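(* If $G$ is a $(P_6,C_4)$-free graph, then $\chi(G)\le \left\lceil \frac{\Delta(G)+\omega(G)+1}{2}\right\rceil$.
   Context: $P_6$ is the path on 6 vertices and $C_4$ the cycle on 4 vertices; $(P_6,C_4)$-free means no induced subgraph isomorphic to $P_6$ or $C_4$. $\Delta(G)$ is the maximum degree, $\omega(G)$ the clique number and $\chi(G)$ the chromatic number of $G$. *)

theory Defs
  imports Complex_Main
begin

definition simple_graph :: "'a set \<Rightarrow> ('a \<Rightarrow> 'a \<Rightarrow> bool) \<Rightarrow> bool" where
  "simple_graph V E \<longleftrightarrow> finite V \<and> (\<forall>u v. E u v \<longrightarrow> u \<in> V \<and> v \<in> V)
     \<and> (\<forall>u v. E u v \<longrightarrow> E v u) \<and> (\<forall>v. \<not> E v v)"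

definition has_induced_P6 :: "'a set \<Rightarrow> ('a \<Rightarrow> 'a \<Rightarrow> bool) \<Rightarrow> bool" where
  "has_induced_P6 V E \<longleftrightarrow> (\<exists>f :: nat \<Rightarrow> 'a. inj_on f {0..<6} \<and> f ` {0..<6} \<subseteq> V \<and>
     (\<forall>i<6. \<forall>j<6. E (f i) (f j) \<longleftrightarrow> (i = j + 1 \<or> j = i + 1)))"

definition has_induced_C4 :: "'a set \<Rightarrow> ('a \<Rightarrow> 'a \<Rightarrow> bool) \<Rightarrow> bool" where
  "has_induced_C4 V E \<longleftrightarrow> (\<exists>f :: nat \<Rightarrow> 'a. inj_on f {0..<4} \<and> f ` {0..<4} \<subseteq> V \<and>
     (\<forall>i<4. \<forall>j<4. E (f i) (f j) \<longleftrightarrow> ((i + 1) mod 4 = j \<or> (j + 1) mod 4 = i)))"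

definition degree :: "'a set \<Rightarrow> ('a \<Rightarrow> 'a \<Rightarrow> bool) \<Rightarrow> 'a \<Rightarrow> nat" where
  "degree V E v = card {u \<in> V. E v u}"

text \<open>Maximum degree (0 for the empty graph).\<close>
definition max_degree :: "'a set \<Rightarrow> ('a \<Rightarrow> 'a \<Rightarrow> bool) \<Rightarrow> nat" where
  "max_degree V E = Max (insert 0 (degree V E ` V))"

definition is_clique :: "'a set \<Rightarrow> ('a \<Rightarrow> 'a \<Rightarrow> bool) \<Rightarrow> 'a set \<Rightarrow> bool" where
  "is_clique V E K \<longleftrightarrow> K \<subseteq> V \<and> (\<forall>u\<in>K. \<forall>v\<in>K. u \<noteq> v \<longrightarrow> E u v)"

definition clique_number :: "'a set \<Rightarrow> ('a \<Rightarrow> 'a \<Rightarrow> bool) \<Rightarrow> nat" where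
  "clique_number V E = Max {card K | K. is_clique V E K}"

definition proper_colouring :: "'a set \<Rightarrow> ('a \<Rightarrow> 'a \<Rightarrow> bool) \<Rightarrow> nat \<Rightarrow> ('a \<Rightarrow> nat) \<Rightarrow> bool" where
  "proper_colouring V E k c \<longleftrightarrow> c ` V \<subseteq> {0..<k} \<and> (\<forall>u\<in>V. \<forall>v\<in>V. E u v \<longrightarrow> c u \<noteq> c v)"

definition chromatic_number :: "'a set \<Rightarrow> ('a \<Rightarrow> 'a \<Rightarrow> bool) \<Rightarrow> nat" where
  "chromatic_number V E = (LEAST k. \<exists>c. proper_colouring V E k c)"

end

theory Submission
  imports Defs
begin

text \<open>Let \<open>G\<close> be a minimal counterexample, \<open>D = \<Delta> + 1\<close> and \<open>n x\<close> the size of the closed neighbourhood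
  of \<open>x\<close>. Minimality gives: no clique cutset; \<open>n p + n q \<ge> n x + \<omega> + 2\<close> for all vertices; every
  stable set is missed by a maximum clique; and more generally no set of vertices that can be
  coloured with \<open>s\<close> colours lowers \<open>D\<close> and \<open>\<omega>\<close> together by \<open>2s\<close> when it is removed. The
  vertices around an induced \<open>C\<^sub>6\<close> fall into few types; counting neighbours of suitable
  vertices contradicts the inequality above, except for blowups of the Petersen graph, where one
  removes a Petersen graph. Then pyramids (three triangle vertices joined by paths of length 2 to a
  common vertex) are excluded, then \<open>C\<^sub>5\<close>: around a \<open>C\<^sub>5\<close> of maximum total degree the graph is
  a ring of five cliques, from which one removes two top vertices of each clique. Finally, two
  non-adjacent neighbours of a component of the non-neighbours of a vertex lie in a hole.\<close>

section \<open>Minimal counterexamples\<close>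

text \<open>A greedy colouring forces every \<open>n v\<close> to be at least half of
  \<open>D + w + 2\<close>, so all degrees are large; this is what gives counting its force. For
  well-chosen vertices a pointwise inequality between indicators such as \<open>R y p\<close> is
  proved for every \<open>y\<close> and summed over \<open>V\<close>. It bounds
  \<open>n p + n q\<close> by \<open>n x + w\<close>, where \<open>w\<close> bounds the size of a
  clique that absorbs the excess, or it bounds a sum of several such pairs. This contradicts
  \<open>two_n\<close>.

  Counting needs control over how each vertex meets the hole, and vertices with few or no neighbours
  on it escape that control. They are excluded through clique cutsets instead: a set of such
  vertices has two non-adjacent attachments, joined through it by a short induced path, and this
  path clashes with the hole.

  The order of the exclusions matters. Six-holes are treated with the fact that five-holes dominate
  the graph, pyramids with the absence of six-holes as well, and five-holes with the absence of
  six-holes and pyramids.\<close>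

text \<open>\<open>D\<close> bounds the sizes of closed neighbourhoods, that is, \<open>\<Delta> + 1\<close>. Minimality ranges over arbitrary
  bounds \<open>D'\<close>, \<open>w'\<close>, \<open>k'\<close>, so that both may be lowered by different amounts when vertices are removed.\<close>

locale critical_graph =
  fixes V :: "'a set" and E :: "'a \<Rightarrow> 'a \<Rightarrow> bool" and D w k :: nat
  assumes finite_V: "finite V"
    and E_sym: "E u v \<Longrightarrow> E v u"
    and E_irrefl: "\<not> E v v"
    and no_P6: "\<not> has_induced_P6 V E"
    and no_C4: "\<not> has_induced_C4 V E"
    and degree_bound: "x \<in> V \<Longrightarrow> card {y \<in> V. x = y \<or> E x y} \<le> D"
    and clique_bound: "is_clique V E K \<Longrightarrow> card K \<le> w"
    and D_w_k: "D + w \<le> 2 * k"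
    and not_colourable: "\<not> proper_colouring V E k c"
    and smaller_colourable:
      "\<lbrakk>W \<subset> V; \<And>x. x \<in> W
      \<Longrightarrow> card {y \<in> W. x = y \<or> E x y} \<le> D';
        \<And>K. is_clique W E K \<Longrightarrow> card K \<le> w'; D' + w' \<le> 2 * k'\<rbrakk>
       \<Longrightarrow> \<exists>c. proper_colouring W E k' c"
begin

text \<open>\<open>R\<close> is reflexive adjacency, so an induced subgraph on distinct vertices is described by \<open>R\<close> alone,
  and in a configuration such as \<open>C4\<close> below coinciding vertices need no separate treatment.\<close>

definition R :: "'a \<Rightarrow> 'a \<Rightarrow> bool" where
  "R x y \<longleftrightarrow> x \<in> V \<and> y \<in> V \<and> (x = y \<or> E x y)"

abbreviation n :: "'a \<Rightarrow> nat" where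
  "n x \<equiv> card {y \<in> V. R x y}"

definition cliq :: "'a set \<Rightarrow> bool" where
  "cliq K \<longleftrightarrow> (\<forall>x\<in>K. \<forall>y\<in>K. R x y)"

lemma R_sym: "R x y \<Longrightarrow> R y x"
  unfolding R_def using E_sym by blast

lemma R_commute: "R x y \<longleftrightarrow> R y x"
  using R_sym by blast

lemma R_refl: "x \<in> V \<Longrightarrow> R x x"
  by (simp add: R_def)

lemma R_V: "R x y \<Longrightarrow> x \<in> V" "R x y \<Longrightarrow> y \<in> V"
  by (simp_all add: R_def)

lemma cliq_iff: "cliq K \<longleftrightarrow> is_clique V E K"
  unfolding cliq_def is_clique_def R_def by blast

lemma cliq_card: "cliq K \<Longrightarrow> card K \<le> w"
  by (simp add: cliq_iff clique_bound)

lemma cliq_subset: "cliq K \<Longrightarrow> K \<subseteq> V"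
  by (simp add: cliq_iff is_clique_def)

lemma n_le: "x \<in> V \<Longrightarrow> n x \<le> D"
  using degree_bound[of x] by (simp add: R_def conj_commute cong: conj_cong)

lemma C4:
  assumes "R a b" "R b c" "R c d" "R d a"
  shows "R a c \<or> R b d"
proof (rule ccontr)
  assume n: "\<not> (R a c \<or> R b d)"
  define f where "f i = (if i = 0 then a else if i = 1 then b else if i = (2::nat) then c else d)" for i
  have in_V: "a \<in> V" "b \<in> V" "c \<in> V" "d \<in> V"
    using assms R_V by blast+
  \<comment> \<open>Equal opposite vertices would be adjacent by reflexivity; equal consecutive ones
    would turn another edge of the cycle into a diagonal.\<close>
  have ne: "a \<noteq> b" "a \<noteq> c" "a \<noteq> d" "b \<noteq> c" "b \<noteq> d" "c \<noteq> d"
    using n assms in_V R_commute R_refl by metis+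
  have adj: "E a b" "E b a" "E b c" "E c b" "E c d" "E d c" "E d a" "E a d"
    "\<not> E a c" "\<not> E c a" "\<not> E b d" "\<not> E d b"
    using assms n ne in_V E_sym unfolding R_def by metis+
  have all_less4: "(\<forall>i<4. P i) \<longleftrightarrow>
    P 0 \<and> P 1 \<and> P 2 \<and> P 3" for P :: "nat \<Rightarrow> bool"
    by (simp add: numeral_eq_Suc All_less_Suc conj_ac)
  have set4: "{0..<4} = {0, 1, 2, 3::nat}"
    by auto
  have "has_induced_C4 V E"
    unfolding has_induced_C4_def
    by (rule exI[of _ f])
      (simp add: f_def set4 all_less4 inj_on_def in_V ne ne[symmetric] adj E_irrefl)
  then show False
    using no_C4 by simp
qed

lemma P6:
  assumes "R a b" "R b c" "R c d" "R d e" "R e f"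
  shows "R a c \<or> R a d \<or> R a e \<or> R a f \<or> R b d \<or> R b e \<or> R b f \<or> R c e \<or>
    R c f \<or> R d f"
proof (rule ccontr)
  assume n: "\<not> ?thesis"
  define g where "g i = (if i = 0 then a else if i = 1 then b else if i = (2::nat) then c
    else if i = 3 then d else if i = 4 then e else f)" for i
  have in_V: "a \<in> V" "b \<in> V" "c \<in> V" "d \<in> V" "e \<in> V" "f \<in> V"
    using assms R_V by blast+
  have nR: "\<not> R a c" "\<not> R a d" "\<not> R a e" "\<not> R a f" "\<not> R b d" "\<not> R b e"
    "\<not> R b f"
    "\<not> R c e" "\<not> R c f" "\<not> R d f"
    using n by auto
  have ne0: "a \<noteq> c" "a \<noteq> d" "a \<noteq> e" "a \<noteq> f" "b \<noteq> d" "b \<noteq> e"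
    "b \<noteq> f" "c \<noteq> e" "c \<noteq> f" "d \<noteq> f"
    using nR in_V R_refl by metis+
  have ne1: "a \<noteq> b" "b \<noteq> c" "c \<noteq> d" "d \<noteq> e" "e \<noteq> f"
    using nR assms by metis+
  note ne = ne0 ne1
  have adj0: "E a b" "E b c" "E c d" "E d e" "E e f"
    using assms ne1 unfolding R_def by blast+
  have adj1: "\<not> E a c" "\<not> E a d" "\<not> E a e" "\<not> E a f" "\<not> E b d" "\<not> E b e"
    "\<not> E b f"
    "\<not> E c e" "\<not> E c f" "\<not> E d f"
    using nR in_V unfolding R_def by blast+
  have adj2: "\<not> E c a" "\<not> E d a" "\<not> E e a" "\<not> E f a" "\<not> E d b" "\<not> E e b"
    "\<not> E f b"
    "\<not> E e c" "\<not> E f c" "\<not> E f d"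
    using adj1 E_sym by blast+
  note adj = adj0 adj0[THEN E_sym] adj1 adj2
  have all_less6: "(\<forall>i<6. P i) \<longleftrightarrow>
    P 0 \<and> P 1 \<and> P 2 \<and> P 3 \<and> P 4 \<and> P 5"
    for P :: "nat \<Rightarrow> bool"
    by (simp add: numeral_eq_Suc All_less_Suc conj_ac)
  have set6: "{0..<6} = {0, 1, 2, 3, 4, 5::nat}"
    by auto
  have "has_induced_P6 V E"
    unfolding has_induced_P6_def
    by (rule exI[of _ g])
      (simp add: g_def set6 all_less6 inj_on_def in_V ne ne[symmetric] adj E_irrefl)
  then show False
    using no_P6 by simp
qed

text \<open>The graph on \<open>V - X\<close> obeys the bounds \<open>D - a\<close> and
  \<open>w - b\<close>, so minimality colours it with \<open>k - s\<close> colours, and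
  \<open>s\<close> fresh colours above these serve \<open>X\<close>. Since \<open>V - X\<close> may
  be empty, \<open>a \<le> D\<close> is asked separately; it keeps the natural subtraction
  exact.\<close>

lemma removal:
  assumes X: "X \<subseteq> V" "X \<noteq> {}" and col: "proper_colouring X E s c"
    and a: "a \<le> D" "\<And>x. x \<in> V - X \<Longrightarrow> card {y \<in> V - X. R x y} + a \<le> D"
    and b: "\<And>K. cliq K \<Longrightarrow> K \<inter> X = {} \<Longrightarrow> card K + b \<le> w"
    and s: "2 * s \<le> a + b"
  shows False
proof -
  \<comment> \<open>The empty clique avoids \<open>X\<close>, so the hypothesis on cliques already
    contains this bound.\<close>
  have b0: "b \<le> w"
    using b[of "{}"] by (simp add: cliq_def)
  have "\<exists>c. proper_colouring (V - X) E (k - s) c"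
  proof (rule smaller_colourable)
    show "V - X \<subset> V"
      using X by blast
    show "card {y \<in> V - X. x = y \<or> E x y} \<le> D - a" if "x \<in> V - X" for x
    proof -
      have "{y \<in> V - X. x = y \<or> E x y} = {y \<in> V - X. R x y}"
        using that by (auto simp: R_def)
      then show ?thesis
        using a(2)[OF that] by simp
    qed
    show "card K \<le> w - b" if "is_clique (V - X) E K" for K
    proof -
      have "cliq K" "K \<inter> X = {}"
        using that unfolding cliq_iff is_clique_def by blast+
      then show ?thesis
        using b[of K] by simp
    qed
    show "D - a + (w - b) \<le> 2 * (k - s)"
      using D_w_k a(1) b0 s by simp
  qed
  then obtain c' where c': "proper_colouring (V - X) E (k - s) c'"
    by blast
  have sk: "s \<le> k"
    using D_w_k a(1) b0 s by linarith
  have "proper_colouring V E k (\<lambda>x. if x \<in> X then k - s + c x else c' x)"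
    unfolding proper_colouring_def
  proof (intro conjI ballI impI)
    show "(\<lambda>x. if x \<in> X then k - s + c x else c' x) ` V \<subseteq> {0..<k}"
    proof (rule image_subsetI)
      fix x assume x: "x \<in> V"
      show "(if x \<in> X then k - s + c x else c' x) \<in> {0..<k}"
      proof (cases "x \<in> X")
        case True
        then have "c x < s"
          using col unfolding proper_colouring_def by auto
        then show ?thesis
          using True sk by simp
      next
        case False
        then have "c' x < k - s"
          using c' x unfolding proper_colouring_def by auto
        then show ?thesis
          using False by simp
      qed
    qed
  next
    fix u v assume uv: "u \<in> V" "v \<in> V" "E u v"
    have lt: "c' x < k - s" if "x \<in> V" "x \<notin> X" for x
      using c' that unfolding proper_colouring_def by auto
    show "(if u \<in> X then k - s + c u else c' u) \<noteq> (if v \<in> X then k - s + c v else c' v)"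
    proof (cases "u \<in> X \<longleftrightarrow> v \<in> X")
      case True
      then show ?thesis
        using col c' uv unfolding proper_colouring_def by auto
    next
      case False
      then show ?thesis
        using lt[of u] lt[of v] uv by auto
    qed
  qed
  then show False
    using not_colourable by blast
qed

lemma V_nonempty: "V \<noteq> {}"
proof
  assume "V = {}"
  then have "proper_colouring V E k (\<lambda>_. 0)"
    by (simp add: proper_colouring_def)
  then show False
    using not_colourable by blast
qed

text \<open>Otherwise a colouring of the graph without \<open>v\<close> extends greedily to \<open>v\<close>.\<close>

lemma n_lower:
  assumes v: "v \<in> V"
  shows "D + w + 2 \<le> 2 * n v"
proof (rule ccontr)
  assume "\<not> ?thesis"
  then have nk: "n v \<le> k"
    using D_w_k by linarith
  have "\<exists>c. proper_colouring (V - {v}) E k c"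
  proof (rule smaller_colourable[OF _ _ _ D_w_k])
    show "V - {v} \<subset> V"
      using v by blast
    show "card {y \<in> V - {v}. x = y \<or> E x y} \<le> D" if "x \<in> V - {v}" for x
    proof -
      have "card {y \<in> V - {v}. x = y \<or> E x y} \<le> card {y \<in> V. x = y \<or> E x y}"
        by (rule card_mono) (use finite_V in auto)
      then show ?thesis
        using degree_bound[of x] that by simp
    qed
    show "card K \<le> w" if "is_clique (V - {v}) E K" for K
      using that clique_bound[of K] unfolding is_clique_def by blast
  qed
  then obtain c where c: "proper_colouring (V - {v}) E k c"
    by blast
  define N where "N = {y \<in> V. E v y}"
  have N: "N \<subseteq> V - {v}" "finite N"
    using E_irrefl finite_V by (auto simp: N_def)
  have "{y \<in> V. R v y} = insert v N"
    using v by (auto simp: N_def R_def)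
  then have "card N < k"
    using nk N by (simp add: card_insert_if subset_Diff_insert)
  then have "card (c ` N) < card {0..<k}"
    using card_image_le[OF N(2), of c] by simp
  then obtain i where i: "i \<in> {0..<k}" "i \<notin> c ` N"
    by (metis card_mono finite_imageI N(2) not_le subsetI)
  have "proper_colouring V E k (c(v := i))"
    unfolding proper_colouring_def
  proof (intro conjI ballI impI)
    show "(c(v := i)) ` V \<subseteq> {0..<k}"
      using c i(1) unfolding proper_colouring_def by auto
  next
    fix x y assume xy: "x \<in> V" "y \<in> V" "E x y"
    show "(c(v := i)) x \<noteq> (c(v := i)) y"
    proof (cases "x = v \<or> y = v")
      case True
      then show ?thesis
        using xy i(2) E_sym E_irrefl by (auto simp: N_def)
    next
      case False
      then show ?thesis
        using c xy unfolding proper_colouring_def by auto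
    qed
  qed
  then show False
    using not_colourable by blast
qed

text \<open>\<open>n_lower\<close> is added for \<open>p\<close> and \<open>q\<close>, and
  \<open>D\<close> is at least \<open>n x\<close>. The counting arguments end against this
  inequality, sometimes with \<open>p = q\<close>.\<close>

lemma two_n:
  assumes "p \<in> V" "q \<in> V" "x \<in> V"
  shows "n x + w + 2 \<le> n p + n q"
  using n_lower[OF assms(1)] n_lower[OF assms(2)] n_le[OF assms(3)] by linarith

definition stab :: "'a set \<Rightarrow> bool" where
  "stab S \<longleftrightarrow> S \<subseteq> V \<and>
  (\<forall>x\<in>S. \<forall>y\<in>S. R x y \<longrightarrow> x = y)"

text \<open>Extend \<open>S\<close> to a maximal stable set \<open>T\<close>. It dominates the
  graph, so removing it lowers every \<open>n x\<close> by 1 at the price of one colour. If every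
  maximum clique met \<open>S\<close>, the clique bound would drop by 1 too, and
  \<open>removal\<close> applies with \<open>s = a = b = 1\<close>.\<close>

lemma missed_clique:
  assumes "stab S"
  shows "\<exists>K. cliq K \<and> card K = w \<and> K \<inter> S = {}"
proof (rule ccontr)
  assume no: "\<not> ?thesis"
  have "finite {T. stab T \<and> S \<subseteq> T}"
    by (rule finite_subset[of _ "Pow V"]) (auto simp: stab_def finite_V)
  then obtain T where T: "stab T" "S \<subseteq> T"
    and max: "\<And>T'. stab T' \<Longrightarrow> S \<subseteq> T'
      \<Longrightarrow> T \<subseteq> T' \<Longrightarrow> T = T'"
    using finite_has_maximal2[of "{T. stab T \<and> S \<subseteq> T}" S] assms
    by (metis (mono_tags, lifting) mem_Collect_eq order_refl)
  have TV: "T \<subseteq> V"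
    using T by (simp add: stab_def)
  have dom: "\<exists>t\<in>T. R x t" if "x \<in> V" for x
  proof (rule ccontr)
    assume none: "\<not> ?thesis"
    then have "stab (insert x T)"
      using T(1) that R_sym unfolding stab_def by blast
    then have "x \<in> T"
      using max[of "insert x T"] T(2) by blast
    then show False
      using none R_refl that by blast
  qed
  have T_ne: "T \<noteq> {}"
    using dom V_nonempty by blast
  obtain v where v: "v \<in> V"
    using V_nonempty by blast
  have "0 < n v"
    using v R_refl finite_V by (auto simp: card_gt_0_iff)
  then have D1: "1 \<le> D"
    using n_le[OF v] by linarith
  show False
  proof (rule removal[OF TV T_ne])
    show "proper_colouring T E 1 (\<lambda>_. 0)"
      using T(1) E_irrefl unfolding proper_colouring_def stab_def R_def by (simp, blast)
    show "1 \<le> D"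
      by fact
    show "card {y \<in> V - T. R x y} + 1 \<le> D" if x: "x \<in> V - T" for x
    proof -
      obtain t where t: "t \<in> T" "R x t"
        using dom[of x] x by blast
      have "insert t {y \<in> V - T. R x y} \<subseteq> {y \<in> V. R x y}"
        using t R_V by blast
      then have "card (insert t {y \<in> V - T. R x y}) \<le> n x"
        by (rule card_mono[rotated]) (use finite_V in auto)
      then show ?thesis
        using n_le[of x] x t(1) finite_V by (simp add: card_insert_if)
    qed
    show "card K + 1 \<le> w" if "cliq K" "K \<inter> T = {}" for K
    proof -
      have "K \<inter> S = {}"
        using that(2) T(2) by blast
      then have "card K \<noteq> w"
        using no that(1) by blast
      then show ?thesis
        using cliq_card[OF that(1)] by linarith
    qed
  qed simp
qed

lemma max_clique_extend:
  assumes "cliq K" "card K = w" "v \<in> V" "v \<notin> K"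
  shows "\<exists>x\<in>K. \<not> R x v"
proof (rule ccontr)
  assume "\<not> ?thesis"
  then have "cliq (insert v K)"
    using assms(1,3) R_sym R_refl unfolding cliq_def by blast
  then have "card (insert v K) \<le> w"
    by (rule cliq_card)
  then show False
    using assms(2,4) finite_subset[OF cliq_subset[OF assms(1)] finite_V] by simp
qed

lemma no_universal:
  assumes v: "v \<in> V" and univ: "\<And>y. y \<in> V \<Longrightarrow> R v y"
  shows False
proof -
  have "stab {v}"
    using v by (auto simp: stab_def)
  then obtain K where K: "cliq K" "card K = w" "K \<inter> {v} = {}"
    using missed_clique by blast
  then obtain x where "x \<in> K" "\<not> R x v"
    using max_clique_extend[of K v] v by blast
  then show False
    using univ K cliq_subset R_sym by blast
qed

text \<open>Both sides can be coloured by minimality. Each colouring is injective on the clique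
  \<open>S\<close>, so a permutation of the colours of one side makes the two agree there.\<close>

lemma no_clique_cutset:
  assumes S: "cliq S" and V: "V = P \<union> S \<union> Q" "P \<inter> S = {}" "Q \<inter> S = {}"
    "P \<inter> Q = {}"
    and ne: "P \<noteq> {}"
      "Q \<noteq> {}" and sep: "\<And>p q. p \<in> P \<Longrightarrow> q \<in> Q
      \<Longrightarrow> \<not> R p q"
  shows False
proof -
  have col: "\<exists>c. proper_colouring W E k c" if W: "W \<subset> V" for W
  proof (rule smaller_colourable[OF W _ _ D_w_k])
    show "card {y \<in> W. x = y \<or> E x y} \<le> D" if "x \<in> W" for x
    proof -
      have "card {y \<in> W. x = y \<or> E x y} \<le> card {y \<in> V. x = y \<or> E x y}"
        by (rule card_mono) (use finite_V W in auto)
      then show ?thesis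
        using degree_bound[of x] that W by force
    qed
    show "card K \<le> w" if "is_clique W E K" for K
      using that clique_bound[of K] W unfolding is_clique_def by blast
  qed
  have sub_V: "P \<union> S \<subset> V" "Q \<union> S \<subset> V"
    using ne unfolding V(1) using V(2-4) by auto
  obtain c1 where c1: "proper_colouring (P \<union> S) E k c1"
    using col[OF sub_V(1)] by blast
  obtain c2 where c2: "proper_colouring (Q \<union> S) E k c2"
    using col[OF sub_V(2)] by blast
  have inj: "inj_on c1 S" "inj_on c2 S"
  proof -
    have "E x y" if "x \<in> S" "y \<in> S" "x \<noteq> y" for x y
      using S that unfolding cliq_def R_def by blast
    then show "inj_on c1 S" "inj_on c2 S"
      using c1 c2 unfolding inj_on_def proper_colouring_def by (metis UnI2)+
  qed
  have fin_S: "finite S"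
    using finite_subset[OF cliq_subset[OF S] finite_V] .
  have sub: "c1 ` S \<subseteq> {0..<k}" "c2 ` S \<subseteq> {0..<k}"
    using c1 c2 unfolding proper_colouring_def by blast+
  have "card ({0..<k} - c2 ` S) = card ({0..<k} - c1 ` S)"
    using sub inj fin_S by (simp add: card_Diff_subset card_image)
  then obtain g where g: "bij_betw g ({0..<k} - c2 ` S) ({0..<k} - c1 ` S)"
    using finite_same_card_bij by (metis finite_Diff finite_atLeastLessThan)
  \<comment> \<open>\<open>h\<close> is that permutation: on the colours used by \<open>c2\<close>
    on \<open>S\<close> it is dictated by \<open>c1\<close>, and \<open>g\<close> matches the
    remaining colours.\<close>
  define h where "h i = (if i \<in> c2 ` S then c1 (inv_into S c2 i) else g i)" for i
  have h_S: "h (c2 s) = c1 s" if "s \<in> S" for s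
    using that inj(2) by (simp add: h_def)
  have h_g: "h i \<in> {0..<k} - c1 ` S" if "i \<in> {0..<k} - c2 ` S" for i
    using that bij_betwE[OF g] by (simp add: h_def)
  have h_range: "h i \<in> {0..<k}" if "i \<in> {0..<k}" for i
  proof (cases "i \<in> c2 ` S")
    case True
    then show ?thesis
      using h_S sub(1) by auto
  next
    case False
    then show ?thesis
      using h_g[of i] that by simp
  qed
  have h_inj: "inj_on h {0..<k}"
  proof (rule inj_onI)
    fix i j assume ij: "i \<in> {0..<k}" "j \<in> {0..<k}" "h i = h j"
    show "i = j"
    proof (cases "i \<in> c2 ` S")
      case True
      then obtain s where s: "s \<in> S" "i = c2 s"
        by blast
      have "j \<in> c2 ` S"
      proof (rule ccontr)
        assume "j \<notin> c2 ` S"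
        then have "h j \<notin> c1 ` S"
          using ij(2) h_g[of j] by simp
        then show False
          using s h_S[OF s(1)] ij(3) by (metis imageI)
      qed
      then obtain t where t: "t \<in> S" "j = c2 t"
        by blast
      then have "c1 s = c1 t"
        using s h_S ij(3) by simp
      then show ?thesis
        using s t inj(1) by (simp add: inj_on_eq_iff)
    next
      case False
      have "j \<notin> c2 ` S"
      proof
        assume "j \<in> c2 ` S"
        then obtain t where t: "t \<in> S" "j = c2 t"
          by blast
        have "h i \<notin> c1 ` S"
          using ij(1) h_g[of i] False by simp
        then show False
          using t h_S[OF t(1)] ij(3) by (metis imageI)
      qed
      then have "g i = g j"
        using ij(3) False by (simp add: h_def)
      then show ?thesis
        using bij_betw_imp_inj_on[OF g] ij(1,2) False \<open>j \<notin> c2 ` S\<close> by (simp add: inj_on_eq_iff)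
    qed
  qed
  have "proper_colouring V E k (\<lambda>x. if x \<in> P then c1 x else h (c2 x))" (is "proper_colouring V E k ?c")
    unfolding proper_colouring_def
  proof (intro conjI ballI impI)
    have r1: "c1 x \<in> {0..<k}" if "x \<in> P" for x
      using c1 that unfolding proper_colouring_def by blast
    have r2: "c2 x \<in> {0..<k}" if "x \<in> Q \<union> S" for x
      using c2 that unfolding proper_colouring_def by blast
    show "?c ` V \<subseteq> {0..<k}"
    proof (rule image_subsetI)
      fix x assume "x \<in> V"
      then have "x \<in> P \<or> x \<in> Q \<union> S"
        by (simp add: V(1)) blast
      then show "?c x \<in> {0..<k}"
        using r1 h_range[OF r2] by presburger
    qed
    fix u v assume uv: "u \<in> V" "v \<in> V" "E u v"
    have eq1: "?c x = c1 x" if "x \<in> P \<union> S" for x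
      using that V(2) h_S by (cases "x \<in> P") auto
    have eq2: "?c x = h (c2 x)" if "x \<in> Q \<union> S" for x
      using that V(2,4) by auto
    have "\<not> (u \<in> P \<and> v \<in> Q)" "\<not> (u \<in> Q \<and> v \<in> P)"
      using sep uv E_sym unfolding R_def by (metis, metis)
    then consider "u \<in> P \<union> S" "v \<in> P \<union> S" | "u \<in> Q \<union> S"
      "v \<in> Q \<union> S"
      using uv(1,2) unfolding V(1) by blast
    then show "?c u \<noteq> ?c v"
    proof cases
      case 1
      then have "c1 u \<noteq> c1 v"
        using c1 uv(3) unfolding proper_colouring_def by blast
      then show ?thesis
        using eq1[OF 1(1)] eq1[OF 1(2)] by simp
    next
      case 2
      then have "c2 u \<noteq> c2 v"
        using c2 uv(3) unfolding proper_colouring_def by blast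
      then have "h (c2 u) \<noteq> h (c2 v)"
        using h_inj r2 2 unfolding inj_on_def by blast
      then show ?thesis
        using eq2[OF 2(1)] eq2[OF 2(2)] by simp
    qed
  qed
  then show False
    using not_colourable by blast
qed

section \<open>Induced paths through a connected set\<close>

definition walk :: "'a set \<Rightarrow> nat \<Rightarrow> (nat \<Rightarrow> 'a) \<Rightarrow> bool" where
  "walk Q m f \<longleftrightarrow>
  (\<forall>i<m. R (f i) (f (Suc i))) \<and> (\<forall>i. 0 < i \<and>
  i < m \<longrightarrow> f i \<in> Q)"

text \<open>A chord replaces \<open>j - i\<close> edges by a single one, which explains the new
  length. It follows that a shortest walk is induced.\<close>

lemma walk_shortcut:
  assumes f: "walk Q m f" and ij: "Suc i < j" "j \<le> m" and R: "R (f i) (f j)"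
  shows "\<exists>g. walk Q (m - (j - Suc i)) g \<and> g 0 = f 0 \<and> g (m - (j - Suc i)) = f m"
proof -
  define g where "g l = (if l \<le> i then f l else f (l + (j - Suc i)))" for l
  have "R (g l) (g (Suc l))" if "l < m - (j - Suc i)" for l
  proof -
    consider "l < i" | "l = i" | "i < l"
      by linarith
    then show ?thesis
    proof cases
      case 1
      then show ?thesis
        using f ij unfolding walk_def g_def by auto
    next
      case 2
      then show ?thesis
        using R ij unfolding g_def by auto
    next
      case 3
      then have "R (f (l + (j - Suc i))) (f (Suc (l + (j - Suc i))))"
        using f that ij unfolding walk_def by auto
      then show ?thesis
        using 3 by (simp add: g_def)
    qed
  qed
  moreover have "g l \<in> Q" if "0 < l" "l < m - (j - Suc i)" for l
    using f that ij unfolding walk_def g_def by auto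
  ultimately have "walk Q (m - (j - Suc i)) g"
    unfolding walk_def by blast
  moreover have "g 0 = f 0" "g (m - (j - Suc i)) = f m"
    using ij by (auto simp: g_def)
  ultimately show ?thesis
    by blast
qed

text \<open>Two non-adjacent neighbours of a connected set are joined through it by an induced path,
  which has at most three inner vertices since there is no induced \<open>P\<^sub>6\<close>. Such neighbours exist
  because the neighbourhood of a component is not a clique cutset.\<close>

lemma attached_path:
  assumes Z: "Z \<subseteq> V" "z0 \<in> Z" and v: "v \<in> V" "v \<notin> Z"
    "\<And>z. z \<in> Z \<Longrightarrow> \<not> R v z"
  obtains s t q1 where "s \<in> V - Z" "t \<in> V - Z" "\<not> R s t" "q1 \<in> Z" "R s q1" "R q1 t"
  | s t q1 q2 where "s \<in> V - Z" "t \<in> V - Z" "\<not> R s t" "q1 \<in> Z" "q2 \<in> Z"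
      "R s q1" "R q1 q2" "R q2 t" "\<not> R s q2" "\<not> R q1 t"
  | s t q1 q2 q3 where "s \<in> V - Z" "t \<in> V - Z" "\<not> R s t" "q1 \<in> Z" "q2 \<in> Z"
    "q3 \<in> Z"
      "R s q1" "R q1 q2" "R q2 q3" "R q3 t" "\<not> R s q2" "\<not> R s q3" "\<not> R q1 q3"
      "\<not> R q1 t" "\<not> R q2 t"
proof -
  define r where "r = {(x, y). x \<in> Z \<and> y \<in> Z \<and> R x y}"
  \<comment> \<open>\<open>Q\<close> is the component of \<open>z0\<close> inside \<open>Z\<close>,
    and \<open>S\<close> will be the set of its neighbours outside. A neighbour inside
    \<open>Z\<close> belongs to \<open>Q\<close> itself, so \<open>S\<close> avoids all of
    \<open>Z\<close>.\<close>
  define Q where "Q = {y. (z0, y) \<in> r\<^sup>*}"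
  define S where "S = {s \<in> V - Q. \<exists>q\<in>Q. R s q}"
  have QZ: "Q \<subseteq> Z"
  proof
    fix y assume "y \<in> Q"
    then have "(z0, y) \<in> r\<^sup>*"
      by (simp add: Q_def)
    then show "y \<in> Z"
      by induction (use Z in \<open>auto simp: r_def\<close>)
  qed
  have step: "y \<in> Q" if "q \<in> Q" "y \<in> Z" "R q y" for q y
    using that QZ unfolding Q_def r_def by (auto intro: rtrancl_into_rtrancl)
  have SZ: "S \<subseteq> V - Z"
    unfolding S_def using step R_sym by blast
  \<comment> \<open>Otherwise \<open>S\<close> would be a clique cutset between \<open>Q\<close> and
    the rest, which contains \<open>v\<close>.\<close>
  have "\<not> cliq S"
  proof
    assume S: "cliq S"
    show False
    proof (rule no_clique_cutset[OF S, of Q "V - Q - S"])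
      show "V = Q \<union> S \<union> (V - Q - S)"
        using QZ Z(1) SZ by blast
      show "Q \<inter> S = {}"
        by (auto simp: S_def)
      show "Q \<noteq> {}"
        by (auto simp: Q_def)
      show "V - Q - S \<noteq> {}"
        using v QZ R_sym unfolding S_def by blast
      show "\<not> R p q" if "p \<in> Q" "q \<in> V - Q - S" for p q
        using that R_sym by (auto simp: S_def)
    qed auto
  qed
  then obtain s t where st: "s \<in> S" "t \<in> S" "\<not> R s t"
    by (auto simp: cliq_def)
  have reach: "\<exists>m f. walk Q m f \<and> 0 < m \<and> f 0 = s \<and> f m = q" if "q \<in> Q" for q
  proof -
    obtain p where p: "p \<in> Q" "R s p"
      using st(1) by (auto simp: S_def)
    have "(p, z0) \<in> r\<^sup>*"
    proof -
      have "sym r"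
        using R_sym by (auto simp: sym_def r_def)
      then show ?thesis
        using p(1) symD[OF sym_rtrancl] by (simp add: Q_def)
    qed
    then have "(p, q) \<in> r\<^sup>*"
      using that by (auto simp: Q_def)
    then show ?thesis
    proof induction
      case base
      show ?case
        by (rule exI[of _ 1], rule exI[of _ "\<lambda>i. if i = 0 then s else p"]) (auto simp: walk_def p)
    next
      case (step y z)
      then obtain m f where f: "walk Q m f" "0 < m" "f 0 = s" "f m = y"
        by blast
      have "y \<in> Q"
        using step(1) p(1) by (auto simp: Q_def)
      then have "walk Q (Suc m) (f(Suc m := z))"
        using f step(2) unfolding walk_def r_def by (auto simp: less_Suc_eq)
      moreover have "(f(Suc m := z)) 0 = s" "(f(Suc m := z)) (Suc m) = z"
        using f by simp_all
      ultimately show ?case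
        by blast
    qed
  qed
  have ex: "\<exists>m f. walk Q m f \<and> f 0 = s \<and> f m = t"
  proof -
    obtain q where q: "q \<in> Q" "R q t"
      using st(2) R_sym by (auto simp: S_def)
    obtain m f where f: "walk Q m f" "0 < m" "f 0 = s" "f m = q"
      using reach[OF q(1)] by blast
    have "walk Q (Suc m) (f(Suc m := t))"
      using f q unfolding walk_def by (auto simp: less_Suc_eq)
    moreover have "(f(Suc m := t)) 0 = s" "(f(Suc m := t)) (Suc m) = t"
      using f by simp_all
    ultimately show ?thesis
      by blast
  qed
  define m where "m = (LEAST m. \<exists>f. walk Q m f \<and> f 0 = s \<and> f m = t)"
  have "\<exists>f. walk Q m f \<and> f 0 = s \<and> f m = t"
    unfolding m_def by (rule LeastI_ex[OF ex])
  then obtain f where f: "walk Q m f" "f 0 = s" "f m = t"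
    by blast
  have short: "\<not> R (f i) (f j)" if ij: "Suc i < j" "j \<le> m" for i j
  proof
    assume "R (f i) (f j)"
    then obtain g where "walk Q (m - (j - Suc i)) g" "g 0 = s" "g (m - (j - Suc i)) = t"
      using walk_shortcut[OF f(1) ij] f by auto
    then have "m \<le> m - (j - Suc i)"
      unfolding m_def by (intro Least_le exI conjI)
    then show False
      using ij by linarith
  qed
  have adj: "R (f i) (f (Suc i))" if "i < m" for i
    using f(1) that by (simp add: walk_def)
  have inQ: "f i \<in> Z" if "0 < i" "i < m" for i
    using f(1) that QZ by (auto simp: walk_def)
  have st': "s \<in> V - Z" "t \<in> V - Z"
    using st SZ by auto
  have "m \<noteq> 0"
    using f(2,3) st(3) st' R_refl by (metis DiffD1)
  moreover have "m \<noteq> 1"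
    using f(2,3) st(3) adj[of 0] by (metis One_nat_def zero_less_one)
  moreover have "m < 5"
  proof (rule ccontr)
    assume "\<not> m < 5"
    moreover from this have "R (f 0) (f 1)" "R (f 1) (f 2)" "R (f 2) (f 3)" "R (f 3) (f 4)"
      "R (f 4) (f 5)"
      using adj[of 0] adj[of 1] adj[of 2] adj[of 3] adj[of 4] by (simp_all add: eval_nat_numeral)
    ultimately show False
      using P6[of "f 0" "f 1" "f 2" "f 3" "f 4" "f 5"] short by simp
  qed
  ultimately consider "m = 2" | "m = 3" | "m = 4"
    by linarith
  then show thesis
  proof cases
    case 1
    then have "f 2 = t" "R s (f 1)" "R (f 1) (f 2)" "f 1 \<in> Z"
      using f adj[of 0] adj[of 1] inQ[of 1] by (simp_all add: eval_nat_numeral)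
    then show thesis
      using that(1)[of s t "f 1"] st(3) st' by simp
  next
    case 2
    then have "f 3 = t" "R s (f 1)" "R (f 1) (f 2)" "R (f 2) (f 3)" "f 1 \<in> Z" "f 2 \<in> Z"
      using f adj[of 0] adj[of 1] adj[of 2] inQ[of 1] inQ[of 2] by (simp_all add: eval_nat_numeral)
    moreover have "\<not> R s (f 2)" "\<not> R (f 1) (f 3)"
      using 2 f short[of 0 2] short[of 1 3] by simp_all
    ultimately show thesis
      using that(2)[of s t "f 1" "f 2"] st(3) st' by simp
  next
    case 3
    then have "f 4 = t" "R s (f 1)" "R (f 1) (f 2)" "R (f 2) (f 3)" "R (f 3) (f 4)"
      "f 1 \<in> Z" "f 2 \<in> Z" "f 3 \<in> Z"
      using f adj[of 0] adj[of 1] adj[of 2] adj[of 3] inQ[of 1] inQ[of 2] inQ[of 3]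
      by (simp_all add: eval_nat_numeral)
    moreover have "\<not> R s (f 2)" "\<not> R s (f 3)" "\<not> R (f 1) (f 3)" "\<not> R (f 1) (f 4)"
      "\<not> R (f 2) (f 4)"
      using 3 f short[of 0 2] short[of 0 3] short[of 1 3] short[of 1 4] short[of 2 4] by simp_all
    ultimately show thesis
      using that(3)[of s t "f 1" "f 2" "f 3"] st(3) st' by simp
  qed
qed

section \<open>Holes of length six\<close>

text \<open>\<open>sees x ps ns\<close>: \<open>x\<close> is a vertex adjacent or equal to all members of \<open>ps\<close> and to none of \<open>ns\<close>. The
  configuration lemmas below are stated with it; each is a propositional consequence of finitely many
  instances of the forbidden subgraphs (found by a SAT search), which are listed in its proof.\<close>

fun sees :: "'a \<Rightarrow> 'a list \<Rightarrow> 'a list \<Rightarrow> bool" where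
  "sees x [] [] \<longleftrightarrow> x \<in> V"
| "sees x [] (q # ns) \<longleftrightarrow> \<not> R x q \<and> sees x [] ns"
| "sees x (p # ps) ns \<longleftrightarrow> R x p \<and> sees x ps ns"

definition hole5 :: "'a \<Rightarrow> 'a \<Rightarrow> 'a \<Rightarrow> 'a \<Rightarrow> 'a \<Rightarrow> bool" where
  "hole5 a b c d e \<longleftrightarrow>
  sees a [b, e] [c, d] \<and> sees b [a, c] [d, e] \<and> sees c [b, d] [a, e] \<and>
     sees d [c, e] [a, b] \<and> sees e [a, d] [b, c]"

definition hole6 :: "'a \<Rightarrow> 'a \<Rightarrow> 'a \<Rightarrow> 'a \<Rightarrow> 'a \<Rightarrow> 'a \<Rightarrow> bool" where
  "hole6 a b c d e f \<longleftrightarrow>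
  sees a [b, f] [c, d, e] \<and> sees b [a, c] [d, e, f] \<and> sees c [b, d] [a, e, f] \<and>
     sees d [c, e] [a, b, f] \<and> sees e [d, f] [a, b, c] \<and> sees f [a, e] [b, c, d]"

lemmas cfg_defs = hole5_def hole6_def sees.simps

text \<open>\<open>far1\<close>, \<open>far2\<close> and \<open>far3\<close> refute the three
  outcomes of \<open>attached_path\<close> for the set of all vertices without neighbours on the
  hole. An attachment with few neighbours on the hole starts an induced \<open>P_6\<close> that runs
  from the far vertices along the hole; otherwise two non-adjacent attachments tend to close a
  \<open>C_4\<close>.\<close>

lemma far1:
  assumes "hole5 v1 v2 v3 v4 v5" "sees q1 [] [v1, v2, v3, v4, v5]"
    "\<not> sees s [] [v1, v2, v3, v4, v5]" "\<not> sees t [] [v1, v2, v3, v4, v5]"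
    "s \<in> V" "t \<in> V" "R s q1" "R q1 t" "\<not> R s t"
  shows False
  using assms
    C4[of s q1 t v1] C4[of s q1 t v3] C4[of s q1 t v4] C4[of s q1 t v5] C4[of v1 s v3 v2]
    C4[of v1 s v4 v5] C4[of v1 t v4 v5] C4[of v2 s q1 t] C4[of v2 s v4 v3] C4[of v2 v1 t v3]
    C4[of v3 v2 t v4] P6[of q1 s v1 v5 v4 v3] P6[of q1 s v2 v3 v4 v5] P6[of q1 s v3 v2 v1 v5]
    P6[of q1 s v3 v4 v5 v1] P6[of q1 s v4 v3 v2 v1] P6[of q1 s v5 v4 v3 v2]
    P6[of q1 t v1 v2 v3 v4] P6[of q1 t v1 v5 v4 v3] P6[of q1 t v2 v1 v5 v4]
    P6[of q1 t v3 v4 v5 v1] P6[of q1 t v4 v5 v1 v2] P6[of q1 t v5 v1 v2 v3]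
  unfolding cfg_defs by (smt (verit) R_commute)

lemma far2:
  assumes "hole5 v1 v2 v3 v4 v5" "sees q1 [] [v1, v2, v3, v4, v5]" "sees q2 [] [v1, v2, v3, v4, v5]"
    "\<not> sees s [] [v1, v2, v3, v4, v5]" "\<not> sees t [] [v1, v2, v3, v4, v5]"
    "s \<in> V" "t \<in> V" "R s q1" "R q1 q2" "R q2 t" "\<not> R s t" "\<not> R s q2" "\<not> R q1 t"
  shows False
  using assms
    C4[of s v3 t v5] C4[of v3 v2 s v4] C4[of v3 v2 t v4] C4[of v5 v1 s v4] C4[of v5 v1 t v4]
    P6[of q1 q2 t v1 v2 v3] P6[of q1 q2 t v1 v5 v4] P6[of q1 q2 t v2 v1 v5]
    P6[of q1 q2 t v2 v3 v4] P6[of q1 s v1 v2 v3 v4] P6[of q1 s v2 v3 v4 v5]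
    P6[of q2 q1 s v3 v4 v5] P6[of q2 q1 s v4 v3 v2] P6[of q2 q1 s v4 v5 v1]
    P6[of q2 q1 s v5 v4 v3] P6[of q2 t v3 v2 v1 v5] P6[of q2 t v4 v5 v1 v2]
    P6[of q2 t v5 v1 v2 v3]
  unfolding cfg_defs by (smt (verit) R_commute)

lemma far3:
  assumes "hole5 v1 v2 v3 v4 v5" "sees q1 [] [v1, v2, v3, v4, v5]" "sees q2 [] [v1, v2, v3, v4, v5]"
    "sees q3 [] [v1, v2, v3, v4, v5]"
    "\<not> sees s [] [v1, v2, v3, v4, v5]" "\<not> sees t [] [v1, v2, v3, v4, v5]"
    "s \<in> V" "t \<in> V" "R s q1" "R q1 q2" "R q2 q3" "R q3 t" "\<not> R s t" "\<not> R s q2"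
    "\<not> R s q3"
    "\<not> R q1 q3" "\<not> R q1 t" "\<not> R q2 t"
  shows False
  using assms
    C4[of s v1 t v3] P6[of q1 q2 q3 t v2 v1] P6[of q1 q2 q3 t v2 v3] P6[of q2 q1 s v2 v1 v5]
    P6[of q2 q1 s v2 v3 v4] P6[of q2 q3 t v1 v5 v4] P6[of q2 q3 t v3 v4 v5]
    P6[of q2 q3 t v4 v3 v2] P6[of q2 q3 t v4 v5 v1] P6[of q2 q3 t v5 v1 v2]
    P6[of q3 q2 q1 s v1 v2] P6[of q3 q2 q1 s v3 v2] P6[of q3 q2 q1 s v4 v3]
    P6[of q3 q2 q1 s v5 v1] P6[of q3 t v5 v4 v3 v2]
  unfolding cfg_defs by (smt (verit) R_commute)

lemma hole5_dominates:
  assumes h: "hole5 v1 v2 v3 v4 v5" and z: "z \<in> V"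
  shows "\<not> sees z [] [v1, v2, v3, v4, v5]"
proof
  assume far: "sees z [] [v1, v2, v3, v4, v5]"
  define Z where "Z = {z. sees z [] [v1, v2, v3, v4, v5]}"
  have V: "v1 \<in> V"
    using h R_V unfolding cfg_defs by blast
  show False
  proof (rule attached_path[of Z z v1])
    show "Z \<subseteq> V" "z \<in> Z"
      using far by (auto simp: Z_def)
    show "v1 \<in> V" "v1 \<notin> Z" "\<And>x. x \<in> Z \<Longrightarrow> \<not> R v1 x"
      using V R_refl R_sym by (auto simp: Z_def)
  next
    fix s t q1
    assume "s \<in> V - Z" "t \<in> V - Z" "\<not> R s t" "q1 \<in> Z" "R s q1" "R q1 t"
    then show False
      using far1[OF h, of q1 s t] unfolding Z_def by blast
  next
    fix s t q1 q2
    assume "s \<in> V - Z" "t \<in> V - Z" "\<not> R s t" "q1 \<in> Z" "q2 \<in> Z" "R s q1" "R q1 q2"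
      "R q2 t"
      "\<not> R s q2" "\<not> R q1 t"
    then show False
      using far2[OF h, of q1 q2 s t] unfolding Z_def by blast
  next
    fix s t q1 q2 q3
    assume "s \<in> V - Z" "t \<in> V - Z" "\<not> R s t" "q1 \<in> Z" "q2 \<in> Z" "q3 \<in> Z"
      "R s q1" "R q1 q2" "R q2 q3"
      "R q3 t" "\<not> R s q2" "\<not> R s q3" "\<not> R q1 q3" "\<not> R q1 t" "\<not> R q2 t"
    then show False
      using far3[OF h, of q1 q2 q3 s t] unfolding Z_def by blast
  qed
qed

text \<open>\<open>hole5_dominates\<close> in the format of \<open>C4\<close> and \<open>P6\<close>:
  a chord is one of the disjuncts, so it can be instantiated without knowing that the five vertices
  form a hole.\<close>

lemma dom5:
  assumes "R a b" "R b c" "R c d" "R d e" "R e a" "z \<in> V"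
  shows "R a c \<or> R a d \<or> R b d \<or> R b e \<or> R c e \<or> R z a \<or> R z b \<or> R z c \<or>
    R z d \<or> R z e"
  using assms hole5_dominates[of a b c d e z] R_commute R_V unfolding cfg_defs by metis

section \<open>Far and opposite vertices of a six-hole\<close>

definition opp :: "'a \<Rightarrow> 'a \<Rightarrow> 'a \<Rightarrow> 'a \<Rightarrow> 'a \<Rightarrow> 'a \<Rightarrow> 'a \<Rightarrow> bool" where
  "opp c1 c2 c3 c4 c5 c6 x \<longleftrightarrow> sees x [c1, c4] [c2, c3, c5, c6]"

lemmas cfg6_defs = cfg_defs opp_def

text \<open>Here a contradiction is out of reach: the Petersen graph has six-holes with a vertex far
  from them, whose neighbours are opposite vertices of different kinds. This and the next two lemmas
  show that \<open>attached_path\<close> leaves only that possibility for \<open>s\<close> and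
  \<open>t\<close>.\<close>

lemma hole6_far1:
  assumes "hole6 c1 c2 c3 c4 c5 c6"
    "sees q1 [] [c1, c2, c3, c4, c5, c6]"
    "\<not> sees s [] [c1, c2, c3, c4, c5, c6]"
    "\<not> sees t [] [c1, c2, c3, c4, c5, c6]"
    "s \<in> V" "t \<in> V" "\<not> R s t"
    "R s q1" "R q1 t"
  shows "opp c1 c2 c3 c4 c5 c6 s \<and> opp c2 c3 c4 c5 c6 c1 t \<or>
    opp c1 c2 c3 c4 c5 c6 s \<and> opp c3 c4 c5 c6 c1 c2 t \<or>
    opp c2 c3 c4 c5 c6 c1 s \<and> opp c1 c2 c3 c4 c5 c6 t \<or>
    opp c2 c3 c4 c5 c6 c1 s \<and> opp c3 c4 c5 c6 c1 c2 t \<or>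
    opp c3 c4 c5 c6 c1 c2 s \<and> opp c1 c2 c3 c4 c5 c6 t \<or>
    opp c3 c4 c5 c6 c1 c2 s \<and> opp c2 c3 c4 c5 c6 c1 t"
  using assms
    C4[of c2 c1 c6 s] C4[of c2 c1 c6 t] C4[of c2 c1 s c3] C4[of c2 c1 t c3] C4[of c2 c3 c4 s]
    C4[of c2 s q1 t] C4[of c3 c2 t c4] C4[of c3 s q1 t] C4[of c4 c3 s c5] C4[of c4 c3 t c5]
    C4[of c5 c4 s c6] C4[of c6 c1 s c5] C4[of s c1 t q1] C4[of s c4 t q1] C4[of s c5 t q1]
    C4[of s c6 t q1] dom5[of c1 c6 s q1 t c4] dom5[of c5 c6 s q1 t c2] dom5[of c5 s q1 t c6 c3]
    P6[of c1 c2 c3 c4 c5 t] P6[of c1 c2 c3 c4 s q1] P6[of c1 c2 s c5 c4 t] P6[of c1 c6 c5 c4 t q1]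
    P6[of c2 c1 c6 c5 s q1] P6[of c2 c1 c6 c5 t q1] P6[of c2 c3 c4 c5 c6 t]
    P6[of c4 c3 c2 c1 c6 s] P6[of c4 c3 c2 c1 s q1] P6[of c4 c5 c6 c1 c2 t]
    P6[of c4 c5 c6 c1 s q1] P6[of c4 c5 c6 c1 t q1] P6[of c5 c6 c1 c2 s q1]
    P6[of c6 c1 c2 c3 s q1] P6[of c6 c5 c4 c3 t q1]
  unfolding cfg6_defs by (smt (verit) R_commute)

lemma hole6_far2:
  assumes "hole6 c1 c2 c3 c4 c5 c6"
    "sees q1 [] [c1, c2, c3, c4, c5, c6]"
    "sees q2 [] [c1, c2, c3, c4, c5, c6]"
    "\<not> sees s [] [c1, c2, c3, c4, c5, c6]"
    "\<not> sees t [] [c1, c2, c3, c4, c5, c6]"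
    "s \<in> V" "t \<in> V" "\<not> R s t"
    "R s q1" "R q1 q2" "R q2 t"
    "\<not> R s q2" "\<not> R q1 t"
  shows "opp c1 c2 c3 c4 c5 c6 s \<and> opp c2 c3 c4 c5 c6 c1 t \<or>
    opp c1 c2 c3 c4 c5 c6 s \<and> opp c3 c4 c5 c6 c1 c2 t \<or>
    opp c2 c3 c4 c5 c6 c1 s \<and> opp c1 c2 c3 c4 c5 c6 t \<or>
    opp c2 c3 c4 c5 c6 c1 s \<and> opp c3 c4 c5 c6 c1 c2 t \<or>
    opp c3 c4 c5 c6 c1 c2 s \<and> opp c1 c2 c3 c4 c5 c6 t \<or>
    opp c3 c4 c5 c6 c1 c2 s \<and> opp c2 c3 c4 c5 c6 c1 t"
  using assms
    C4[of c2 c1 c6 s] C4[of c2 c1 c6 t] C4[of c3 c2 s c4] C4[of c3 c2 t c4] C4[of s c1 t c3]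
    P6[of c1 c2 c3 s q1 q2] P6[of c1 c2 c3 t q2 q1] P6[of c2 c1 c6 t q2 q1]
    P6[of c2 c3 c4 s q1 q2] P6[of c2 c3 c4 t q2 q1] P6[of c3 c2 c1 t q2 q1]
    P6[of c3 c4 c5 c6 s q1] P6[of c3 c4 c5 s q1 q2] P6[of c3 c4 c5 t q2 q1]
    P6[of c5 c4 c3 c2 t q2] P6[of c5 c6 c1 s q1 q2] P6[of c6 c1 c2 s q1 q2]
    P6[of c6 c1 c2 t q2 q1]
  unfolding cfg6_defs by (smt (verit) R_commute)

lemma hole6_far3:
  assumes "hole6 c1 c2 c3 c4 c5 c6"
    "sees q1 [] [c1, c2, c3, c4, c5, c6]"
    "sees q2 [] [c1, c2, c3, c4, c5, c6]"
    "sees q3 [] [c1, c2, c3, c4, c5, c6]"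
    "\<not> sees s [] [c1, c2, c3, c4, c5, c6]"
    "\<not> sees t [] [c1, c2, c3, c4, c5, c6]"
    "s \<in> V" "t \<in> V" "\<not> R s t"
    "R s q1" "R q1 q2" "R q2 q3" "R q3 t"
    "\<not> R s q2" "\<not> R s q3" "\<not> R q1 q3" "\<not> R q1 t" "\<not> R q2 t"
  shows "opp c1 c2 c3 c4 c5 c6 s \<and> opp c2 c3 c4 c5 c6 c1 t \<or>
    opp c1 c2 c3 c4 c5 c6 s \<and> opp c3 c4 c5 c6 c1 c2 t \<or>
    opp c2 c3 c4 c5 c6 c1 s \<and> opp c1 c2 c3 c4 c5 c6 t \<or>
    opp c2 c3 c4 c5 c6 c1 s \<and> opp c3 c4 c5 c6 c1 c2 t \<or>
    opp c3 c4 c5 c6 c1 c2 s \<and> opp c1 c2 c3 c4 c5 c6 t \<or>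
    opp c3 c4 c5 c6 c1 c2 s \<and> opp c2 c3 c4 c5 c6 c1 t"
  using assms
    C4[of s c3 t c6] P6[of c2 c1 c6 t q3 q2] P6[of c2 c1 s q1 q2 q3] P6[of c2 c3 t q3 q2 q1]
    P6[of c3 c4 s q1 q2 q3] P6[of c3 c4 t q3 q2 q1] P6[of c4 c3 s q1 q2 q3]
    P6[of c4 c5 c6 s q1 q2] P6[of c4 c5 s q1 q2 q3] P6[of c4 c5 t q3 q2 q1]
    P6[of c5 c4 c3 c2 c1 t] P6[of c5 c4 c3 c2 s q1] P6[of c5 c4 c3 c2 t q3]
    P6[of c6 c1 c2 t q3 q2] P6[of c6 c1 t q3 q2 q1] P6[of c6 c5 c4 s q1 q2]
    P6[of c6 c5 s q1 q2 q3]
  unfolding cfg6_defs by (smt (verit) R_commute)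

text \<open>Summed over \<open>V\<close>, four values of \<open>n\<close> are bounded by two values
  plus twice the size of a clique, which two instances of \<open>two_n\<close> refute. The two
  variants below have the same shape; the \<open>opp12_clique\<close> lemmas identify the
  cliques.\<close>

lemma opp12_count_a:
  assumes "hole6 c1 c2 c3 c4 c5 c6"
    "opp c1 c2 c3 c4 c5 c6 n1"
    "opp c2 c3 c4 c5 c6 c1 n2"
    "opp c3 c4 c5 c6 c1 c2 n3"
    "y \<in> V"
    "\<not> sees y [] [c1, c2, c3, c4, c5, c6]"
  shows "(if R y n2 then 2 else 0) + (if R y n1 then 1 else 0) + (if R y n3 then 1 else 0) \<le>
    (if R y c4 then 1 else 0) + (if R y c6 then 1 else 0) +
    (if R y n2 \<and> R y c2 then 2 else (0::int))"
  using assms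
    C4[of c1 c6 y n1] C4[of c2 c1 y n2] C4[of c4 c3 y n1] C4[of c5 c4 n1 y] C4[of c5 c4 y n2]
    C4[of c6 c1 y n3] C4[of c6 c5 y n3] dom5[of c1 c6 y n2 c2 c4] dom5[of c1 n1 c4 c5 c6 y]
    dom5[of c1 n1 n2 c5 c6 c3] dom5[of c2 y n1 c4 c3 c6] dom5[of c3 c4 c5 c6 n3 y]
    dom5[of c3 c4 c5 n2 n3 c1] dom5[of c4 n1 n3 c6 c5 c2] P6[of c1 y n3 c3 c4 c5]
    P6[of n1 c1 c2 n2 y n3] P6[of n1 y n3 c6 c5 n2] P6[of n3 c6 c1 c2 n2 y]
  unfolding cfg6_defs by (smt (verit) R_commute)

lemma opp12_count_b:
  assumes "hole6 c1 c2 c3 c4 c5 c6"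
    "opp c1 c2 c3 c4 c5 c6 n1"
    "opp c2 c3 c4 c5 c6 c1 n2"
    "sees z [] [c1, c2, c3, c4, c5, c6]"
    "y \<in> V"
    "\<not> opp c3 c4 c5 c6 c1 c2 y"
  shows "(if R y c3 then 1 else 0) + (if R y c6 then 1 else 0) + (if R y z then 2 else 0) \<le>
    (if R y c1 then 1 else 0) + (if R y c4 then 1 else 0) +
    (if R y z \<and> R y n2 then 2 else (0::int))"
  using assms
    C4[of c2 c1 y c3] C4[of c4 c3 y c5] C4[of c5 c4 y c6] C4[of c6 c1 n1 y] C4[of c6 c5 n2 y]
    C4[of n1 c1 y z] C4[of n1 c4 y z] C4[of n2 c2 y c5] dom5[of c1 n1 c4 c3 c2 z]
    dom5[of c2 n2 c5 c4 c3 y] dom5[of c2 n2 n1 c4 c3 c6] P6[of c1 c2 n2 c5 c4 y]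
    P6[of c1 y c3 c4 c5 n2] P6[of c2 c1 c6 c5 y z] P6[of c2 c3 c4 c5 y z] P6[of c2 y c6 c5 c4 n1]
    P6[of c3 c2 n2 c5 y z] P6[of c3 c2 n2 z y c6] P6[of c3 c4 c5 c6 y z] P6[of c3 y c6 c1 n1 z]
    P6[of c3 y n1 c1 c6 c5] P6[of c4 n1 c1 c6 y n2] P6[of c5 c6 c1 c2 y z] P6[of c6 c1 n1 c4 c3 y]
    P6[of c6 c5 n2 c2 y n1] P6[of n1 c1 c2 n2 c5 y]
  unfolding cfg6_defs by (smt (verit) R_commute)

lemma opp12_count_c:
  assumes "hole6 c1 c2 c3 c4 c5 c6"
    "opp c1 c2 c3 c4 c5 c6 n1"
    "opp c2 c3 c4 c5 c6 c1 n2"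
    "y \<in> V"
    "\<not> sees y [] [c1, c2, c3, c4, c5, c6]"
    "\<not> opp c3 c4 c5 c6 c1 c2 y"
  shows "(if R y c3 then 1 else 0) + (if R y c6 then 1 else 0) + (if R y n1 then 1 else 0) +
    (if R y n2 then 1 else 0) \<le>
    (if R y c1 then 1 else 0) + (if R y c2 then 1 else 0) +
    (if R y c4 \<and> R y c5 then 2 else (0::int))"
  using assms
    C4[of c2 c1 c6 y] C4[of c2 c1 n1 n2] C4[of c2 c1 n1 y] C4[of c2 c1 y c3] C4[of c3 c2 n2 y]
    C4[of c4 c3 y c5] C4[of c4 c3 y n1] C4[of c5 c4 n1 y] C4[of c5 c4 y c6] C4[of c5 c4 y n2]
    C4[of c6 c1 n1 y] P6[of c1 y n2 c5 c4 c3] P6[of c2 y c6 c5 c4 n1] P6[of c4 c3 c2 c1 c6 y]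
    P6[of c4 c3 c2 n2 y c6] P6[of c4 c5 n2 c2 c1 y] P6[of c4 n1 c1 c2 n2 y]
    P6[of c5 c4 n1 c1 c2 y] P6[of c5 c6 c1 c2 c3 y] P6[of c6 c1 c2 c3 c4 y]
  unfolding cfg6_defs by (smt (verit) R_commute)

lemma opp12_clique_a:
  assumes "hole6 c1 c2 c3 c4 c5 c6"
    "opp c1 c2 c3 c4 c5 c6 n1"
    "opp c2 c3 c4 c5 c6 c1 n2"
    "x \<in> V" "y \<in> V" "R x n2" "R x c2" "R y n2" "R y c2"
  shows "R x y"
  using assms
    C4[of c1 x n2 y] C4[of c3 c2 x c4] C4[of c3 c2 y c4] C4[of c3 x n2 y] C4[of c4 c5 n2 x]
    C4[of c4 c5 n2 y] C4[of c6 c5 n2 x] C4[of c6 c5 n2 y] C4[of x c2 y c5]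
    dom5[of c1 n1 c4 c5 c6 x] P6[of c1 x c3 c4 c5 y] P6[of c1 y c3 c4 c5 x]
    P6[of c2 x n1 c4 c5 c6] P6[of c4 c5 c6 c1 c2 y] P6[of c6 c5 c4 c3 c2 x]
    P6[of c6 c5 c4 c3 c2 y]
  unfolding cfg6_defs by (smt (verit) R_commute)

lemma opp12_clique_b:
  assumes "hole6 c1 c2 c3 c4 c5 c6"
    "opp c1 c2 c3 c4 c5 c6 n1"
    "opp c2 c3 c4 c5 c6 c1 n2"
    "sees z [] [c1, c2, c3, c4, c5, c6]"
    "x \<in> V" "y \<in> V" "R x z" "R x n2" "R y z" "R y n2"
  shows "R x y"
  using assms
    C4[of c1 n1 z y] C4[of c2 c1 c6 y] C4[of c3 c2 n2 y] C4[of c3 x n2 y] C4[of c4 c3 x c5]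
    C4[of c4 c5 n2 y] C4[of c4 n1 z x] C4[of c4 n1 z y] C4[of c5 x z y] C4[of c6 c5 n2 x]
    C4[of x c2 y z] C4[of x n1 y n2] dom5[of c1 c6 c5 n2 x c3] dom5[of c1 n1 c4 c3 c2 y]
    dom5[of c1 n1 c4 c5 c6 x] dom5[of c1 n1 c4 c5 c6 y] dom5[of c1 n1 c4 c5 c6 z]
    dom5[of c2 n2 n1 c4 c3 c6] dom5[of c3 c4 n1 z x c6] P6[of c2 x c5 c4 n1 y]
    P6[of c5 y c2 c1 n1 x] P6[of c5 y c2 c3 x n1] P6[of n1 c4 c3 c2 n2 x]
  unfolding cfg6_defs by (smt (verit) R_commute)

lemma opp12_clique_c:
  assumes "hole6 c1 c2 c3 c4 c5 c6"
    "opp c1 c2 c3 c4 c5 c6 n1"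
    "opp c2 c3 c4 c5 c6 c1 n2"
    "x \<in> V" "y \<in> V" "R x c4" "R x c5" "R y c4" "R y c5"
  shows "R x y"
  using assms
    C4[of c1 c6 c5 x] C4[of c1 n1 c4 x] C4[of c1 n1 c4 y] C4[of c2 c1 n1 x] C4[of c2 c1 n1 y]
    C4[of c3 c2 x c4] C4[of c3 c2 y c4] C4[of c4 c5 n2 n1] C4[of c4 x c6 y] C4[of c5 x n1 y]
    C4[of c6 c1 y c5] C4[of x c3 y c5] dom5[of c1 c6 x n2 c2 y] dom5[of c1 n1 x c5 c6 c3]
    dom5[of c1 n1 y c5 c6 c3] P6[of c1 c2 n2 y c4 x] P6[of c3 x c5 c6 c1 n1]
    P6[of c3 y c5 c6 c1 n1] P6[of c4 x n2 c2 c1 c6] P6[of c4 y n2 c2 c1 c6]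
    P6[of n2 c2 c1 n1 c4 x] P6[of n2 c2 c1 n1 c4 y]
  unfolding cfg6_defs by (smt (verit) R_commute)

text \<open>The ten vertices induce the Petersen graph. Adjacency among \<open>n1\<close>,
  \<open>n2\<close>, \<open>n3\<close> and \<open>z\<close> is not demanded here: once vertices
  complete to all ten are excluded, \<open>petersen_twin\<close> applied to these vertices
  themselves forces it.\<close>

definition petersen where
  "petersen c1 c2 c3 c4 c5 c6 n1 n2 n3 z \<longleftrightarrow>
  hole6 c1 c2 c3 c4 c5 c6 \<and> opp c1 c2 c3 c4 c5 c6 n1 \<and>
     opp c2 c3 c4 c5 c6 c1 n2 \<and> opp c3 c4 c5 c6 c1 c2 n3 \<and> sees z [] [c1, c2, c3, c4, c5, c6]"

lemmas petersen_defs = cfg6_defs petersen_def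

lemma petersen_universal:
  assumes "petersen c1 c2 c3 c4 c5 c6 n1 n2 n3 z"
    "y \<in> V"
    "R u c1" "R u c2" "R u c3" "R u c4" "R u c5" "R u c6" "R u n1" "R u n2" "R u n3" "R u z"
  shows "R u y"
  using assms
    C4[of c3 u c6 y] C4[of c3 u n2 y] C4[of c4 u z y] C4[of c6 u n2 y] C4[of n1 c1 u c4]
    C4[of n1 c1 y c4] C4[of n1 c1 y z] C4[of n1 y n2 z] C4[of n2 c2 u c5] C4[of n2 u n3 y]
    C4[of n2 u n3 z] C4[of n3 c3 u c6] C4[of u c1 y n3] C4[of u c2 y c5] C4[of u c2 y c6]
    C4[of u c2 y n1] C4[of u c2 y n3] C4[of u c5 y n1] C4[of u c6 y n1] dom5[of c1 c6 c5 n2 c2 y]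
    dom5[of c1 c6 c5 n2 c2 z] dom5[of c1 n1 c4 c3 c2 y] dom5[of c1 n1 c4 c3 c2 z]
    dom5[of c1 n1 c4 c5 c6 y] dom5[of c1 n1 n3 c3 c2 c5] dom5[of c1 n1 z n3 c6 y]
    dom5[of c2 n2 c5 c4 c3 y] dom5[of c2 n2 c5 y c3 n1] dom5[of c2 n2 n1 c4 c3 c6]
    dom5[of c2 n2 z y c3 c6] dom5[of c3 c4 c5 c6 n3 y] dom5[of c3 c4 c5 c6 n3 z]
    dom5[of c3 c4 c5 n2 n3 c1] dom5[of c5 c6 n3 z n2 y] P6[of c4 y c6 c1 c2 n2]
    P6[of n1 c1 c2 n2 c5 y] P6[of y c5 c4 c3 n3 z]
  unfolding petersen_defs by (smt (verit) R_commute)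

text \<open>The ten cases are the ten rows of the adjacency matrix with loops, so every vertex
  belongs to a class represented by one of the ten.\<close>

lemma petersen_twin:
  assumes "petersen c1 c2 c3 c4 c5 c6 n1 n2 n3 z"
    "y \<in> V"
    "\<not> (R y c1 \<and> R y c2 \<and> R y c3 \<and> R y c4 \<and> R y c5 \<and> R y c6 \<and>
    R y n1 \<and> R y n2 \<and> R y n3 \<and> R y z)"
  shows "sees y [c1, c2, c6, n1] [c3, c4, c5, n2, n3, z] \<or>
    sees y [c1, c2, c3, n2] [c4, c5, c6, n1, n3, z] \<or>
    sees y [c2, c3, c4, n3] [c1, c5, c6, n1, n2, z] \<or>
    sees y [c3, c4, c5, n1] [c1, c2, c6, n2, n3, z] \<or>
    sees y [c4, c5, c6, n2] [c1, c2, c3, n1, n3, z] \<or>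
    sees y [c1, c5, c6, n3] [c2, c3, c4, n1, n2, z] \<or>
    sees y [c1, c4, n1, z] [c2, c3, c5, c6, n2, n3] \<or>
    sees y [c2, c5, n2, z] [c1, c3, c4, c6, n1, n3] \<or>
    sees y [c3, c6, n3, z] [c1, c2, c4, c5, n1, n2] \<or>
    sees y [n1, n2, n3, z] [c1, c2, c3, c4, c5, c6]"
  using assms
    C4[of c1 c2 y n1] C4[of c1 c6 n3 y] C4[of c1 n1 c4 y] C4[of c2 c1 c6 y] C4[of c2 c1 n1 n2]
    C4[of c2 c1 y n2] C4[of c3 c2 n2 n3] C4[of c3 c2 n2 y] C4[of c3 c2 y c4] C4[of c3 c2 y n3]
    C4[of c3 n3 z y] C4[of c4 c3 n3 y] C4[of c4 c3 y n1] C4[of c4 c5 c6 y] C4[of c6 c1 y c5]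
    C4[of c6 c5 n2 y] C4[of c6 c5 y n3] C4[of n1 c1 y z] C4[of n1 c4 y z] C4[of n1 y n2 z]
    C4[of n2 c2 y c5] C4[of n2 c5 y z] C4[of n3 c6 y z] C4[of z n1 y n3] C4[of z n2 y n3]
    dom5[of c1 c6 n3 c3 c2 y] dom5[of c1 n1 c4 c3 c2 z] dom5[of c1 n1 c4 c5 c6 y]
    dom5[of c1 n1 z n2 c2 y] dom5[of c1 n1 z n3 c6 y] dom5[of c2 n2 c5 c4 c3 z]
    dom5[of c2 n2 c5 y c3 n1] dom5[of c3 c4 c5 c6 n3 y] dom5[of c3 c4 c5 c6 n3 z]
    dom5[of c3 c4 c5 y n3 c1] dom5[of c4 n1 n3 c6 c5 c2] dom5[of c6 y n1 z n3 c2]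
    P6[of c3 c4 n1 c1 c6 y] P6[of c4 n1 z n3 c6 y] P6[of c5 c4 n1 c1 y n3] P6[of n2 c2 c3 c4 n1 y]
    P6[of n2 c5 c6 c1 n1 y] P6[of n2 z n3 c6 c1 y]
  unfolding petersen_defs by (smt (verit) R_commute)

text \<open>Together with its rotations and the next two lemmas this becomes hypothesis
  \<open>adj\<close> of \<open>twin_removal\<close>. One hole vertex, one opposite vertex and
  \<open>z\<close> suffice up to rotation.\<close>

lemma petersen_adjacent_c1:
  assumes "petersen c1 c2 c3 c4 c5 c6 n1 n2 n3 z"
    "sees y [c1, c2, c6, n1] [c3, c4, c5, n2, n3, z]" "y2 \<in> V" "R y y2"
  shows "R y2 c1"
  using assms
    C4[of c2 n2 y2 y] C4[of c3 c2 y y2] C4[of c3 n3 z y2] C4[of c4 c3 n3 n1] C4[of c4 c5 n2 n1]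
    C4[of c4 n1 y y2] C4[of c6 c1 n1 y2] C4[of c6 c5 y2 y] C4[of c6 n3 y2 y] C4[of n1 y2 n2 z]
    dom5[of c1 n1 c4 c5 c6 y2] dom5[of c2 n2 c5 c4 c3 y2] dom5[of c2 n2 c5 c4 c3 z]
    dom5[of c3 c4 c5 c6 n3 y2] dom5[of c3 c4 c5 c6 n3 z] dom5[of c4 n1 y c6 c5 z]
    P6[of c1 c2 n2 c5 y2 n3] P6[of c1 y y2 c4 c5 n2] P6[of c3 y2 c6 c1 n1 z]
    P6[of c3 y2 y c6 c5 n2] P6[of c4 n1 c1 c2 n2 n3] P6[of c4 n1 c1 c2 y2 n3]
    P6[of c4 y2 c2 c1 c6 n3] P6[of n3 c3 c4 n1 y y2]
  unfolding petersen_defs by (smt (verit) R_commute)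

lemma petersen_adjacent_n1:
  assumes "petersen c1 c2 c3 c4 c5 c6 n1 n2 n3 z"
    "sees y [c1, c4, n1, z] [c2, c3, c5, c6, n2, n3]" "y2 \<in> V" "R y y2"
  shows "R y2 n1"
  using assms
    C4[of c1 c2 c3 y2] C4[of c1 n1 z y2] C4[of c2 c1 y y2] C4[of c4 c3 n3 n1] C4[of c4 c3 y2 c5]
    C4[of c4 c5 n2 n1] C4[of c6 c1 y y2] C4[of n2 y2 y z] C4[of n3 y2 y z]
    dom5[of c1 c6 n3 c3 c2 y2] dom5[of c1 c6 n3 c3 c2 z] dom5[of c1 n1 c4 c3 c2 z]
    dom5[of c2 n2 c5 c4 c3 z] P6[of c2 y2 c4 n1 z n3] P6[of c3 n3 z n1 c1 y2]
    P6[of c3 y2 z n1 c1 c6] P6[of c5 n2 c2 y2 y n1] P6[of c6 c5 n2 z y y2] P6[of c6 n3 z n1 c4 y2]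
    P6[of n1 c1 c2 c3 n3 y2]
  unfolding petersen_defs by (smt (verit) R_commute)

lemma petersen_adjacent_z:
  assumes "petersen c1 c2 c3 c4 c5 c6 n1 n2 n3 z"
    "sees y [n1, n2, n3, z] [c1, c2, c3, c4, c5, c6]" "y2 \<in> V" "R y y2"
  shows "R y2 z"
  using assms
    C4[of c1 c2 n2 n1] C4[of c1 c6 n3 n1] C4[of c6 c5 n2 n3] C4[of n1 y2 n2 z] C4[of n2 c2 y2 y]
    C4[of n2 c5 y2 y] C4[of n3 c3 y2 y] C4[of n3 c6 y2 y] C4[of z n1 y2 n3] C4[of z n2 y2 n3]
    dom5[of c1 c6 n3 c3 c2 y2] dom5[of c1 n1 c4 c3 c2 z] dom5[of c2 n2 c5 c4 c3 y2]
    dom5[of c2 n2 c5 c4 c3 z] dom5[of c3 c4 c5 c6 n3 z] P6[of c1 c2 c3 y2 y z]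
    P6[of c1 c2 n2 y y2 c4] P6[of c3 n3 z n1 c1 y2] P6[of c5 n2 z n1 c1 y2] P6[of c6 c5 c4 y2 y z]
    P6[of n1 z n3 c3 c2 y2]
  unfolding petersen_defs by (smt (verit) R_commute)

text \<open>The possible types when only the third kind of opposite vertex occurs and two types have been excluded:
  the graph is a blowup of a theta graph.\<close>

definition theta6 where
  "theta6 c1 c2 c3 c4 c5 c6 x \<longleftrightarrow>
  \<not> sees x [] [c1, c2, c3, c4, c5, c6] \<and> \<not> opp c1 c2 c3 c4 c5 c6 x \<and>
     \<not> opp c2 c3 c4 c5 c6 c1 x \<and> \<not> sees x [c6, c1, c2, c3] [c4, c5] \<and>
       \<not> sees x [c3, c4, c5, c6] [c1, c2]"

text \<open>The closed neighbourhoods of \<open>c1\<close> and, by the next lemma, of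
  \<open>n3\<close> lie in that of \<open>m\<close>. As \<open>c1\<close> and \<open>n3\<close> are
  not adjacent, their common neighbours form a clique, so \<open>n c1 + n n3\<close> is at most
  \<open>n m + w\<close>. Hence no such \<open>m\<close> exists.\<close>

lemma opp3_below1:
  assumes "hole6 c1 c2 c3 c4 c5 c6"
    "opp c3 c4 c5 c6 c1 c2 n3"
    "sees m [c6, c1, c2, c3] [c4, c5]" "R y c1"
  shows "R y m"
  using assms
    C4[of c2 c3 c4 y] C4[of m c1 y c3] C4[of m c1 y n3] C4[of n3 c3 m c6] P6[of c4 c5 y c1 m n3]
    P6[of c5 c4 c3 m c1 y] P6[of c5 c4 y c1 m n3] P6[of c5 y c1 c2 c3 n3]
  unfolding cfg6_defs theta6_def by (smt (verit) R_commute)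

lemma opp3_below2:
  assumes "hole6 c1 c2 c3 c4 c5 c6"
    "opp c3 c4 c5 c6 c1 c2 n3"
    "sees m [c6, c1, c2, c3] [c4, c5]" "y \<in> V" "R y n3"
  shows "R y m"
  using assms
    C4[of c3 c4 y n3] C4[of m c1 y n3] C4[of m c2 y n3] C4[of m c3 y c6] C4[of n3 c3 m c6]
    dom5[of c3 c4 c5 c6 m y] P6[of c1 c6 c5 c4 c3 y] P6[of c1 m n3 y c5 c4]
    P6[of c2 c1 c6 n3 y c4] P6[of c4 c3 c2 c1 c6 y]
  unfolding cfg6_defs theta6_def by (smt (verit) R_commute)

text \<open>Meant for \<open>k1\<close>, \<open>k3\<close>, \<open>k5\<close> and \<open>y\<close>
  in a maximum clique that misses \<open>c1\<close>, \<open>c3\<close>, \<open>c5\<close>: the whole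
  clique then lies in the common neighbourhood of \<open>n3\<close> and \<open>c6\<close>, which
  therefore has at least \<open>w\<close> members.\<close>

lemma opp3_odd_missed:
  assumes "hole6 c1 c2 c3 c4 c5 c6"
    "opp c3 c4 c5 c6 c1 c2 n3"
    "k1 \<in> V" "theta6 c1 c2 c3 c4 c5 c6 k1"
    "k3 \<in> V" "theta6 c1 c2 c3 c4 c5 c6 k3"
    "k5 \<in> V" "theta6 c1 c2 c3 c4 c5 c6 k5"
    "y \<in> V" "theta6 c1 c2 c3 c4 c5 c6 y"
    "\<not> R k1 c1" "\<not> R k3 c3" "\<not> R k5 c5" "R k1 k3" "R k3 k5" "R k1 k5"
    "R y k1" "R y k3" "R y k5"
  shows "R y n3 \<and> R y c6"
  using assms
    C4[of c1 c2 c3 k5] C4[of c1 c2 k1 c6] C4[of c2 c1 c6 k3] C4[of c2 c1 c6 k5] C4[of c2 c1 k3 k1]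
    C4[of c2 c1 k3 k5] C4[of c2 c1 k3 y] C4[of c2 c3 n3 k3] C4[of c3 c2 k3 c4] C4[of c3 c2 k5 k1]
    C4[of c3 c4 y k1] C4[of c3 n3 c6 y] C4[of c4 c3 k1 k3] C4[of c4 c3 k5 k1] C4[of c4 c3 n3 k1]
    C4[of c4 c3 n3 k3] C4[of c4 c5 c6 k1] C4[of c4 c5 c6 k5] C4[of c5 c6 k5 k1] C4[of c5 c6 n3 k1]
    C4[of c6 c1 k5 k1] C4[of c6 c1 k5 n3] C4[of c6 c1 y k5] C4[of c6 c5 k1 k3] C4[of c6 c5 k3 n3]
    C4[of c6 c5 y k5] C4[of n3 c6 k3 k1] C4[of n3 c6 k3 k5] dom5[of c1 c6 n3 c3 c2 k3]
    dom5[of c3 n3 c6 c5 c4 k1] P6[of c1 c6 c5 c4 c3 k1] P6[of c1 c6 c5 c4 c3 k5]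
    P6[of c1 k3 c5 c4 c3 n3] P6[of c1 k3 k5 c3 c4 c5] P6[of c1 k5 n3 c3 c4 c5]
    P6[of c1 y c5 c4 c3 n3] P6[of c1 y k5 c3 c4 c5] P6[of c2 c1 c6 c5 c4 k5]
    P6[of c2 c3 c4 c5 c6 k5] P6[of c2 k5 k1 c5 c6 n3] P6[of c3 c4 c5 c6 c1 k5]
    P6[of c4 c3 c2 c1 c6 k1] P6[of c4 c3 c2 c1 c6 k3] P6[of c4 c3 c2 c1 c6 y]
    P6[of c4 k1 c2 c1 c6 n3] P6[of c4 k5 c2 c1 c6 n3] P6[of c5 c6 c1 c2 c3 k1]
    P6[of c5 c6 c1 c2 c3 y] P6[of c5 c6 n3 c3 c2 k3] P6[of c5 k1 k5 c2 c3 n3]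
    P6[of c6 c1 c2 c3 c4 k1]
  unfolding cfg6_defs theta6_def by (smt (verit) R_commute)

text \<open>The last set on the left has at least \<open>w\<close> members by
  \<open>opp3_odd_missed\<close> and counts twice; the last three sets on the right are cliques.
  Summation leaves \<open>n c2 + n c4\<close> at most \<open>n c3 + w\<close>.\<close>

lemma opp3_count:
  assumes "hole6 c1 c2 c3 c4 c5 c6"
    "opp c3 c4 c5 c6 c1 c2 n3"
    "y \<in> V" "theta6 c1 c2 c3 c4 c5 c6 y"
  shows "(if R y c2 then 1 else 0) + (if R y c4 then 1 else 0) +
    (if R y n3 \<and> R y c6 then 2 else 0) \<le>
    (if R y c3 then 1 else 0) + (if R y c6 \<and> R y c1 then 1 else 0) +
    (if R y c6 \<and> R y c5 then 1 else 0) + (if R y c3 \<and> R y n3 then 1 else (0::int))"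
  using assms
    C4[of c1 c6 c5 y] C4[of c2 c1 c6 y] C4[of c3 c2 y n3] C4[of c4 c3 n3 y] C4[of c5 c4 y c6]
    dom5[of c1 c6 n3 c3 c2 y] P6[of c2 c3 c4 c5 c6 y] P6[of c2 y c4 c5 c6 n3]
    P6[of c4 c3 c2 c1 c6 y] P6[of c4 y c2 c1 c6 n3] P6[of c6 c5 c4 c3 c2 y]
  unfolding cfg6_defs theta6_def by (smt (verit) R_commute)

lemma opp3_clique1:
  assumes "hole6 c1 c2 c3 c4 c5 c6"
    "opp c3 c4 c5 c6 c1 c2 n3"
    "x \<in> V" "theta6 c1 c2 c3 c4 c5 c6 x"
    "y \<in> V" "theta6 c1 c2 c3 c4 c5 c6 y"
    "R x c6" "R x c1" "R y c6" "R y c1"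
  shows "R x y"
  using assms
    C4[of c2 c1 x c3] C4[of c2 c1 y c3] C4[of c4 c3 n3 x] C4[of c5 c4 x c6] C4[of c5 c4 y c6]
    C4[of x c1 y c5] C4[of x c1 y n3] C4[of x c2 y c6] dom5[of c3 n3 x c5 c4 y]
    P6[of c2 c3 c4 c5 c6 y] P6[of c5 c4 c3 c2 c1 x] P6[of c5 x c1 c2 c3 n3]
    P6[of c5 y c1 c2 c3 n3] P6[of c5 y n3 c3 c2 x]
  unfolding cfg6_defs theta6_def by (smt (verit) R_commute)

lemma opp3_clique2:
  assumes "hole6 c1 c2 c3 c4 c5 c6"
    "opp c3 c4 c5 c6 c1 c2 n3"
    "x \<in> V" "theta6 c1 c2 c3 c4 c5 c6 x"
    "y \<in> V" "theta6 c1 c2 c3 c4 c5 c6 y"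
    "R x c6" "R x c5" "R y c6" "R y c5"
  shows "R x y"
  using assms
    C4[of c2 c1 c6 x] C4[of c2 c1 c6 y] C4[of c4 c3 x c5] C4[of c4 c3 y c5] C4[of x c1 y c5]
    C4[of x c4 y c6] C4[of x c5 y n3] P6[of c1 x c5 c4 c3 n3] P6[of c1 x n3 c3 c4 y]
    P6[of c1 y c5 c4 c3 n3] P6[of c1 y n3 c3 c4 x] P6[of c4 c3 c2 c1 c6 x] P6[of c4 c3 c2 c1 c6 y]
  unfolding cfg6_defs theta6_def by (smt (verit) R_commute)

lemma opp3_clique3:
  assumes "hole6 c1 c2 c3 c4 c5 c6"
    "opp c3 c4 c5 c6 c1 c2 n3"
    "x \<in> V" "theta6 c1 c2 c3 c4 c5 c6 x"
    "y \<in> V" "theta6 c1 c2 c3 c4 c5 c6 y"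
    "R x c3" "R x n3" "R y c3" "R y n3"
  shows "R x y"
  using assms
    C4[of c2 c1 x c3] C4[of c3 c4 c5 y] C4[of c6 c1 x n3] C4[of c6 c1 y n3] C4[of c6 c5 x n3]
    C4[of c6 c5 y n3] C4[of x c2 y n3] C4[of x c3 y c6] C4[of x c4 y n3] P6[of c1 c6 c5 c4 c3 x]
    P6[of c1 c6 c5 c4 c3 y] P6[of c2 x c4 c5 c6 y] P6[of c4 y c2 c1 c6 x] P6[of c5 c6 c1 c2 c3 x]
    P6[of c5 c6 c1 c2 c3 y]
  unfolding cfg6_defs theta6_def by (smt (verit) R_commute)

section \<open>Six-holes that every vertex meets in an arc\<close>

lemma hole6_universal:
  assumes "hole6 c1 c2 c3 c4 c5 c6"
    "u \<in> V" "y \<in> V" "R u c1" "R u c2" "R u c3" "R u c4" "R u c5" "R u c6"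
    "\<not> sees y [] [c1, c2, c3, c4, c5, c6]"
  shows "R u y"
  using assms
    C4[of c1 u c5 y] C4[of c2 u c5 y] C4[of u c1 y c3] C4[of u c1 y c4] C4[of u c2 y c4]
    C4[of u c2 y c6] C4[of u c3 y c5] C4[of u c3 y c6] C4[of u c4 y c6] P6[of c1 c2 c3 c4 c5 y]
    P6[of c2 c1 c6 c5 c4 y] P6[of c2 c3 c4 c5 c6 y] P6[of c3 c2 c1 c6 c5 y]
    P6[of c3 c4 c5 c6 c1 y] P6[of c4 c5 c6 c1 c2 y] P6[of c5 c6 c1 c2 c3 y]
  unfolding cfg6_defs theta6_def by (smt (verit) R_commute)

text \<open>Around a six-hole, seeing two vertices at distance two forces seeing the one between
  them, by \<open>C4\<close>. So an \<open>x\<close> of this type sees exactly three or exactly four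
  consecutive hole vertices.\<close>

definition arc6 where
  "arc6 c1 c2 c3 c4 c5 c6 x \<longleftrightarrow>
  x \<in> V \<and> (R x c1 \<and> R x c2 \<and> R x c3 \<or> R x c2 \<and> R x c3 \<and> R x c4 \<or>
     R x c3 \<and> R x c4 \<and> R x c5 \<or> R x c4 \<and> R x c5 \<and> R x c6 \<or>
       R x c5 \<and> R x c6 \<and> R x c1 \<or>
     R x c6 \<and> R x c1 \<and> R x c2) \<and>
     \<not> (R x c1 \<and> R x c2 \<and> R x c3 \<and> R x c4 \<and> R x c5 \<and> R x c6)"

lemma hole6_arc:
  assumes "hole6 c1 c2 c3 c4 c5 c6"
    "y \<in> V"
    "\<not> sees y [] [c1, c2, c3, c4, c5, c6]"
    "\<not> opp c1 c2 c3 c4 c5 c6 y" "\<not> opp c2 c3 c4 c5 c6 c1 y" "\<not> opp c3 c4 c5 c6 c1 c2 y"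
    "\<not> (R y c1 \<and> R y c2 \<and> R y c3 \<and> R y c4 \<and> R y c5 \<and> R y c6)"
  shows "arc6 c1 c2 c3 c4 c5 c6 y"
  using assms
    C4[of c2 c1 c6 y] C4[of c2 c1 y c3] C4[of c3 c2 y c4] C4[of c4 c3 y c5] C4[of c5 c4 y c6]
    C4[of c6 c1 y c5] P6[of c1 c6 c5 c4 c3 y] P6[of c2 c1 c6 c5 c4 y] P6[of c2 c3 c4 c5 c6 y]
    P6[of c3 c2 c1 c6 c5 y] P6[of c3 c4 c5 c6 c1 y] P6[of c4 c3 c2 c1 c6 y]
    P6[of c4 c5 c6 c1 c2 y]
  unfolding cfg6_defs arc6_def by (smt (verit) R_commute)

text \<open>Summed over \<open>V\<close> this gives only that \<open>2 * n a\<close> is at most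
  \<open>n c6 + 2 * w\<close>, which is too weak by \<open>w\<close>. The next lemma gains 1 at
  every vertex of a maximum clique missing \<open>c1\<close>, \<open>c3\<close>, \<open>c5\<close>,
  exactly the missing amount.\<close>

lemma opposite_arcs_count:
  assumes "hole6 c1 c2 c3 c4 c5 c6"
    "sees m [c6, c1, c2, c3] [c4, c5]" "sees p [c3, c4, c5, c6] [c1, c2]"
    "sees a [c5, c6, c1] [c2, c3, c4]" "\<not> R a m"
    "arc6 c1 c2 c3 c4 c5 c6 y"
  shows "(if R y a then 2 else 0) \<le>
    (if R y c6 then 1 else 0) + (if R y c6 \<and> R y c1 \<and> \<not> R y c3 then 1 else 0) +
    (if R y p \<and> R y c5 \<and> R y c6 then 1 else (0::int))"
  using assms
    C4[of c1 a p m] C4[of c2 c1 a y] C4[of c3 p c6 y] C4[of c4 c3 y c5] C4[of c4 c5 a y]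
    C4[of c6 c1 y c5] C4[of m c1 y c3] C4[of m c3 p c6] C4[of p c5 a y] C4[of p c6 a y]
    dom5[of c4 y a c6 p c2] P6[of c2 m y a c5 c4] P6[of c2 y a c6 p c4] P6[of c4 c3 m c6 a y]
    P6[of c5 c6 c1 c2 c3 y] P6[of p c3 c2 c1 a y]
  unfolding cfg6_defs arc6_def by (smt (verit) R_commute)

lemma opposite_arcs_count_clique:
  assumes "hole6 c1 c2 c3 c4 c5 c6"
    "sees m [c6, c1, c2, c3] [c4, c5]" "sees p [c3, c4, c5, c6] [c1, c2]"
    "sees a [c5, c6, c1] [c2, c3, c4]" "\<not> R a m"
    "arc6 c1 c2 c3 c4 c5 c6 y"
    "arc6 c1 c2 c3 c4 c5 c6 k1" "arc6 c1 c2 c3 c4 c5 c6 k3" "arc6 c1 c2 c3 c4 c5 c6 k5"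
    "\<not> R k1 c1" "\<not> R k3 c3" "\<not> R k5 c5" "R k1 k3" "R k3 k5" "R k1 k5"
    "R y k1" "R y k3" "R y k5"
  shows "(if R y a then 2 else 0) + 1 \<le>
    (if R y c6 then 1 else 0) + (if R y c6 \<and> R y c1 \<and> \<not> R y c3 then 1 else 0) +
    (if R y p \<and> R y c5 \<and> R y c6 then 1 else (0::int))"
  using assms
    C4[of a c1 k5 y] C4[of c1 a k1 c2] C4[of c1 a k1 m] C4[of c1 a p m] C4[of c1 c6 k1 y]
    C4[of c1 c6 p k5] C4[of c1 k3 k5 m] C4[of c1 k5 c3 m] C4[of c2 c1 a k3] C4[of c2 c1 c6 k1]
    C4[of c2 c1 k3 k1] C4[of c2 c1 k3 k5] C4[of c2 c1 k3 y] C4[of c2 c1 y c3] C4[of c2 c3 c4 k1]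
    C4[of c2 c3 p k3] C4[of c2 c3 p k5] C4[of c2 k1 p m] C4[of c3 c2 k3 k1] C4[of c3 c4 k3 k5]
    C4[of c3 k1 c5 p] C4[of c3 k5 c6 p] C4[of c4 c3 k5 k1] C4[of c4 c3 y c5] C4[of c4 c5 a k3]
    C4[of c4 c5 c6 k1] C4[of c4 k1 c6 p] C4[of c5 a k5 c4] C4[of c5 a k5 k1] C4[of c5 a y k1]
    C4[of c5 c4 k5 c6] C4[of c5 c6 k5 k1] C4[of c5 k3 m p] C4[of c5 p k5 y] C4[of c6 c1 k5 k1]
    C4[of c6 c5 y k5] C4[of m c1 a k3] C4[of m c1 k3 k1] C4[of m c3 k1 c6] C4[of m c3 p c6]
    C4[of m c6 k3 k5] C4[of p c3 k5 k3] C4[of p c4 k5 m] C4[of p c6 k3 k1] C4[of p k1 k3 m]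
    C4[of p k1 k5 m] C4[of p k3 k5 m] P6[of a c5 p c3 c2 k3] P6[of a c5 p m c2 k5]
    P6[of c1 a c5 p c3 k1] P6[of c1 c2 c3 p c5 k3] P6[of c1 c6 c5 c4 c3 y] P6[of c1 m c3 c4 c5 k3]
    P6[of c2 c1 a c5 c4 k3] P6[of c2 c1 a c5 k1 k5] P6[of c2 c1 c6 c5 c4 k5]
    P6[of c2 c1 c6 c5 c4 y] P6[of c2 c1 c6 c5 k1 k5] P6[of c2 c3 c4 k3 a c6]
    P6[of c2 m k5 a c5 c4] P6[of c3 c2 c1 a c5 k1] P6[of c3 c2 c1 a c5 k3]
    P6[of c3 c2 c1 c6 c5 k1] P6[of c3 c4 c5 a c1 k5] P6[of c3 c4 c5 c6 c1 k3]
    P6[of c3 m c1 a c5 k3] P6[of c4 c3 c2 c1 c6 k1] P6[of c4 c3 c2 c1 c6 k3]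
    P6[of c4 c3 c2 c1 c6 k5] P6[of c4 p c6 c1 c2 k1] P6[of c5 a c1 m c3 k5]
    P6[of c5 c6 c1 c2 c3 k1] P6[of c6 c1 c2 c3 c4 k1] P6[of k5 a c5 c4 c3 m]
    R_commute[of c1 a] R_commute[of c1 k5] R_commute[of y k5] R_commute[of a y] R_commute[of a k5]
    R_commute[of c1 y] R_commute[of a k1] R_commute[of c2 k1] R_commute[of c1 c2]
    R_commute[of c1 k1] R_commute[of c2 a] R_commute[of m k1] R_commute[of c1 m] R_commute[of m a]
    R_commute[of p a] R_commute[of m p] R_commute[of c1 p] R_commute[of c1 c6] R_commute[of c6 k1]
    R_commute[of y k1] R_commute[of c6 y] R_commute[of c6 p] R_commute[of p k5]
    R_commute[of c6 k5] R_commute[of c1 k3] R_commute[of k3 k5] R_commute[of m k5]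
    R_commute[of m k3] R_commute[of c3 k5] R_commute[of c3 m] R_commute[of c1 c3]
    R_commute[of a k3] R_commute[of c2 k3] R_commute[of c2 c6] R_commute[of k1 k3]
    R_commute[of c2 k5] R_commute[of y k3] R_commute[of c2 y] R_commute[of c3 y]
    R_commute[of c2 c3] R_commute[of c3 c4] R_commute[of c4 k1] R_commute[of c2 c4]
    R_commute[of c3 k1] R_commute[of c3 p] R_commute[of p k3] R_commute[of c2 p]
    R_commute[of c3 k3] R_commute[of p k1] R_commute[of c2 m] R_commute[of c4 k3]
    R_commute[of c4 k5] R_commute[of c5 k1] R_commute[of c5 p] R_commute[of c3 c5]
    R_commute[of c3 c6] R_commute[of k1 k5] R_commute[of c5 y] R_commute[of c4 c5]
    R_commute[of c4 y] R_commute[of c5 a] R_commute[of c4 a] R_commute[of c5 k3]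
    R_commute[of c5 c6] R_commute[of c4 c6] R_commute[of c4 p] R_commute[of c5 k5]
    R_commute[of c5 m] R_commute[of p y] R_commute[of c6 m] R_commute[of c6 k3] R_commute[of c4 m]
    R_commute[of c3 a] R_commute[of c2 c5] R_commute[of c1 c5] R_commute[of c1 c4]
    R_commute[of c6 a]
  unfolding cfg6_defs arc6_def by (smt (verit))

lemma opposite_arcs_clique1:
  assumes "hole6 c1 c2 c3 c4 c5 c6"
    "sees m [c6, c1, c2, c3] [c4, c5]" "sees p [c3, c4, c5, c6] [c1, c2]"
    "arc6 c1 c2 c3 c4 c5 c6 x" "arc6 c1 c2 c3 c4 c5 c6 y"
    "x \<in> V" "y \<in> V" "R x c6" "R x c1" "R y c6" "R y c1" "\<not> R x c3" "\<not> R y c3"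
  shows "R x y"
  using assms
    C4[of c1 m p y] C4[of c4 c3 m x] C4[of c4 c3 m y] C4[of m c1 x p] C4[of m c3 p c6]
    C4[of p c4 x c6] C4[of p c4 y c6] C4[of x c1 y c5] C4[of x c2 y c6] P6[of c2 c3 c4 c5 c6 y]
    P6[of c3 c4 c5 y c1 x] P6[of c4 c3 c2 y c6 x]
  unfolding cfg6_defs arc6_def by (smt (verit) R_commute)

lemma opposite_arcs_clique2:
  assumes "hole6 c1 c2 c3 c4 c5 c6"
    "sees m [c6, c1, c2, c3] [c4, c5]" "sees p [c3, c4, c5, c6] [c1, c2]"
    "arc6 c1 c2 c3 c4 c5 c6 x" "arc6 c1 c2 c3 c4 c5 c6 y"
    "x \<in> V" "y \<in> V" "R x p" "R x c5" "R x c6" "R y p" "R y c5" "R y c6"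
  shows "R x y"
  using assms
    C4[of c1 m p x] C4[of c1 m p y] C4[of c3 c2 x p] C4[of c3 c2 y p] C4[of c3 m c6 x]
    C4[of c3 m c6 y] C4[of c4 c3 x c5] C4[of c4 c3 y c5] C4[of c5 x m y] C4[of m c3 p c6]
    C4[of x c4 y c6] P6[of c1 c2 c3 c4 c5 x] P6[of c1 c2 c3 c4 c5 y] P6[of c3 c2 c1 x c5 y]
    P6[of x c4 c3 c2 c1 y]
  unfolding cfg6_defs arc6_def by (smt (verit) R_commute)

lemma opposite_arcs_clique3:
  assumes "hole6 c1 c2 c3 c4 c5 c6"
    "sees m [c6, c1, c2, c3] [c4, c5]" "sees p [c3, c4, c5, c6] [c1, c2]"
    "arc6 c1 c2 c3 c4 c5 c6 x" "arc6 c1 c2 c3 c4 c5 c6 y"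
    "x \<in> V" "y \<in> V" "R x c4" "R x c5" "R y c4" "R y c5"
  shows "R x y"
  using assms
    C4[of c1 c6 c5 x] C4[of c1 m p x] C4[of c2 c3 c4 x] C4[of c2 c3 c4 y] C4[of c3 c4 x m]
    C4[of c3 c4 y m] C4[of c5 c6 m y] C4[of c6 c1 y c5] C4[of c6 c5 x m] C4[of m c2 x p]
    C4[of m c3 p c6] C4[of p c3 x c5] C4[of p c4 x c6] C4[of x c3 y c5] C4[of x c4 y c6]
    P6[of c1 m c3 y c5 x] P6[of c2 m c6 y c4 x] P6[of c3 c2 c1 c6 c5 x] P6[of c6 c1 c2 c3 c4 y]
  unfolding cfg6_defs arc6_def by (smt (verit) R_commute)

text \<open>The two conditional premises are what \<open>opposite_arcs_no_missing\<close> yields on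
  the two sides. Summation bounds \<open>n c4 + n c5\<close> by \<open>n p + w\<close>, since the
  common neighbours of \<open>c4\<close> and \<open>c5\<close> form a clique.\<close>

lemma opposite_arcs_final:
  assumes "hole6 c1 c2 c3 c4 c5 c6"
    "sees m [c6, c1, c2, c3] [c4, c5]" "sees p [c3, c4, c5, c6] [c1, c2]"
    "arc6 c1 c2 c3 c4 c5 c6 y"
    "sees y [c2, c3, c4] [c1, c5, c6] \<Longrightarrow> R y p"
    "sees y [c5, c6, c1] [c2, c3, c4] \<Longrightarrow> R y m"
  shows "(if R y c4 then 1 else 0) + (if R y c5 then 1 else 0) \<le>
    (if R y p then 1 else 0) + (if R y c4 \<and> R y c5 then 1 else (0::int))"
  using assms
    C4[of c2 m c6 y] C4[of c3 c2 y c4] C4[of c5 p m y] C4[of c6 c1 y c5] C4[of m c1 y c3]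
    C4[of m c3 p c6] C4[of p c3 y c5] C4[of p c4 y c6] C4[of p c4 y m] P6[of c1 c2 c3 p c5 y]
    P6[of c2 c1 c6 p c4 y]
  unfolding cfg6_defs arc6_def by (smt (verit) R_commute)

text \<open>On the hole, \<open>a\<close> could replace \<open>c1\<close> and \<open>b\<close> could
  replace \<open>c3\<close>, but not both at once, because \<open>a\<close> and \<open>b\<close> are
  adjacent.\<close>

definition chord where
  "chord c1 c2 c3 c4 c5 c6 a b \<longleftrightarrow>
  sees a [c6, c1, c2] [c3, c4, c5] \<and> sees b [c2, c3, c4] [c5, c6, c1] \<and> R a b"

definition opposite_arcs where
  "opposite_arcs c1 c2 c3 c4 c5 c6 a b \<longleftrightarrow>
  sees a [c6, c1, c2, c3] [c4, c5] \<and> sees b [c3, c4, c5, c6] [c1, c2]"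

text \<open>To be applied to members of a maximum clique that misses \<open>c1\<close>,
  \<open>c3\<close>, \<open>c5\<close>. The last alternative is a triangle of replacements for the
  three even vertices.\<close>

lemma odd_missed:
  assumes "hole6 c1 c2 c3 c4 c5 c6" "arc6 c1 c2 c3 c4 c5 c6 k1" "arc6 c1 c2 c3 c4 c5 c6 k3"
    "arc6 c1 c2 c3 c4 c5 c6 k5"
    "\<not> R k1 c1" "\<not> R k3 c3" "\<not> R k5 c5" "R k1 k3" "R k3 k5" "R k1 k5"
  shows "\<exists>a b. chord c1 c2 c3 c4 c5 c6 a b \<or>
    chord c3 c4 c5 c6 c1 c2 a b \<or>
    chord c5 c6 c1 c2 c3 c4 a b \<or>
    opposite_arcs c1 c2 c3 c4 c5 c6 a b \<or>
    opposite_arcs c2 c3 c4 c5 c6 c1 a b \<or>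
    opposite_arcs c3 c4 c5 c6 c1 c2 a b \<or>
    (\<exists>d. chord c2 c3 c4 c5 c6 c1 a b \<and> chord c4 c5 c6 c1 c2 c3 b d \<and> R a d)"
proof (rule ccontr)
  assume no: "\<not> ?thesis"
  \<comment> \<open>The witnesses \<open>a\<close>, \<open>b\<close>, \<open>d\<close> are found
    among \<open>k1\<close>, \<open>k3\<close>, \<open>k5\<close> themselves, so the six orders of
    these are the instances that matter.\<close>
  then have no_pair: "\<not> (chord c1 c2 c3 c4 c5 c6 a b \<or>
    chord c3 c4 c5 c6 c1 c2 a b \<or>
    chord c5 c6 c1 c2 c3 c4 a b \<or>
    opposite_arcs c1 c2 c3 c4 c5 c6 a b \<or>
    opposite_arcs c2 c3 c4 c5 c6 c1 a b \<or>
    opposite_arcs c3 c4 c5 c6 c1 c2 a b \<or>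
    (chord c2 c3 c4 c5 c6 c1 a b \<and> chord c4 c5 c6 c1 c2 c3 b d \<and> R a d))" for a b d
    by blast
  show False
  using assms R_commute[of k3 k1] R_commute[of k5 k3] R_commute[of k5 k1] no_pair[of k1 k3 k5] no_pair[of k1 k5 k3] no_pair[of k3 k1 k5] no_pair[of k3 k5 k1] no_pair[of k5 k1 k3] no_pair[of k5 k3 k1]
    C4[of c1 c2 k3 c6] C4[of c2 c1 c6 k1] C4[of c2 c1 c6 k5] C4[of c2 c1 k3 k1] C4[of c2 c1 k3 k5]
    C4[of c2 c1 k5 c3] C4[of c2 c3 c4 k1] C4[of c3 c2 k3 c4] C4[of c3 c2 k3 k1] C4[of c3 c2 k5 c4]
    C4[of c3 c2 k5 k1] C4[of c4 c3 k1 c5] C4[of c4 c3 k5 k1] C4[of c4 c3 k5 k3] C4[of c4 c5 c6 k1]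
    C4[of c4 c5 k3 k1] C4[of c5 c4 k3 c6] C4[of c5 c4 k5 c6] C4[of c5 c4 k5 k3] C4[of c5 c6 k3 k1]
    C4[of c6 c1 k3 c5] C4[of c6 c1 k5 k1] C4[of c6 c1 k5 k3] C4[of c6 c5 k1 k5]
    P6[of c2 c1 c6 c5 c4 k5] P6[of c3 c2 c1 c6 c5 k1] P6[of c3 c2 c1 c6 c5 k3]
    P6[of c4 c3 c2 c1 c6 k1] P6[of c4 c3 c2 c1 c6 k3] P6[of c4 c3 c2 c1 c6 k5]
    P6[of c4 c5 c6 c1 c2 k1] P6[of c4 c5 c6 c1 c2 k5] P6[of c5 c4 c3 c2 c1 k3]
    P6[of c5 c4 c3 c2 c1 k5] P6[of c5 c6 c1 c2 c3 k1] P6[of c5 c6 c1 c2 c3 k5]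
    P6[of c6 c1 c2 c3 c4 k1] P6[of c6 c1 c2 c3 c4 k3] P6[of c6 c5 c4 c3 c2 k3]
    R_commute[of c1 c2] R_commute[of c2 k3] R_commute[of c6 k3] R_commute[of c1 c6]
    R_commute[of c1 k3] R_commute[of c2 c6] R_commute[of c6 k1] R_commute[of c2 k1]
    R_commute[of c1 k1] R_commute[of c6 k5] R_commute[of c2 k5] R_commute[of c1 k5]
    R_commute[of k1 k3] R_commute[of k3 k5] R_commute[of c3 k5] R_commute[of c2 c3]
    R_commute[of c1 c3] R_commute[of c3 c4] R_commute[of c4 k1] R_commute[of c2 c4]
    R_commute[of c3 k1] R_commute[of c4 k3] R_commute[of c3 k3] R_commute[of c4 k5]
    R_commute[of k1 k5] R_commute[of c5 k1] R_commute[of c4 c5] R_commute[of c3 c5]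
    R_commute[of c5 c6] R_commute[of c4 c6] R_commute[of c5 k3] R_commute[of c5 k5]
    R_commute[of c1 c5] R_commute[of c2 c5] R_commute[of c1 c4] R_commute[of c3 c6]
  unfolding cfg6_defs arc6_def chord_def opposite_arcs_def by (smt (verit))
qed

text \<open>This and the \<open>two_chords\<close> lemmas make the closed neighbourhood of
  \<open>a\<close> contain that of \<open>c1\<close>. As \<open>a\<close> also sees
  \<open>b\<close>, it would have larger \<open>n\<close>, although it can replace \<open>c1\<close>
  on the hole; a hole chosen with maximal degrees forbids this.\<close>

lemma even_triangle:
  assumes "hole6 c1 c2 c3 c4 c5 c6"
    "chord c1 c2 c3 c4 c5 c6 a b" "chord c3 c4 c5 c6 c1 c2 b d" "R a d" "y \<in> V" "R y c1"
  shows "R y a"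
  using assms
    C4[of a b y c1] C4[of a c1 y d] C4[of c4 c3 y c5] C4[of c6 c1 y c5] C4[of d c4 y c6]
    P6[of b c3 y c1 c6 c5] P6[of c1 y c5 d b c3] P6[of c3 b d c6 c1 y] P6[of c5 c4 b a c1 y]
  unfolding cfg6_defs arc6_def chord_def opposite_arcs_def by (smt (verit) R_commute)

lemma two_chords1:
  assumes "hole6 c1 c2 c3 c4 c5 c6"
    "chord c1 c2 c3 c4 c5 c6 a b" "chord c2 c3 c4 c5 c6 c1 d e" "y \<in> V" "R y c1"
  shows "R y a"
  using assms
    C4[of b c2 y e] C4[of c1 a b y] C4[of c2 c1 y c3] C4[of c3 e c5 y] C4[of c6 a e c5]
    C4[of c6 c5 e y] dom5[of c4 c5 c6 a b y] P6[of b c2 c1 c6 c5 e] P6[of c2 a c6 c5 c4 y]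
    P6[of c3 b a c1 y c5] P6[of c5 e b a c1 y]
  unfolding cfg6_defs arc6_def chord_def opposite_arcs_def by (smt (verit) R_commute)

lemma two_chords2:
  assumes "hole6 c1 c2 c3 c4 c5 c6"
    "chord c1 c2 c3 c4 c5 c6 a b" "chord c4 c5 c6 c1 c2 c3 d e" "y \<in> V" "R y c1"
  shows "R y a"
  using assms
    C4[of b a e d] C4[of c5 c4 b e] C4[of c6 a d c5] P6[of a c2 c3 c4 c5 e] P6[of b c2 c1 c6 c5 d]
  unfolding cfg6_defs arc6_def chord_def opposite_arcs_def by (smt (verit) R_commute)

lemma two_chords3:
  assumes "hole6 c1 c2 c3 c4 c5 c6"
    "chord c1 c2 c3 c4 c5 c6 a b" "chord c6 c1 c2 c3 c4 c5 d e" "y \<in> V" "R y c1"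
  shows "R y a"
  using assms
    C4[of a c6 y e] C4[of b c2 y c4] C4[of c1 a b y] C4[of c1 c2 c3 y] C4[of c5 c4 y d]
    C4[of c6 c1 y c5] C4[of e c1 y c3] dom5[of c4 c5 c6 a b y] P6[of a c1 d c5 c4 c3]
    P6[of a c1 e c3 c4 c5] P6[of c3 b a c1 y c5] P6[of c5 c4 c3 e c1 y] P6[of d a c2 c3 c4 y]
  unfolding cfg6_defs arc6_def chord_def opposite_arcs_def by (smt (verit) R_commute)

section \<open>Exclusion of six-holes\<close>

lemma n_alt: "n x = card {y \<in> V. R y x}"
  using R_commute by metis

lemma card_int:
  fixes c :: int
  shows "(\<Sum>y\<in>V. if P y then c else 0) = c * int (card {y \<in> V. P y})"
  by (simp add: sum.If_cases finite_V Int_def)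

lemma hole6_rotate: "hole6 a b c d e f \<Longrightarrow> hole6 b c d e f a"
  unfolding hole6_def sees.simps by blast

lemma opp_rotate3: "opp d e f a b c x \<longleftrightarrow> opp a b c d e f x"
  unfolding opp_def sees.simps by blast

lemma hole6_V:
  assumes "hole6 a b c d e f"
  shows "a \<in> V" "b \<in> V" "c \<in> V" "d \<in> V" "e \<in> V" "f \<in> V"
  using assms by (auto simp: hole6_def)

lemma opp_V: "opp a b c d e f x \<Longrightarrow> x \<in> V"
  by (auto simp: opp_def)

lemma sees_nil_V: "sees x [] ns \<Longrightarrow> x \<in> V"
  by (induction ns) auto

text \<open>Three colours are paid for by lowering \<open>D\<close> by 4 and \<open>w\<close> by 2.
  Every vertex loses the at least four members of \<open>X\<close> that it sees. A clique avoiding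
  \<open>X\<close> can be enlarged by two members of \<open>X\<close>: representatives of two of its
  vertices of different type, or, if only one type occurs, a representative and one of its
  neighbours in \<open>X\<close>.\<close>

lemma twin_removal:
  assumes X: "X \<subseteq> V" "X \<noteq> {}" and col: "proper_colouring X E 3 c"
    and deg: "\<And>x. x \<in> X \<Longrightarrow> 4 \<le> card {u \<in> X. R x u}"
    and twin: "\<And>y. y \<in> V
      \<Longrightarrow> \<exists>x\<in>X. \<forall>u\<in>X. R y u \<longleftrightarrow> R x u"
    and adj: "\<And>x y y'. x \<in> X \<Longrightarrow> y \<in> V
      \<Longrightarrow> y' \<in> V
      \<Longrightarrow> \<forall>u\<in>X. R y u \<longleftrightarrow> R x u
      \<Longrightarrow> R y y' \<Longrightarrow> R y' x"
  shows False
proof (rule removal[OF X col])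
  have fin_X: "finite X"
    using finite_subset[OF X(1) finite_V] .
  have deg': "card {y \<in> V - X. R x y} + 4 \<le> n x" if x: "x \<in> V" for x
  proof -
    obtain t where t: "t \<in> X" "\<forall>u\<in>X. R x u \<longleftrightarrow> R t u"
      using twin[OF x] by blast
    have "4 \<le> card {u \<in> X. R x u}"
      using deg[OF t(1)] t(2) by (simp cong: conj_cong)
    moreover have "n x = card {y \<in> V - X. R x y} + card {u \<in> X. R x u}"
    proof -
      have "{y \<in> V. R x y} = {y \<in> V - X. R x y} \<union> {u \<in> X. R x u}"
        using X by blast
      then show ?thesis
        using finite_V fin_X by (simp add: card_Un_disjoint disjoint_iff)
    qed
    ultimately show ?thesis
      by linarith
  qed
  show "card {y \<in> V - X. R x y} + 4 \<le> D" if "x \<in> V - X" for x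
    using deg'[of x] n_le[of x] that by simp
  obtain x where x: "x \<in> X"
    using X(2) by blast
  then show "4 \<le> D"
    using deg'[of x] n_le[of x] X(1) by fastforce
  show "card K + 2 \<le> w" if K: "cliq K" "K \<inter> X = {}" for K
  proof -
    have pair: "\<exists>u v. u \<in> X \<and> v \<in> X \<and> u \<noteq> v \<and> R u v \<and>
      (\<forall>y\<in>K. R y u \<and> R y v)"
    proof (cases "\<exists>x\<in>X. \<forall>y\<in>K. \<forall>u\<in>X. R y u \<longleftrightarrow>
      R x u")
      case True
      then obtain x where x: "x \<in> X"
        "\<forall>y\<in>K. \<forall>u\<in>X. R y u \<longleftrightarrow> R x u"
        by blast
      have "{u \<in> X. R x u} \<noteq> {x}"
        using deg[OF x(1)] by force
      then obtain u where "u \<in> X" "R x u" "u \<noteq> x"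
        using x(1) X(1) R_refl by blast
      then show ?thesis
        using x X(1) R_refl by blast
    next
      case False
      then have "K \<noteq> {}"
        using X(2) by blast
      then obtain y where y: "y \<in> K" "y \<in> V"
        using cliq_subset[OF K(1)] by blast
      obtain x where x: "x \<in> X" "\<forall>u\<in>X. R y u \<longleftrightarrow> R x u"
        using twin[OF y(2)] by blast
      obtain y' where y': "y' \<in> K" "\<not> (\<forall>u\<in>X. R y' u \<longleftrightarrow> R x u)"
        using False x(1) by blast
      then have y'V: "y' \<in> V"
        using cliq_subset[OF K(1)] by blast
      obtain x' where x': "x' \<in> X" "\<forall>u\<in>X. R y' u \<longleftrightarrow> R x' u"
        using twin[OF y'V] by blast
      have "R z x" "R z x'" if "z \<in> K" for z
      proof -
        have "R y z" "R y' z" "z \<in> V"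
          using that y y' K(1) cliq_subset[OF K(1)] unfolding cliq_def by blast+
        then show "R z x" "R z x'"
          using adj[OF x(1) y(2) _ x(2)] adj[OF x'(1) y'V _ x'(2)] by blast+
      qed
      moreover from this have "R x x'"
        using x y(1) x'(1) by blast
      moreover have "x \<noteq> x'"
        using y'(2) x'(2) by blast
      ultimately show ?thesis
        using x(1) x'(1) by blast
    qed
    then obtain u v where uv: "u \<in> X" "v \<in> X" "u \<noteq> v" "R u v"
      "\<forall>y\<in>K. R y u \<and> R y v"
      by blast
    then have "R u u" "R v v"
      using X(1) R_refl by blast+
    then have "cliq (insert u (insert v K))"
      using uv K(1) R_sym unfolding cliq_def by blast
    then have "card (insert u (insert v K)) \<le> w"
      by (rule cliq_card)
    moreover have "finite K" "u \<notin> K" "v \<notin> K"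
      using finite_subset[OF cliq_subset[OF K(1)] finite_V] K(2) uv by blast+
    ultimately show ?thesis
      using uv(3) by simp
  qed
qed simp

lemma petersen_rotate:
  assumes "petersen c1 c2 c3 c4 c5 c6 n1 n2 n3 z"
  shows "petersen c2 c3 c4 c5 c6 c1 n2 n3 n1 z"
  using assms hole6_rotate unfolding petersen_def opp_def sees.simps by blast

lemma no_petersen: "\<not> petersen c1 c2 c3 c4 c5 c6 n1 n2 n3 z"
proof
  assume p: "petersen c1 c2 c3 c4 c5 c6 n1 n2 n3 z"
  let ?xs = "[c1, c2, c3, c4, c5, c6, n1, n2, n3, z]"
  have not_all: "\<not> (R y c1 \<and> R y c2 \<and> R y c3 \<and> R y c4 \<and> R y c5 \<and>
    R y c6 \<and> R y n1 \<and> R y n2 \<and> R y n3 \<and> R y z)"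
    if "y \<in> V" for y
    using petersen_universal[OF p, of _ y] no_universal[OF that] that petersen_universal[OF p] by blast
  note twin = petersen_twin[OF p _ not_all]
  have adj: "sees c1 [c1, c2, c6, n1] [c3, c4, c5, n2, n3, z]"
    "sees c2 [c1, c2, c3, n2] [c4, c5, c6, n1, n3, z]"
    "sees c3 [c2, c3, c4, n3] [c1, c5, c6, n1, n2, z]"
    "sees c4 [c3, c4, c5, n1] [c1, c2, c6, n2, n3, z]"
    "sees c5 [c4, c5, c6, n2] [c1, c2, c3, n1, n3, z]"
    "sees c6 [c1, c5, c6, n3] [c2, c3, c4, n1, n2, z]"
    "sees n1 [c1, c4, n1, z] [c2, c3, c5, c6, n2, n3]"
    "sees n2 [c2, c5, n2, z] [c1, c3, c4, c6, n1, n3]"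
    "sees n3 [c3, c6, n3, z] [c1, c2, c4, c5, n1, n2]"
    "sees z [n1, n2, n3, z] [c1, c2, c3, c4, c5, c6]"
    subgoal using twin[of c1] p unfolding petersen_defs by (smt (verit) R_commute)
    subgoal using twin[of c2] p unfolding petersen_defs by (smt (verit) R_commute)
    subgoal using twin[of c3] p unfolding petersen_defs by (smt (verit) R_commute)
    subgoal using twin[of c4] p unfolding petersen_defs by (smt (verit) R_commute)
    subgoal using twin[of c5] p unfolding petersen_defs by (smt (verit) R_commute)
    subgoal using twin[of c6] p unfolding petersen_defs by (smt (verit) R_commute)
    subgoal using twin[of n1] p unfolding petersen_defs by (smt (verit) R_commute)
    subgoal using twin[of n2] p unfolding petersen_defs by (smt (verit) R_commute)
    subgoal using twin[of n3] p unfolding petersen_defs by (smt (verit) R_commute)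
    subgoal using twin[of z] p unfolding petersen_defs by (smt (verit) R_commute)
    done
  \<comment> \<open>The rows of the adjacency matrix differ pairwise, hence so do the
    vertices.\<close>
  have "distinct (map (\<lambda>x. map (R x) ?xs) ?xs)"
    using adj by simp
  then have dist: "distinct ?xs"
    by (simp only: distinct_map)
  have sub: "set ?xs \<subseteq> V"
    using adj by simp
  \<comment> \<open>A 3-colouring of the Petersen graph; the default colour 0 goes to
    \<open>c1\<close>, \<open>c3\<close>, \<open>c5\<close> and \<open>z\<close>.\<close>
  define f where "f u = (if u \<in> {n1, n2, n3} then 1 else if u \<in> {c2, c4, c6} then 2 else (0::nat))" for u
  \<comment> \<open>The reversed list offers every inequality to \<open>simp\<close> in the other
    orientation as well.\<close>
  have dist': "distinct [z, n3, n2, n1, c6, c5, c4, c3, c2, c1]"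
    using dist by auto
  have f: "\<forall>u\<in>set ?xs. \<forall>v\<in>set ?xs. u \<noteq> v \<and>
    R u v \<longrightarrow> f u \<noteq> f v"
    using dist dist' adj by (simp add: f_def)
  have four: "\<forall>x\<in>set ?xs. length (filter (R x) ?xs) = 4"
    using adj by simp
  show False
  proof (rule twin_removal[OF sub])
    show "set ?xs \<noteq> {}"
      by simp
    show "proper_colouring (set ?xs) E 3 f"
      unfolding proper_colouring_def
    proof (intro conjI ballI impI image_subsetI)
      show "f u \<in> {0..<3}" if "u \<in> set ?xs" for u
        by (simp add: f_def)
      show "f u \<noteq> f v" if uv: "u \<in> set ?xs" "v \<in> set ?xs" "E u v" for u v
      proof -
        have "u \<noteq> v" "R u v"
          using uv sub E_irrefl unfolding R_def by blast+
        then show ?thesis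
          using bspec[OF bspec[OF f uv(1)] uv(2)] by blast
      qed
    qed
    show "4 \<le> card {u \<in> set ?xs. R x u}" if "x \<in> set ?xs" for x
    proof -
      have "{u \<in> set ?xs. R x u} = set (filter (R x) ?xs)"
        by (simp only: set_filter)
      then have "card {u \<in> set ?xs. R x u} = length (filter (R x) ?xs)"
        using dist distinct_card distinct_filter by metis
      then show ?thesis
        using bspec[OF four that] by linarith
    qed
    show "\<exists>x\<in>set ?xs. \<forall>u\<in>set ?xs. R y u \<longleftrightarrow>
      R x u" if "y \<in> V" for y
      using twin[OF that that]
      apply (elim disjE)
      subgoal by (rule bexI[of _ c1]) (simp_all add: adj[simplified])
      subgoal by (rule bexI[of _ c2]) (simp_all add: adj[simplified])
      subgoal by (rule bexI[of _ c3]) (simp_all add: adj[simplified])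
      subgoal by (rule bexI[of _ c4]) (simp_all add: adj[simplified])
      subgoal by (rule bexI[of _ c5]) (simp_all add: adj[simplified])
      subgoal by (rule bexI[of _ c6]) (simp_all add: adj[simplified])
      subgoal by (rule bexI[of _ n1]) (simp_all add: adj[simplified])
      subgoal by (rule bexI[of _ n2]) (simp_all add: adj[simplified])
      subgoal by (rule bexI[of _ n3]) (simp_all add: adj[simplified])
      subgoal by (rule bexI[of _ z]) (simp_all add: adj[simplified])
      done
    show "R y' x" if x: "x \<in> set ?xs" and y: "y \<in> V"
      "y' \<in> V" and tw: "\<forall>u\<in>set ?xs. R y u \<longleftrightarrow> R x u"
      and yy: "R y y'" for x y y'
    proof -
      note p2 = petersen_rotate[OF p] petersen_rotate[OF petersen_rotate[OF p]]
        petersen_rotate[OF petersen_rotate[OF petersen_rotate[OF p]]]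
      note p4 = petersen_rotate[OF p2(3)] petersen_rotate[OF petersen_rotate[OF p2(3)]]
      note a = petersen_adjacent_c1[OF _ _ y(2) yy] petersen_adjacent_n1[OF _ _ y(2) yy]
        petersen_adjacent_z[OF p _ y(2) yy]
      have "R y' c1" if "x = c1"
        using a(1)[OF p] tw adj(1) y(1) unfolding that by simp
      moreover have "R y' c2" if "x = c2"
        using a(1)[OF p2(1)] tw adj(2) y(1) unfolding that by simp
      moreover have "R y' c3" if "x = c3"
        using a(1)[OF p2(2)] tw adj(3) y(1) unfolding that by simp
      moreover have "R y' c4" if "x = c4"
        using a(1)[OF p2(3)] tw adj(4) y(1) unfolding that by simp
      moreover have "R y' c5" if "x = c5"
        using a(1)[OF p4(1)] tw adj(5) y(1) unfolding that by simp
      moreover have "R y' c6" if "x = c6"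
        using a(1)[OF p4(2)] tw adj(6) y(1) unfolding that by simp
      moreover have "R y' n1" if "x = n1"
        using a(2)[OF p] tw adj(7) y(1) unfolding that by simp
      moreover have "R y' n2" if "x = n2"
        using a(2)[OF p2(1)] tw adj(8) y(1) unfolding that by simp
      moreover have "R y' n3" if "x = n3"
        using a(2)[OF p2(2)] tw adj(9) y(1) unfolding that by simp
      moreover have "R y' z" if "x = z"
        using a(3) tw adj(10) y(1) unfolding that by simp
      ultimately show ?thesis
        using x by auto
    qed
  qed
qed

lemma sum_mono_V:
  fixes f g :: "'a \<Rightarrow> int"
  shows "(\<And>y. y \<in> V \<Longrightarrow> f y \<le> g y) \<Longrightarrow> sum f V \<le> sum g V"
  by (rule sum_mono)

text \<open>The cases are whether a far vertex exists and whether the third kind of opposite vertex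
  occurs. Both together would be a Petersen graph; each of the other three cases has its own
  \<open>opp12_count\<close> lemma.\<close>

lemma no_two_opp:
  assumes h: "hole6 c1 c2 c3 c4 c5 c6" and n1: "opp c1 c2 c3 c4 c5 c6 n1"
    and n2: "opp c2 c3 c4 c5 c6 c1 n2"
  shows False
proof (cases "\<exists>z. sees z [] [c1, c2, c3, c4, c5, c6]")
  case True
  then obtain z where z: "sees z [] [c1, c2, c3, c4, c5, c6]"
    by blast
  have N3: "\<not> opp c3 c4 c5 c6 c1 c2 y" for y
    using no_petersen[of c1 c2 c3 c4 c5 c6 n1 n2 y z] h n1 n2 z by (simp add: petersen_def)
  have "cliq {y \<in> V. R y z \<and> R y n2}"
    using opp12_clique_b[OF h n1 n2 z] by (simp add: cliq_def)
  note c = cliq_card[OF this]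
  have "int (n c3) + int (n c6) + 2 * int (n z)
      \<le> int (n c1) + int (n c4) + 2 * int (card {y \<in> V. R y z \<and> R y n2})"
    using sum_mono_V[OF opp12_count_b[OF h n1 n2 z _ N3]]
    by (simp add: sum.distrib card_int n_alt)
  moreover have "n c1 + w + 2 \<le> n c3 + n c6" "n c4 + w + 2 \<le> n z + n z"
    by (rule two_n; use hole6_V[OF h] sees_nil_V[OF z] in simp)+
  ultimately show False
    using c by linarith
next
  case False
  then have Z: "\<not> sees y [] [c1, c2, c3, c4, c5, c6]" for y
    by blast
  note V = hole6_V[OF h] opp_V[OF n1] opp_V[OF n2]
  show False
  proof (cases "\<exists>n3. opp c3 c4 c5 c6 c1 c2 n3")
    case True
    then obtain n3 where n3: "opp c3 c4 c5 c6 c1 c2 n3"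
      by blast
    have "cliq {y \<in> V. R y n2 \<and> R y c2}"
      using opp12_clique_a[OF h n1 n2] by (simp add: cliq_def)
    note c = cliq_card[OF this]
    have "2 * int (n n2) + int (n n1) + int (n n3)
        \<le> int (n c4) + int (n c6) + 2 * int (card {y \<in> V. R y n2 \<and> R y c2})"
      using sum_mono_V[OF opp12_count_a[OF h n1 n2 n3 _ Z]]
      by (simp add: sum.distrib card_int n_alt)
    moreover have "n c4 + w + 2 \<le> n n2 + n n2" "n c6 + w + 2 \<le> n n1 + n n3"
      by (rule two_n; use V opp_V[OF n3] in simp)+
    ultimately show False
      using c by linarith
  next
    case False
    then have N3: "\<not> opp c3 c4 c5 c6 c1 c2 y" for y
      by blast
    have "cliq {y \<in> V. R y c4 \<and> R y c5}"
      using opp12_clique_c[OF h n1 n2] by (simp add: cliq_def)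
    note c = cliq_card[OF this]
    have "int (n c3) + int (n c6) + int (n n1) + int (n n2)
        \<le> int (n c1) + int (n c2) + 2 * int (card {y \<in> V. R y c4 \<and> R y c5})"
      using sum_mono_V[OF opp12_count_c[OF h n1 n2 _ Z N3]]
      by (simp add: sum.distrib card_int n_alt)
    moreover have "n c2 + w + 2 \<le> n c3 + n c6" "n c1 + w + 2 \<le> n n1 + n n2"
      by (rule two_n; use V in simp)+
    ultimately show False
      using c by linarith
  qed
qed

lemma hole6_dominates:
  assumes h: "hole6 c1 c2 c3 c4 c5 c6"
  shows "\<not> sees z [] [c1, c2, c3, c4, c5, c6]"
proof
  assume far: "sees z [] [c1, c2, c3, c4, c5, c6]"
  define Z where "Z = {z. sees z [] [c1, c2, c3, c4, c5, c6]}"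
  note h2 = hole6_rotate[OF h]
  note h3 = hole6_rotate[OF h2]
  \<comment> \<open>The kinds of opposite vertices are indexed modulo three
    (\<open>opp_rotate3\<close>), so any two kinds are consecutive for some rotation of the
    hole.\<close>
  have no: False if "opp c1 c2 c3 c4 c5 c6 s \<and> opp c2 c3 c4 c5 c6 c1 t \<or>
    opp c1 c2 c3 c4 c5 c6 s \<and> opp c3 c4 c5 c6 c1 c2 t \<or>
    opp c2 c3 c4 c5 c6 c1 s \<and> opp c1 c2 c3 c4 c5 c6 t \<or>
    opp c2 c3 c4 c5 c6 c1 s \<and> opp c3 c4 c5 c6 c1 c2 t \<or>
    opp c3 c4 c5 c6 c1 c2 s \<and> opp c1 c2 c3 c4 c5 c6 t \<or>
    opp c3 c4 c5 c6 c1 c2 s \<and> opp c2 c3 c4 c5 c6 c1 t" for s t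
    using that no_two_opp[OF h] no_two_opp[OF h2] no_two_opp[OF h3] opp_rotate3 by blast
  show False
  proof (rule attached_path[of Z z c1])
    show "Z \<subseteq> V" "z \<in> Z"
      using far by (auto simp: Z_def)
    show "c1 \<in> V" "c1 \<notin> Z" "\<And>x. x \<in> Z \<Longrightarrow> \<not> R c1 x"
      using hole6_V[OF h] R_refl R_sym by (auto simp: Z_def)
  next
    fix s t q1
    assume "s \<in> V - Z" "t \<in> V - Z" "\<not> R s t" "q1 \<in> Z" "R s q1" "R q1 t"
    then show False
      using hole6_far1[OF h, of q1 s t] no[of s t] unfolding Z_def by blast
  next
    fix s t q1 q2
    assume "s \<in> V - Z" "t \<in> V - Z" "\<not> R s t" "q1 \<in> Z" "q2 \<in> Z" "R s q1" "R q1 q2"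
      "R q2 t"
      "\<not> R s q2" "\<not> R q1 t"
    then show False
      using hole6_far2[OF h, of q1 q2 s t] no[of s t] unfolding Z_def by blast
  next
    fix s t q1 q2 q3
    assume "s \<in> V - Z" "t \<in> V - Z" "\<not> R s t" "q1 \<in> Z" "q2 \<in> Z" "q3 \<in> Z"
      "R s q1" "R q1 q2" "R q2 q3"
      "R q3 t" "\<not> R s q2" "\<not> R s q3" "\<not> R q1 q3" "\<not> R q1 t" "\<not> R q2 t"
    then show False
      using hole6_far3[OF h, of q1 q2 q3 s t] no[of s t] unfolding Z_def by blast
  qed
qed

text \<open>Only exchanges of a single vertex are compared. This follows from a maximal sum of the
  six values of \<open>n\<close>, survives rotation, and suffices for the replacement
  arguments.\<close>

definition max6 :: "'a \<Rightarrow> 'a \<Rightarrow> 'a \<Rightarrow> 'a \<Rightarrow> 'a \<Rightarrow> 'a \<Rightarrow> bool" where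
  "max6 a b c d e f \<longleftrightarrow> hole6 a b c d e f \<and>
     (\<forall>x. hole6 x b c d e f \<longrightarrow> n x \<le>
       n a) \<and> (\<forall>x. hole6 a x c d e f \<longrightarrow> n x \<le> n b) \<and>
     (\<forall>x. hole6 a b x d e f \<longrightarrow> n x \<le>
       n c) \<and> (\<forall>x. hole6 a b c x e f \<longrightarrow> n x \<le> n d) \<and>
     (\<forall>x. hole6 a b c d x f \<longrightarrow> n x \<le>
       n e) \<and> (\<forall>x. hole6 a b c d e x \<longrightarrow> n x \<le> n f)"

lemma max6_rotate:
  assumes "max6 a b c d e f"
  shows "max6 b c d e f a"
proof -
  note r = hole6_rotate[OF hole6_rotate[OF hole6_rotate[OF hole6_rotate[OF hole6_rotate]]]]
  have "n x \<le> n b" if "hole6 x c d e f a" for x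
    using r[OF that] assms by (simp add: max6_def)
  moreover have "n x \<le> n c" if "hole6 b x d e f a" for x
    using r[OF that] assms by (simp add: max6_def)
  moreover have "n x \<le> n d" if "hole6 b c x e f a" for x
    using r[OF that] assms by (simp add: max6_def)
  moreover have "n x \<le> n e" if "hole6 b c d x f a" for x
    using r[OF that] assms by (simp add: max6_def)
  moreover have "n x \<le> n f" if "hole6 b c d e x a" for x
    using r[OF that] assms by (simp add: max6_def)
  moreover have "n x \<le> n a" if "hole6 b c d e f x" for x
    using r[OF that] assms by (simp add: max6_def)
  moreover have "hole6 b c d e f a"
    using hole6_rotate[of a b c d e f] assms by (simp add: max6_def)
  ultimately show ?thesis
    by (simp add: max6_def)
qed

lemma max6_exists:
  assumes "hole6 a b c d e f"
  shows "\<exists>a b c d e f. max6 a b c d e f"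
proof -
  define P where "P xs \<longleftrightarrow>
    (\<exists>a b c d e f. xs = [a, b, c, d, e, f] \<and> hole6 a b c d e f)" for xs
  have "sum_list (map n xs) < 6 * D + 1" if "P xs" for xs
  proof -
    obtain a b c d e f where x: "xs = [a, b, c, d, e, f]" and h: "hole6 a b c d e f"
      using \<open>P xs\<close> unfolding P_def by blast
    then show ?thesis
      using hole6_V[OF h, THEN n_le] by simp
  qed
  moreover have "P [a, b, c, d, e, f]"
    using assms unfolding P_def by blast
  ultimately obtain xs where xs: "P xs"
    "\<And>ys. P ys \<Longrightarrow> sum_list (map n ys) \<le> sum_list (map n xs)"
    using ex_has_greatest_nat[of P _ "\<lambda>xs. sum_list (map n xs)" "6 * D + 1"] by blast
  then obtain a b c d e f where h: "xs = [a, b, c, d, e, f]" "hole6 a b c d e f"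
    unfolding P_def by blast
  have le: "n a' + (n b' + (n c' + (n d' + (n e' + n f')))) \<le>
    n a + (n b + (n c + (n d + (n e + n f))))"
    if "hole6 a' b' c' d' e' f'" for a' b' c' d' e' f'
    using xs(2)[of "[a', b', c', d', e', f']"] that h(1) by (auto simp: P_def)
  have "max6 a b c d e f"
    unfolding max6_def using h(2) le[of _ b c d e f] le[of a _ c d e f] le[of a b _ d e f]
      le[of a b c _ e f] le[of a b c d _ f] le[of a b c d e] by simp
  then show ?thesis
    by blast
qed

lemma n_le_witness:
  assumes "n a \<le> n c" "R a b" "\<not> R c b"
  shows "\<exists>y. R y c \<and> \<not> R y a"
proof (rule ccontr)
  assume "\<not> ?thesis"
  then have "{y \<in> V. R c y} \<subset> {y \<in> V. R a y}"
    using assms(2,3) R_commute R_V by blast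
  then have "n c < n a"
    using finite_V by (simp add: psubset_card_mono)
  then show False
    using assms(1) by simp
qed

lemma max6_chord:
  assumes m: "max6 c1 c2 c3 c4 c5 c6" and c: "chord c1 c2 c3 c4 c5 c6 a b"
  shows "\<exists>y\<in>V. R y c1 \<and> \<not> R y a"
proof -
  have h: "hole6 c1 c2 c3 c4 c5 c6"
    using m by (simp add: max6_def)
  have "hole6 a c2 c3 c4 c5 c6"
    using h c R_commute unfolding cfg6_defs chord_def by blast
  then have "n a \<le> n c1"
    using m by (simp add: max6_def)
  moreover have "R a b" "\<not> R c1 b"
    using c R_commute unfolding cfg6_defs chord_def by blast+
  ultimately show ?thesis
    using n_le_witness R_V by blast
qed

lemma no_two_chords:
  assumes m: "max6 c1 c2 c3 c4 c5 c6" and c: "chord c1 c2 c3 c4 c5 c6 a b"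
    and d: "chord c2 c3 c4 c5 c6 c1 d e \<or> chord c4 c5 c6 c1 c2 c3 d e \<or>
      chord c6 c1 c2 c3 c4 c5 d e"
  shows False
proof -
  have h: "hole6 c1 c2 c3 c4 c5 c6"
    using m by (simp add: max6_def)
  obtain y where "y \<in> V" "R y c1" "\<not> R y a"
    using max6_chord[OF m c] by blast
  then show False
    using d two_chords1[OF h c] two_chords2[OF h c] two_chords3[OF h c] by blast
qed

lemma no_triangle:
  assumes m: "max6 c1 c2 c3 c4 c5 c6" and c: "chord c1 c2 c3 c4 c5 c6 a b"
    "chord c3 c4 c5 c6 c1 c2 b d" "R a d"
  shows False
proof -
  have h: "hole6 c1 c2 c3 c4 c5 c6"
    using m by (simp add: max6_def)
  obtain y where "y \<in> V" "R y c1" "\<not> R y a"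
    using max6_chord[OF m c(1)] by blast
  then show False
    using even_triangle[OF h c] by blast
qed

text \<open>\<open>{c1, c3, c5}\<close> is stable, hence missed by a maximum clique; that clique
  cannot be extended by any of the three.\<close>

lemma missing_odd:
  assumes h: "hole6 c1 c2 c3 c4 c5 c6"
  obtains K k1 k3 k5 where "cliq K" "card K = w" "k1 \<in> K" "k3 \<in> K" "k5 \<in> K"
    "\<not> R k1 c1" "\<not> R k3 c3" "\<not> R k5 c5"
proof -
  have "stab {c1, c3, c5}"
    using h R_commute unfolding stab_def cfg_defs by blast
  then obtain K where K: "cliq K" "card K = w" "K \<inter> {c1, c3, c5} = {}"
    using missed_clique by blast
  then have "\<exists>x\<in>K. \<not> R x c1" "\<exists>x\<in>K. \<not> R x c3"
    "\<exists>x\<in>K. \<not> R x c5"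
    using max_clique_extend[OF K(1,2)] hole6_V[OF h] by blast+
  then show thesis
    using K that by blast
qed

text \<open>An opposite vertex of one kind excludes the other two kinds, and the arcs of four
  vertices on either side of its axis fall to \<open>opp3_below1\<close> and
  \<open>opp3_below2\<close>. Then every vertex satisfies \<open>theta6\<close> and
  \<open>opp3_count\<close> applies.\<close>

lemma no_opp3:
  assumes h: "hole6 c1 c2 c3 c4 c5 c6" and n3: "opp c3 c4 c5 c6 c1 c2 n3"
  shows False
proof -
  note h2 = hole6_rotate[OF h]
  note h3 = hole6_rotate[OF h2]
  note h4 = hole6_rotate[OF h3]
  note V = hole6_V[OF h] opp_V[OF n3]
  have no1: "\<not> opp c1 c2 c3 c4 c5 c6 x" for x
    using no_two_opp[OF h3 n3] opp_rotate3 by blast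
  have no2: "\<not> opp c2 c3 c4 c5 c6 c1 x" for x
    using no_two_opp[OF h2 _ n3] by blast
  \<comment> \<open>Stated for a relabelled hole because rotation by three carries it to the other
    side of the axis through \<open>c3\<close> and \<open>c6\<close>.\<close>
  have no_m: "\<not> sees m [d6, d1, d2, d3] [d4, d5]"
    if h: "hole6 d1 d2 d3 d4 d5 d6" and n3: "opp d3 d4 d5 d6 d1 d2 n3" for m d1 d2 d3 d4 d5 d6
  proof
    assume m: "sees m [d6, d1, d2, d3] [d4, d5]"
    have "\<not> R d1 n3" "m \<in> V" "d1 \<in> V"
      using n3 m hole6_V[OF h] R_commute unfolding cfg6_defs by blast+
    note b = opp3_below1[OF h n3 m] opp3_below2[OF h n3 m]
    have "cliq {y \<in> V. R y d1 \<and> R y n3}"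
    proof -
      have "R x y" if "R x d1" "R x n3" "R y d1" "R y n3" for x y
        using C4[of x d1 y n3] that \<open>\<not> R d1 n3\<close> R_commute by blast
      then show ?thesis
        by (simp add: cliq_def)
    qed
    note c = cliq_card[OF this]
    have "int (n d1) + int (n n3) \<le> int (n m) + int (card {y \<in> V. R y d1 \<and> R y n3})"
      using sum_mono_V[of "\<lambda>y. (if R y d1 then 1 else 0) + (if R y n3 then 1 else 0)"
          "\<lambda>y. (if R y m then 1 else 0) + (if R y d1 \<and> R y n3 then 1 else 0)"] b
      by (simp add: sum.distrib card_int n_alt)
    moreover have "n m + w + 2 \<le> n d1 + n n3"
      by (rule two_n; use \<open>m \<in> V\<close> \<open>d1 \<in> V\<close> opp_V[OF n3] in simp)
    ultimately show False
      using c by linarith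
  qed
  have m1: "\<not> sees x [c6, c1, c2, c3] [c4, c5]" for x
    by (rule no_m[OF h n3])
  have m2: "\<not> sees x [c3, c4, c5, c6] [c1, c2]" for x
    using no_m[OF h4, of x] n3 opp_rotate3 unfolding sees.simps by blast
  have theta: "theta6 c1 c2 c3 c4 c5 c6 x" for x
    unfolding theta6_def using m1 m2 no1 no2 hole6_dominates[OF h] by blast
  obtain K k1 k3 k5 where K: "cliq K" "card K = w" "k1 \<in> K" "k3 \<in> K" "k5 \<in> K"
    "\<not> R k1 c1" "\<not> R k3 c3" "\<not> R k5 c5"
    using missing_odd[OF h] by blast
  have KV: "x \<in> V" if "x \<in> K" for x
    using cliq_subset[OF K(1)] that by blast
  have RK: "R x y" if "x \<in> K" "y \<in> K" for x y
    using K(1) that unfolding cliq_def by blast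
  have "K \<subseteq> {y \<in> V. R y n3 \<and> R y c6}"
    using opp3_odd_missed[OF h n3 KV[OF K(3)] theta KV[OF K(4)] theta KV[OF K(5)] theta _ theta
        K(6-8) RK[OF K(3,4)] RK[OF K(4,5)] RK[OF K(3,5)]] RK K(3-5) KV by blast
  then have Kle: "w \<le> card {y \<in> V. R y n3 \<and> R y c6}"
    using K(2) card_mono[of "{y \<in> V. R y n3 \<and> R y c6}" K] finite_V by simp
  have "cliq {y \<in> V. R y c6 \<and> R y c1}" "cliq {y \<in> V. R y c6 \<and> R y c5}"
    "cliq {y \<in> V. R y c3 \<and> R y n3}"
    using opp3_clique1[OF h n3 _ theta _ theta] opp3_clique2[OF h n3 _ theta _ theta]
      opp3_clique3[OF h n3 _ theta _ theta] by (simp_all add: cliq_def)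
  note c = this[THEN cliq_card]
  have "int (n c2) + int (n c4) + 2 * int (card {y \<in> V. R y n3 \<and> R y c6}) \<le> int (n c3) +
      int (card {y \<in> V. R y c6 \<and> R y c1}) + int (card {y \<in> V. R y c6 \<and> R y c5}) +
      int (card {y \<in> V. R y c3 \<and> R y n3})"
    using sum_mono_V[OF opp3_count[OF h n3 _ theta]] by (simp add: sum.distrib card_int n_alt)
  moreover have "n c3 + w + 2 \<le> n c2 + n c4"
    by (rule two_n; use V in simp)
  ultimately show False
    using c Kle by linarith
qed

lemma no_opp: "hole6 c1 c2 c3 c4 c5 c6 \<Longrightarrow> \<not> opp c1 c2 c3 c4 c5 c6 x"
  using no_opp3[OF hole6_rotate[OF hole6_rotate[OF hole6_rotate[OF hole6_rotate]]]] by blast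

lemma all_arcs:
  assumes h: "hole6 c1 c2 c3 c4 c5 c6" and y: "y \<in> V"
  shows "arc6 c1 c2 c3 c4 c5 c6 y"
proof (rule hole6_arc[OF h y])
  note far = hole6_dominates[OF h]
  show "\<not> sees y [] [c1, c2, c3, c4, c5, c6]"
    by (rule far)
  show "\<not> (R y c1 \<and> R y c2 \<and> R y c3 \<and> R y c4 \<and> R y c5 \<and> R y c6)"
    using no_universal[OF y] hole6_universal[OF h y] far by blast
  show "\<not> opp c1 c2 c3 c4 c5 c6 y" "\<not> opp c2 c3 c4 c5 c6 c1 y" "\<not> opp c3 c4 c5 c6 c1 c2 y"
    using no_opp[OF h] no_opp[OF hole6_rotate[OF h]] no_opp[OF hole6_rotate[OF hole6_rotate[OF h]]]
    by blast+
qed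

lemma opposite_arcs_no_missing:
  assumes h: "hole6 c1 c2 c3 c4 c5 c6" and mp: "opposite_arcs c1 c2 c3 c4 c5 c6 m p"
    and a: "sees a [c5, c6, c1] [c2, c3, c4]"
  shows "R a m"
proof (rule ccontr)
  assume am: "\<not> R a m"
  have m: "sees m [c6, c1, c2, c3] [c4, c5]" and p: "sees p [c3, c4, c5, c6] [c1, c2]"
    using mp by (simp_all add: opposite_arcs_def)
  note arc = all_arcs[OF h]
  obtain K k1 k3 k5 where K: "cliq K" "card K = w" "k1 \<in> K" "k3 \<in> K" "k5 \<in> K"
    "\<not> R k1 c1" "\<not> R k3 c3" "\<not> R k5 c5"
    using missing_odd[OF h] by blast
  have KV: "x \<in> V" if "x \<in> K" for x
    using cliq_subset[OF K(1)] that by blast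
  have RK: "R x y" if "x \<in> K" "y \<in> K" for x y
    using K(1) that unfolding cliq_def by blast
  let ?r = "\<lambda>y. (if R y c6 then 1 else 0) +
    (if R y c6 \<and> R y c1 \<and> \<not> R y c3 then 1 else 0) +
      (if R y p \<and> R y c5 \<and> R y c6 then 1 else (0::int))"
  have "(if R y a then 2 else 0) + (if y \<in> K then 1 else 0) \<le> ?r y" if "y \<in> V" for y
    using opposite_arcs_count[OF h m p a am arc[OF that]]
      opposite_arcs_count_clique[OF h m p a am arc[OF that] arc[OF KV[OF K(3)]] arc[OF KV[OF K(4)]]
        arc[OF KV[OF K(5)]] K(6-8) RK[OF K(3,4)] RK[OF K(4,5)] RK[OF K(3,5)]] RK K(3-5)
    by (cases "y \<in> K") simp_all
  then have "(\<Sum>y\<in>V. (if R y a then 2 else 0) + (if y \<in> K then 1 else 0)) \<le> sum ?r V"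
    by (rule sum_mono_V)
  moreover have "{y \<in> V. y \<in> K} = K"
    using KV by blast
  ultimately have "2 * int (n a) + int w \<le>
    int (n c6) + int (card {y \<in> V. R y c6 \<and> R y c1 \<and> \<not> R y c3}) +
      int (card {y \<in> V. R y p \<and> R y c5 \<and> R y c6})"
    using K(2) by (simp add: sum.distrib card_int n_alt)
  moreover have "cliq {y \<in> V. R y c6 \<and> R y c1 \<and> \<not> R y c3}"
    "cliq {y \<in> V. R y p \<and> R y c5 \<and> R y c6}"
    using opposite_arcs_clique1[OF h m p arc arc] opposite_arcs_clique2[OF h m p arc arc]
    by (simp_all add: cliq_def)
  note this[THEN cliq_card]
  moreover have "n c6 + w + 2 \<le> n a + n a"
    by (rule two_n; use hole6_V[OF h] a in simp)
  ultimately show False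
    by linarith
qed

lemma no_opposite_arcs:
  assumes h: "hole6 c1 c2 c3 c4 c5 c6"
  shows "\<not> opposite_arcs c1 c2 c3 c4 c5 c6 m p"
proof
  assume mp: "opposite_arcs c1 c2 c3 c4 c5 c6 m p"
  then have m: "sees m [c6, c1, c2, c3] [c4, c5]" and p: "sees p [c3, c4, c5, c6] [c1, c2]"
    by (simp_all add: opposite_arcs_def)
  note arc = all_arcs[OF h]
  have h4: "hole6 c4 c5 c6 c1 c2 c3"
    by (rule hole6_rotate[OF hole6_rotate[OF hole6_rotate[OF h]]])
  have pm: "opposite_arcs c4 c5 c6 c1 c2 c3 p m"
    using m p unfolding opposite_arcs_def sees.simps by blast
  have a3: "R y p" if "sees y [c2, c3, c4] [c1, c5, c6]" for y
    using opposite_arcs_no_missing[OF h4 pm, of y] that unfolding sees.simps by blast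
  have a6: "R y m" if "sees y [c5, c6, c1] [c2, c3, c4]" for y
    by (rule opposite_arcs_no_missing[OF h mp that])
  have "cliq {y \<in> V. R y c4 \<and> R y c5}"
    using opposite_arcs_clique3[OF h m p arc arc] by (simp add: cliq_def)
  note c = cliq_card[OF this]
  have "int (n c4) + int (n c5) \<le> int (n p) + int (card {y \<in> V. R y c4 \<and> R y c5})"
    using sum_mono_V[OF opposite_arcs_final[OF h m p arc a3 a6]] by (simp add: sum.distrib card_int n_alt)
  moreover have "n p + w + 2 \<le> n c4 + n c5"
    by (rule two_n; use hole6_V[OF h] p in simp)
  ultimately show False
    using c by linarith
qed

text \<open>The other alternatives of \<open>odd_missed\<close> are gone: opposite arcs by
  \<open>no_opposite_arcs\<close>, the even triangle by maximality of the hole.\<close>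

lemma odd_chord:
  assumes m: "max6 c1 c2 c3 c4 c5 c6"
  shows "\<exists>a b. chord c1 c2 c3 c4 c5 c6 a b \<or> chord c3 c4 c5 c6 c1 c2 a b \<or>
    chord c5 c6 c1 c2 c3 c4 a b"
proof -
  have h: "hole6 c1 c2 c3 c4 c5 c6"
    using m by (simp add: max6_def)
  note h2 = hole6_rotate[OF h]
  obtain K k1 k3 k5 where K: "cliq K" "card K = w" "k1 \<in> K" "k3 \<in> K" "k5 \<in> K"
    "\<not> R k1 c1" "\<not> R k3 c3" "\<not> R k5 c5"
    using missing_odd[OF h] by blast
  have KV: "x \<in> V" if "x \<in> K" for x
    using cliq_subset[OF K(1)] that by blast
  have RK: "R x y" if "x \<in> K" "y \<in> K" for x y
    using K(1) that unfolding cliq_def by blast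
  show ?thesis
    using odd_missed[OF h all_arcs[OF h] all_arcs[OF h] all_arcs[OF h] K(6-8) RK[OF K(3,4)] RK[OF K(4,5)]
        RK[OF K(3,5)]] KV K(3-5) no_opposite_arcs[OF h] no_opposite_arcs[OF h2]
      no_opposite_arcs[OF hole6_rotate[OF h2]] no_triangle[OF max6_rotate[OF m]]
    by blast
qed

text \<open>\<open>odd_chord\<close> gives a chord between odd positions and, after rotation by one,
  another between even positions. Up to rotation these are the pairs refuted by
  \<open>no_two_chords\<close>.\<close>

lemma no_hole6: "\<not> hole6 c1 c2 c3 c4 c5 c6"
proof
  assume "hole6 c1 c2 c3 c4 c5 c6"
  then obtain c1 c2 c3 c4 c5 c6 where m: "max6 c1 c2 c3 c4 c5 c6"
    using max6_exists by blast
  have no: False if m: "max6 c1 c2 c3 c4 c5 c6" and c: "chord c1 c2 c3 c4 c5 c6 a b"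
    for c1 c2 c3 c4 c5 c6 a b
    using no_two_chords[OF m c] odd_chord[OF max6_rotate[OF m]] by blast
  note m3 = max6_rotate[OF max6_rotate[OF m]]
  note m5 = max6_rotate[OF max6_rotate[OF m3]]
  show False
    using odd_chord[OF m] no[OF m] no[OF m3] no[OF m5] by blast
qed

lemma no_C6:
  assumes "R a b" "R b c" "R c d" "R d e" "R e f" "R f a"
  shows "R a c \<or> R a d \<or> R a e \<or> R b d \<or> R b e \<or> R b f \<or> R c e \<or> R c f \<or>
    R d f"
  using assms no_hole6[of a b c d e f] R_commute R_V unfolding cfg_defs by metis

section \<open>Pyramids\<close>

definition pyramid where
  "pyramid h l1 l2 l3 m1 m2 m3 \<longleftrightarrow>
  sees h [l1, l2, l3] [m1, m2, m3] \<and> sees l1 [h, m1] [l2, l3, m2, m3] \<and>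
     sees l2 [h, m2] [l1, l3, m1, m3] \<and> sees l3 [h, m3] [l1, l2, m1, m2] \<and>
     sees m1 [l1, m2, m3] [h, l2, l3] \<and> sees m2 [l2, m1, m3] [h, l1, l3] \<and>
     sees m3 [l3, m1, m2] [h, l1, l2]"

text \<open>Such an \<open>x\<close> is complete to one of the three five-holes of the pyramid and
  sees nothing of the remaining leg.\<close>

definition half where
  "half h l1 l2 l3 m1 m2 m3 x \<longleftrightarrow>
  sees x [h, l1, l2, m1, m2] [l3, m3] \<or> sees x [h, l1, l3, m1, m3] [l2, m2] \<or>
     sees x [h, l2, l3, m2, m3] [l1, m1]"

definition full where
  "full h l1 l2 l3 m1 m2 m3 x \<longleftrightarrow> sees x [h, l1, l2, l3, m1, m2, m3] []"

lemmas pyramid_defs = cfg_defs pyramid_def half_def full_def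

text \<open>With its mirror image this puts the closed neighbourhoods of \<open>l1\<close> and
  \<open>l2\<close> inside that of \<open>t\<close>, whereupon \<open>below_adjacent\<close> makes
  \<open>l1\<close> and \<open>l2\<close> adjacent.\<close>

lemma pyramid_half_below:
  assumes "pyramid h l1 l2 l3 m1 m2 m3"
    "sees t [h, l1, l2, m1, m2] [l3, m3]" "y \<in> V" "R y l1"
  shows "R y t"
  using assms
    C4[of h t m1 y] C4[of m1 l1 y m3] C4[of t l1 y l2] C4[of t l1 y m2] no_C6[of h l1 y m3 m2 l2]
    no_C6[of l1 t m2 m3 l3 y] P6[of l3 m3 m2 t l1 y]
  unfolding pyramid_defs by (smt (verit) R_commute)

lemma pyramid_one_leg12:
  assumes "pyramid h l1 l2 l3 m1 m2 m3"
    "x \<in> V" "\<not> half h l1 l2 l3 m1 m2 m3 x"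
    "v \<in> V" "\<not> half h l1 l2 l3 m1 m2 m3 v"
    "k1 \<in> V" "\<not> half h l1 l2 l3 m1 m2 m3 k1"
    "k2 \<in> V" "\<not> half h l1 l2 l3 m1 m2 m3 k2"
    "\<not> full h l1 l2 l3 m1 m2 m3 k1" "\<not> full h l1 l2 l3 m1 m2 m3 k2"
    "\<not> R x h" "\<not> R v m1" "R x v" "R x k1" "R x k2" "R v k1" "R v k2" "R k1 k2"
    "R k1 l1" "R k2 l2"
  shows "False"
  using assms
    C4[of h k2 m3 l3] C4[of h l2 k2 l3] C4[of l1 h k2 k1] C4[of l1 h k2 m1] C4[of l1 h k2 x]
    C4[of l1 h l2 k2] C4[of l1 h l2 x] C4[of l1 h l3 x] C4[of l1 h v k1] C4[of l1 k1 k2 m1]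
    C4[of l1 m1 k2 v] C4[of l1 m1 m3 x] C4[of l2 h k1 k2] C4[of l2 h k1 m2] C4[of l2 h k1 x]
    C4[of l2 h l3 x] C4[of l3 h k1 m3] C4[of l3 m3 k2 v] C4[of m1 l1 k1 x] C4[of m1 l1 k2 m2]
    C4[of m1 l1 k2 x] C4[of m2 k2 k1 m1] C4[of m2 l2 k1 m1] C4[of m2 l2 k2 m1] C4[of m2 l2 k2 x]
    C4[of m2 l2 x m3] C4[of m3 l3 k1 m1] C4[of m3 l3 k2 m2] C4[of m3 l3 x m1] C4[of m3 l3 x m2]
    no_C6[of h k2 x m3 m1 l1] no_C6[of h l1 m1 m3 k2 l2] no_C6[of h l1 m1 m3 v l2]
    no_C6[of h l2 k2 m1 m3 l3] dom5[of h l1 m1 m3 l3 k2] dom5[of h l1 m1 m3 l3 v]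
    dom5[of h l1 m1 m3 l3 x] P6[of l1 h l2 m2 m3 x] P6[of l2 h l1 m1 m3 v] P6[of l3 h l1 m1 m2 x]
    P6[of l3 h l2 m2 m1 x] P6[of m1 m2 l2 h l3 x] P6[of m3 m2 l2 h l1 x]
    R_commute[of h k2] R_commute[of m3 k2] R_commute[of l3 m3] R_commute[of h l3]
    R_commute[of h m3] R_commute[of l3 k2] R_commute[of h l2] R_commute[of l2 k2]
    R_commute[of l2 l3] R_commute[of h l1] R_commute[of k1 k2] R_commute[of l1 k1]
    R_commute[of l1 k2] R_commute[of h k1] R_commute[of m1 k2] R_commute[of l1 m1]
    R_commute[of h m1] R_commute[of x k2] R_commute[of l1 x] R_commute[of h x] R_commute[of l1 l2]
    R_commute[of l2 x] R_commute[of l3 x] R_commute[of l1 l3] R_commute[of h v] R_commute[of v k1]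
    R_commute[of l1 v] R_commute[of m1 k1] R_commute[of v k2] R_commute[of m1 v]
    R_commute[of m1 m3] R_commute[of m3 x] R_commute[of l1 m3] R_commute[of m1 x]
    R_commute[of l2 k1] R_commute[of m2 k1] R_commute[of l2 m2] R_commute[of h m2]
    R_commute[of x k1] R_commute[of m3 k1] R_commute[of l3 k1] R_commute[of l3 v]
    R_commute[of m3 v] R_commute[of m2 k2] R_commute[of m1 m2] R_commute[of l1 m2]
    R_commute[of l2 m1] R_commute[of m2 x] R_commute[of m2 m3] R_commute[of l2 m3]
    R_commute[of l3 m1] R_commute[of l3 m2] R_commute[of l2 v]
  unfolding pyramid_defs by (smt (verit))

lemma pyramid_one_leg13:
  assumes "pyramid h l1 l2 l3 m1 m2 m3"
    "x \<in> V" "\<not> half h l1 l2 l3 m1 m2 m3 x"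
    "v \<in> V" "\<not> half h l1 l2 l3 m1 m2 m3 v"
    "k1 \<in> V" "\<not> half h l1 l2 l3 m1 m2 m3 k1"
    "k2 \<in> V" "\<not> half h l1 l2 l3 m1 m2 m3 k2"
    "\<not> full h l1 l2 l3 m1 m2 m3 k1" "\<not> full h l1 l2 l3 m1 m2 m3 k2"
    "\<not> R x h" "\<not> R v m1" "R x v" "R x k1" "R x k2" "R v k1" "R v k2" "R k1 k2"
    "R k1 l1" "R k2 l3"
  shows "False"
  using assms
    C4[of h k1 m2 l2] C4[of h k1 x l3] C4[of h k2 m1 l1] C4[of h k2 m2 l2] C4[of h l2 x v]
    C4[of l1 h k2 k1] C4[of l1 h k2 x] C4[of l1 h l2 x] C4[of l1 h l3 x] C4[of l1 h v k1]
    C4[of l1 h v x] C4[of l1 k2 m3 m1] C4[of l1 k2 x m1] C4[of l2 h k2 x] C4[of l2 h l3 x]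
    C4[of l3 h k1 m3] C4[of l3 h v k2] C4[of l3 k1 m1 m3] C4[of l3 k2 m1 m3] C4[of l3 k2 x m3]
    C4[of m1 l1 k1 x] C4[of m1 l1 v m2] C4[of m1 l1 v m3] C4[of m1 l1 x m2] C4[of m2 l2 k1 x]
    C4[of m2 l2 k2 m3] C4[of m2 l2 v x] C4[of m3 k2 k1 m1] C4[of m3 l3 v x] C4[of m3 l3 x m1]
    C4[of m3 m1 k1 v] no_C6[of h l1 m1 m2 v l3] no_C6[of h l1 m1 m2 x l3]
    no_C6[of h l1 m1 m3 v l2] no_C6[of h l2 x m1 m3 l3] dom5[of h l1 m1 m3 l3 v]
    dom5[of h l1 m1 m3 l3 x] dom5[of h l2 m2 m1 l1 v] dom5[of h l2 m2 m1 l1 x]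
    dom5[of h l2 m2 m3 l3 x] dom5[of l1 v l3 m3 m1 l2] P6[of l1 h l2 m2 m3 x]
    P6[of l1 m1 m2 l2 v l3] P6[of l2 h l1 m1 m3 x] P6[of l2 h l3 m3 m1 x] P6[of l2 v l1 m1 m3 l3]
    P6[of l3 h l1 m1 m2 v] P6[of m3 m2 l2 h l1 v]
    R_commute[of h k1] R_commute[of m2 k1] R_commute[of l2 m2] R_commute[of h l2]
    R_commute[of h m2] R_commute[of l2 k1] R_commute[of x k1] R_commute[of l3 x]
    R_commute[of h l3] R_commute[of h x] R_commute[of l3 k1] R_commute[of h k2]
    R_commute[of m1 k2] R_commute[of l1 m1] R_commute[of h l1] R_commute[of h m1]
    R_commute[of l1 k2] R_commute[of m2 k2] R_commute[of l2 k2] R_commute[of l2 x]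
    R_commute[of x v] R_commute[of h v] R_commute[of l2 v] R_commute[of k1 k2] R_commute[of l1 k1]
    R_commute[of x k2] R_commute[of l1 x] R_commute[of l1 l2] R_commute[of l1 l3]
    R_commute[of v k1] R_commute[of l1 v] R_commute[of m3 k2] R_commute[of m1 m3]
    R_commute[of l1 m3] R_commute[of m1 x] R_commute[of l2 l3] R_commute[of m3 k1]
    R_commute[of l3 m3] R_commute[of h m3] R_commute[of v k2] R_commute[of l3 k2]
    R_commute[of l3 v] R_commute[of m1 k1] R_commute[of l3 m1] R_commute[of m3 x]
    R_commute[of m2 v] R_commute[of m1 m2] R_commute[of m1 v] R_commute[of l1 m2]
    R_commute[of m3 v] R_commute[of m2 x] R_commute[of m2 m3] R_commute[of l2 m3]
    R_commute[of l3 m2] R_commute[of l2 m1]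
  unfolding pyramid_defs by (smt (verit))

lemma pyramid_one_leg23:
  assumes "pyramid h l1 l2 l3 m1 m2 m3"
    "x \<in> V" "\<not> half h l1 l2 l3 m1 m2 m3 x"
    "v \<in> V" "\<not> half h l1 l2 l3 m1 m2 m3 v"
    "k1 \<in> V" "\<not> half h l1 l2 l3 m1 m2 m3 k1"
    "k2 \<in> V" "\<not> half h l1 l2 l3 m1 m2 m3 k2"
    "\<not> full h l1 l2 l3 m1 m2 m3 k1" "\<not> full h l1 l2 l3 m1 m2 m3 k2"
    "\<not> R x h" "\<not> R v m1" "R x v" "R x k1" "R x k2" "R v k1" "R v k2" "R k1 k2"
    "R k1 l2" "R k2 l3"
  shows "False"
  using assms
    C4[of h l2 k1 l3] C4[of l1 h k1 m1] C4[of l1 h k2 m1] C4[of l1 h l2 k1] C4[of l1 h l2 x]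
    C4[of l1 h l3 x] C4[of l1 h v x] C4[of l1 k1 x m1] C4[of l1 k2 m3 m1] C4[of l2 h k2 m2]
    C4[of l2 h l3 x] C4[of l2 h v k1] C4[of l2 h v x] C4[of l3 h k1 k2] C4[of l3 h k1 m3]
    C4[of l3 h k1 x] C4[of l3 h v k2] C4[of l3 h v m3] C4[of l3 k1 m2 m3] C4[of l3 k2 m1 m3]
    C4[of m1 l1 k1 m2] C4[of m1 l1 k2 x] C4[of m1 l1 v m2] C4[of m1 l1 v x] C4[of m1 l1 x m3]
    C4[of m2 k1 k2 m3] C4[of m2 k1 v m3] C4[of m2 l2 k1 m1] C4[of m2 l2 k1 v] C4[of m2 l2 k1 x]
    C4[of m2 l2 k2 m3] C4[of m2 l2 v x] C4[of m3 k1 v l3] C4[of m3 l3 k2 x]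
    no_C6[of h l1 m1 m2 v l3] no_C6[of h l1 m1 m2 x l3] no_C6[of h l1 m1 m3 v l2]
    no_C6[of h l1 m1 m3 x l2] no_C6[of h l1 v m3 m2 l2] dom5[of h l1 m1 m3 l3 v]
    dom5[of h l1 m1 m3 l3 x] dom5[of h l2 m2 m1 l1 v] dom5[of h l2 m2 m1 l1 x]
    dom5[of h l2 m2 m3 l3 v] dom5[of h l2 m2 m3 l3 x] P6[of k1 m2 m3 l3 h l1]
    P6[of l1 h l3 m3 m2 x] P6[of l1 m1 m2 l2 k1 v] P6[of l1 m1 m2 l2 v l3] P6[of l1 m1 m3 k2 v l2]
    P6[of l1 m1 m3 l3 k2 v] P6[of l1 m1 m3 l3 v l2] P6[of l2 k1 v l1 m1 m3] P6[of l3 h l1 m1 m2 v]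
    P6[of l3 h l2 m2 m1 x]
    R_commute[of h l2] R_commute[of l2 k1] R_commute[of l3 k1] R_commute[of h l3]
    R_commute[of h k1] R_commute[of l2 l3] R_commute[of h l1] R_commute[of m1 k1]
    R_commute[of l1 m1] R_commute[of l1 k1] R_commute[of h m1] R_commute[of h k2]
    R_commute[of m1 k2] R_commute[of l1 k2] R_commute[of l1 l2] R_commute[of l2 x]
    R_commute[of l1 x] R_commute[of h x] R_commute[of l3 x] R_commute[of l1 l3] R_commute[of h v]
    R_commute[of x v] R_commute[of l1 v] R_commute[of x k1] R_commute[of m1 x] R_commute[of m3 k2]
    R_commute[of m1 m3] R_commute[of l1 m3] R_commute[of m2 k2] R_commute[of l2 m2]
    R_commute[of l2 k2] R_commute[of h m2] R_commute[of v k1] R_commute[of l2 v]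
    R_commute[of k1 k2] R_commute[of l3 k2] R_commute[of m3 k1] R_commute[of l3 m3]
    R_commute[of h m3] R_commute[of v k2] R_commute[of l3 v] R_commute[of m3 v]
    R_commute[of m2 k1] R_commute[of m2 m3] R_commute[of l3 m2] R_commute[of l3 m1]
    R_commute[of m1 m2] R_commute[of l1 m2] R_commute[of x k2] R_commute[of m2 v]
    R_commute[of m1 v] R_commute[of m3 x] R_commute[of l2 m1] R_commute[of m2 x]
    R_commute[of l2 m3]
  unfolding pyramid_defs by (smt (verit))

text \<open>The summand 1 on the left counts the vertices \<open>y\<close> of a maximum clique
  through \<open>x\<close>. Without it the inequality is trivial and serves the other vertices; the
  total bounds \<open>n l1 + n l2\<close> by \<open>n h + w\<close>.\<close>

lemma pyramid_count_clique:
  assumes "pyramid h l1 l2 l3 m1 m2 m3"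
    "x \<in> V" "\<not> half h l1 l2 l3 m1 m2 m3 x"
    "y \<in> V" "\<not> half h l1 l2 l3 m1 m2 m3 y"
    "\<not> R x h" "R x y"
    "R y l1 \<Longrightarrow> full h l1 l2 l3 m1 m2 m3 y"
    "R y l2 \<Longrightarrow> full h l1 l2 l3 m1 m2 m3 y"
  shows "(if R y l1 then 1 else 0) + (if R y l2 then 1 else 0) + 1 \<le>
    (if R y h then 1 else 0) + (if R y l1 \<and> R y l2 then 1 else 0) +
    (if \<not> R y h \<and> (R y l1 \<or> R y l2) \<or>
    R y m1 \<and> R y m2 \<and> R y m3 then 1 else (0::int))"
  using assms
    C4[of l3 m3 m1 y] no_C6[of h l1 m1 m2 y l3] dom5[of h l2 m2 m1 l1 y] P6[of l1 h l2 m2 m3 y]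
    P6[of l2 h l3 m3 m1 y] P6[of l3 h l1 m1 m2 y]
  unfolding pyramid_defs by (smt (verit) R_commute)

lemma pyramid_clique_outer:
  assumes "pyramid h l1 l2 l3 m1 m2 m3"
    "x \<in> V" "\<not> half h l1 l2 l3 m1 m2 m3 x"
    "y \<in> V" "\<not> half h l1 l2 l3 m1 m2 m3 y"
    "\<not> R x h" "\<not> R y h" "R x l1 \<or> R x l2" "R y l1 \<or> R y l2"
  shows "R x y"
  using assms
    C4[of h l1 y l3] C4[of h l2 x l3] C4[of l1 m1 m2 x] C4[of l2 x m3 y] C4[of l3 m3 m1 x]
    C4[of l3 m3 m1 y] C4[of m2 l2 y m1] C4[of x l1 y m3] no_C6[of h l1 x m2 m3 l3]
    no_C6[of h l1 x m3 y l2] no_C6[of h l1 y m2 m3 l3] no_C6[of h l1 y m3 x l2]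
    no_C6[of h l2 x m1 m3 l3] dom5[of h l2 m2 m3 l3 y] P6[of l1 h l3 m3 m2 y]
    P6[of m1 m3 l3 h l2 x] P6[of m1 m3 l3 h l2 y] P6[of m3 m1 l1 h l2 y] P6[of m3 m2 l2 h l1 x]
  unfolding pyramid_defs by (smt (verit) R_commute)

lemma pyramid_clique_mixed:
  assumes "pyramid h l1 l2 l3 m1 m2 m3"
    "x \<in> V" "\<not> half h l1 l2 l3 m1 m2 m3 x"
    "y \<in> V" "\<not> half h l1 l2 l3 m1 m2 m3 y"
    "\<not> R x h" "R x l1 \<or> R x l2" "R y m1" "R y m2" "R y m3"
  shows "R x y"
  using assms
    C4[of h l1 m1 y] C4[of h l2 m2 y] C4[of l2 h l3 x] C4[of m2 l2 x m1] C4[of m2 l2 x m3]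
    C4[of m3 l3 x m2] C4[of x l1 y m2] C4[of x l1 y m3] C4[of x l2 y m3] no_C6[of h l1 x m2 y l3]
    no_C6[of h l1 x m3 y l2] no_C6[of h l1 y m3 x l2] dom5[of h l1 m1 m3 l3 x]
    P6[of l1 h l3 m3 m2 x] P6[of l1 h l3 y m2 x] P6[of l2 h l1 x m3 y] P6[of l3 h l1 m1 m2 x]
    P6[of l3 h l1 x m2 y] P6[of l3 h l2 x m1 y] P6[of m2 m3 l3 h l1 x] P6[of m3 m2 l2 h l1 x]
  unfolding pyramid_defs by (smt (verit) R_commute)

lemma pyramid_swap: "pyramid h l1 l2 l3 m1 m2 m3 \<Longrightarrow> pyramid h l2 l1 l3 m2 m1 m3"
  unfolding pyramid_def sees.simps by blast

lemma pyramid_rotate: "pyramid h l1 l2 l3 m1 m2 m3 \<Longrightarrow> pyramid h l2 l3 l1 m2 m3 m1"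
  unfolding pyramid_def sees.simps by blast

lemma full_rotate: "full h l2 l3 l1 m2 m3 m1 x \<longleftrightarrow> full h l1 l2 l3 m1 m2 m3 x"
  unfolding full_def sees.simps by blast

text \<open>Otherwise \<open>n p + n q \<le> n x + w\<close>, since the common neighbours of \<open>p\<close> and \<open>q\<close> form a clique.\<close>

lemma below_adjacent:
  assumes V: "p \<in> V" "q \<in> V"
    "x \<in> V" and p: "\<And>y. y \<in> V \<Longrightarrow> R y p
    \<Longrightarrow> R y x" and q: "\<And>y. y \<in> V \<Longrightarrow> R y q \<Longrightarrow> R y x"
  shows "R p q"
proof (rule ccontr)
  assume pq: "\<not> R p q"
  have "cliq {y \<in> V. R y p \<and> R y q}"
  proof -
    have "R u v" if "R u p" "R u q" "R v p" "R v q" for u v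
      using C4[of u p v q] that pq R_commute by blast
    then show ?thesis
      by (simp add: cliq_def)
  qed
  note c = cliq_card[OF this]
  have "(if R y p then 1 else 0) + (if R y q then 1 else 0) \<le>
      (if R y x then 1 else 0) + (if R y p \<and> R y q then 1 else (0::int))" if "y \<in> V" for y
    using p[OF that] q[OF that] by simp
  from sum_mono_V[OF this] have "int (n p) + int (n q) \<le>
    int (n x) + int (card {y \<in> V. R y p \<and> R y q})"
    by (simp add: sum.distrib card_int n_alt)
  then show False
    using c two_n[OF V] by linarith
qed

lemma pyramid_V:
  assumes "pyramid h l1 l2 l3 m1 m2 m3"
  shows "h \<in> V" "l1 \<in> V" "l2 \<in> V" "l3 \<in> V" "m1 \<in> V" "m2 \<in> V" "m3 \<in> V"
  using assms by (auto simp: pyramid_def)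

lemma no_half:
  assumes p: "pyramid h l1 l2 l3 m1 m2 m3"
  shows "\<not> half h l1 l2 l3 m1 m2 m3 x"
proof -
  have no: "\<not> sees x [h, l1, l2, m1, m2] [l3, m3]" if p: "pyramid h l1 l2 l3 m1 m2 m3"
    for l1 l2 l3 m1 m2 m3
  proof
    assume x: "sees x [h, l1, l2, m1, m2] [l3, m3]"
    then have x': "sees x [h, l2, l1, m2, m1] [l3, m3]"
      unfolding sees.simps by blast
    have "R l1 l2"
      by (rule below_adjacent[of _ _ x])
        (use pyramid_V[OF p] x pyramid_half_below[OF p x] pyramid_half_below[OF pyramid_swap[OF p] x'] in simp_all)
    then show False
      using p unfolding pyramid_defs by blast
  qed
  note p2 = pyramid_rotate[OF p]
  show ?thesis
    using no[OF p] no[OF p2] no[OF pyramid_rotate[OF p2]] unfolding half_def sees.simps by blast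
qed

lemma pyramid_clique_legs:
  assumes p: "pyramid h l1 l2 l3 m1 m2 m3" and K: "cliq K" "card K = w" "x \<in> K" "\<not> R x h"
    and legs: "\<And>y. y \<in> K \<Longrightarrow> R y l1 \<or> R y l2
      \<Longrightarrow> full h l1 l2 l3 m1 m2 m3 y"
  shows False
proof -
  have KV: "y \<in> V" if "y \<in> K" for y
    using cliq_subset[OF K(1)] that by blast
  have RK: "R y z" if "y \<in> K" "z \<in> K" for y z
    using K(1) that unfolding cliq_def by blast
  note V = pyramid_V[OF p]
  \<comment> \<open>The second alternative is restricted to \<open>K\<close> so that two of its
    vertices are adjacent; the other pairs are covered by \<open>pyramid_clique_outer\<close> and
    \<open>pyramid_clique_mixed\<close>.\<close>
  define Q where "Q y \<longleftrightarrow>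
    \<not> R y h \<and> (R y l1 \<or> R y l2) \<or>
    y \<in> K \<and> R y m1 \<and> R y m2 \<and> R y m3" for y
  have "(if R y l1 then 1 else 0) + (if R y l2 then 1 else 0) + (if y \<in> K then 1 else 0) \<le>
      (if R y h then 1 else 0) + (if R y l1 \<and> R y l2 then 1 else 0) + (if Q y then 1 else (0::int))"
    if y: "y \<in> V" for y
  proof (cases "y \<in> K")
    case True
    then show ?thesis
      using pyramid_count_clique[OF p KV[OF K(3)] no_half[OF p] y no_half[OF p] K(4) RK[OF K(3) True]]
        legs[OF True] by (simp add: Q_def)
  next
    case False
    then show ?thesis
      by (simp add: Q_def)
  qed
  from sum_mono_V[OF this] have "int (n l1) + int (n l2) + int (card {y \<in> V. y \<in> K}) \<le>
      int (n h) + int (card {y \<in> V. R y l1 \<and> R y l2}) + int (card {y \<in> V. Q y})"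
    by (simp add: sum.distrib card_int n_alt)
  moreover have "card {y \<in> V. y \<in> K} = w"
  proof -
    have "{y \<in> V. y \<in> K} = K"
      using KV by blast
    then show ?thesis
      using K(2) by simp
  qed
  moreover have "cliq {y \<in> V. R y l1 \<and> R y l2}"
  proof -
    have "\<not> R l1 l2"
      using p unfolding pyramid_defs by blast
    then have "R u v" if "R u l1" "R u l2" "R v l1" "R v l2" for u v
      using C4[of u l1 v l2] that R_commute by blast
    then show ?thesis
      by (simp add: cliq_def)
  qed
  note cliq_card[OF this]
  moreover have "cliq {y \<in> V. Q y}"
  proof -
    have "R u v" if "u \<in> V" "v \<in> V" "Q u" "Q v" for u v
      using that pyramid_clique_outer[OF p that(1) no_half[OF p] that(2) no_half[OF p]]
        pyramid_clique_mixed[OF p that(1) no_half[OF p] that(2) no_half[OF p]]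
        pyramid_clique_mixed[OF p that(2) no_half[OF p] that(1) no_half[OF p]] RK R_sym
      unfolding Q_def by blast
    then show ?thesis
      by (simp add: cliq_def)
  qed
  note cliq_card[OF this]
  moreover have "n h + w + 2 \<le> n l1 + n l2"
    by (rule two_n; use V in simp)
  ultimately show False
    by linarith
qed

lemma no_pyramid_graph: "\<not> pyramid h l1 l2 l3 m1 m2 m3"
proof
  assume p: "pyramid h l1 l2 l3 m1 m2 m3"
  note V = pyramid_V[OF p] and nh = no_half[OF p]
  have "stab {h, m1}"
    using p R_commute unfolding stab_def pyramid_defs by blast
  then obtain K where K: "cliq K" "card K = w" "K \<inter> {h, m1} = {}"
    using missed_clique by blast
  obtain x where x: "x \<in> K" "\<not> R x h"
    using max_clique_extend[OF K(1,2) V(1)] K(3) by blast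
  obtain v where v: "v \<in> K" "\<not> R v m1"
    using max_clique_extend[OF K(1,2) V(5)] K(3) by blast
  have KV: "y \<in> V" if "y \<in> K" for y
    using cliq_subset[OF K(1)] that by blast
  have RK: "R y z" if "y \<in> K" "z \<in> K" for y z
    using K(1) that unfolding cliq_def by blast
  define leg where "leg l \<longleftrightarrow>
    (\<exists>y\<in>K. R y l \<and> \<not> full h l1 l2 l3 m1 m2 m3 y)" for l
  have "\<not> (leg l1 \<and> leg l2)"
  proof
    assume "leg l1 \<and> leg l2"
    then obtain y z where yz: "y \<in> K" "R y l1" "\<not> full h l1 l2 l3 m1 m2 m3 y"
      "z \<in> K" "R z l2" "\<not> full h l1 l2 l3 m1 m2 m3 z"
      unfolding leg_def by blast
    show False
      by (rule pyramid_one_leg12[OF p KV[OF x(1)] nh KV[OF v(1)] nh KV[OF yz(1)] nh KV[OF yz(4)] nh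
          yz(3,6) x(2) v(2)]) (use x(1) v(1) yz RK in simp_all)
  qed
  moreover have "\<not> (leg l1 \<and> leg l3)"
  proof
    assume "leg l1 \<and> leg l3"
    then obtain y z where yz: "y \<in> K" "R y l1" "\<not> full h l1 l2 l3 m1 m2 m3 y"
      "z \<in> K" "R z l3" "\<not> full h l1 l2 l3 m1 m2 m3 z"
      unfolding leg_def by blast
    show False
      by (rule pyramid_one_leg13[OF p KV[OF x(1)] nh KV[OF v(1)] nh KV[OF yz(1)] nh KV[OF yz(4)] nh
          yz(3,6) x(2) v(2)]) (use x(1) v(1) yz RK in simp_all)
  qed
  moreover have "\<not> (leg l2 \<and> leg l3)"
  proof
    assume "leg l2 \<and> leg l3"
    then obtain y z where yz: "y \<in> K" "R y l2" "\<not> full h l1 l2 l3 m1 m2 m3 y"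
      "z \<in> K" "R z l3" "\<not> full h l1 l2 l3 m1 m2 m3 z"
      unfolding leg_def by blast
    show False
      by (rule pyramid_one_leg23[OF p KV[OF x(1)] nh KV[OF v(1)] nh KV[OF yz(1)] nh KV[OF yz(4)] nh
          yz(3,6) x(2) v(2)]) (use x(1) v(1) yz RK in simp_all)
  qed
  ultimately consider "\<not> leg l1" "\<not> leg l2" | "\<not> leg l2"
    "\<not> leg l3" | "\<not> leg l3" "\<not> leg l1"
    by blast
  then show False
  proof cases
    case 1
    then show False
      using pyramid_clique_legs[OF p K(1,2) x] unfolding leg_def by blast
  next
    case 2
    then show False
      by (intro pyramid_clique_legs[OF pyramid_rotate[OF p] K(1,2) x], subst full_rotate)
        (auto simp: leg_def)
  next
    case 3
    then show False
      by (intro pyramid_clique_legs[OF pyramid_rotate[OF pyramid_rotate[OF p]] K(1,2) x],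
          subst full_rotate, subst full_rotate) (auto simp: leg_def)
  qed
qed

lemma no_pyramid:
  assumes "R h l1" "R h l2" "R h l3" "R l1 m1" "R l2 m2" "R l3 m3" "R m1 m2" "R m2 m3" "R m1 m3"
  shows "R h m1 \<or> R h m2 \<or> R h m3 \<or> R l1 l2 \<or> R l1 l3 \<or> R l2 l3 \<or> R l1 m2 \<or>
    R l1 m3 \<or>
    R l2 m1 \<or> R l2 m3 \<or> R l3 m1 \<or> R l3 m2"
  using assms no_pyramid_graph[of h l1 l2 l3 m1 m2 m3] R_commute R_V unfolding pyramid_defs by metis

section \<open>Holes of length five\<close>

text \<open>On a maximal hole \<open>a\<close> can replace \<open>v5\<close> but sees
  \<open>b\<close> in addition, so some \<open>y\<close> sees \<open>v5\<close> and not
  \<open>a\<close>. All neighbours of \<open>y\<close> and, by the next lemma, of \<open>b\<close>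
  see \<open>v4\<close>; then \<open>below_adjacent\<close> makes \<open>y\<close> and
  \<open>b\<close> adjacent, against \<open>across_apart\<close>.\<close>

lemma across_below1:
  assumes "hole5 v1 v2 v3 v4 v5"
    "sees b [v3, v4] [v1, v2, v5]"
    "sees a [v4, v5, v1] [v2, v3]"
    "R a b" "y \<in> V" "R y v5" "\<not> R y a" "z \<in> V" "R z y"
  shows "R z v4"
  using assms
    C4[of a b y v5] C4[of v1 a v4 y] C4[of v2 v1 v5 y] C4[of v4 v3 y v5] no_C6[of a b v3 v2 y v5]
    P6[of v2 v3 b a v5 y] no_pyramid[of v3 b v2 y a v1 v5]
  unfolding cfg_defs by (smt (verit) R_commute)

lemma across_below2:
  assumes "hole5 v1 v2 v3 v4 v5"
    "sees b [v3, v4] [v1, v2, v5]"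
    "sees a [v4, v5, v1] [v2, v3]"
    "R a b" "y \<in> V" "R y v5" "\<not> R y a" "z \<in> V" "R z b"
  shows "R z v4"
  using assms
    C4[of a b z v1] C4[of v3 b z v2] C4[of v3 v4 a z] C4[of v5 v4 b z] no_C6[of b v4 v5 v1 v2 z]
    P6[of v2 v1 v5 v4 b z] no_pyramid[of v1 v2 v5 z v3 v4 b]
  unfolding cfg_defs by (smt (verit) R_commute)

lemma across_apart:
  assumes "hole5 v1 v2 v3 v4 v5"
    "sees b [v3, v4] [v1, v2, v5]"
    "sees a [v4, v5, v1] [v2, v3]"
    "R a b" "y \<in> V" "R y v5" "\<not> R y a"
  shows "\<not> R y b"
  using assms
    C4[of a b y v5]
  unfolding cfg_defs by (smt (verit) R_commute)

lemma edge_below: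
  assumes "hole5 v1 v2 v3 v4 v5"
    "sees b [v3, v4] [v1, v2, v5]"
    "z \<in> V" "R z b"
    "\<not> (sees z [v1, v2, v3] [v4, v5] \<and> R b z)"
    "\<not> (sees z [v4, v5, v1] [v2, v3] \<and> R b z)"
  shows "R z v3"
  using assms
    C4[of v3 b z v2] C4[of v5 v1 z v4] C4[of v5 v4 b z] no_C6[of b v3 v2 v1 v5 z]
    P6[of v5 v1 v2 v3 b z] no_pyramid[of v1 v2 v5 z v3 v4 b]
  unfolding cfg_defs by (smt (verit) R_commute)

text \<open>This and \<open>edge_path2\<close> refute the first two outcomes of
  \<open>attached_path\<close> for the vertices that see exactly the edge \<open>v3 v4\<close> of
  the hole.\<close>

lemma edge_path1:
  assumes "hole5 v1 v2 v3 v4 v5"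
    "sees q1 [v3, v4] [v1, v2, v5]"
    "\<not> sees s [v3, v4] [v1, v2, v5]" "\<not> sees t [v3, v4] [v1, v2, v5]"
    "s \<in> V" "t \<in> V" "R s q1" "R q1 t" "\<not> R s t"
    "\<not> (sees s [v1, v2, v3] [v4, v5] \<and> R q1 s)"
    "\<not> (sees s [v4, v5, v1] [v2, v3] \<and> R q1 s)"
    "\<not> (sees t [v1, v2, v3] [v4, v5] \<and> R q1 t)"
    "\<not> (sees t [v4, v5, v1] [v2, v3] \<and> R q1 t)"
  shows "False"
  using assms
    C4[of s q1 t v2] C4[of s q1 t v5] C4[of v1 s v3 v2] C4[of v1 t v4 v5] C4[of v2 v1 t v3]
    C4[of v3 q1 s v2] C4[of v3 q1 t v2] C4[of v5 s q1 v4] C4[of v5 t q1 v4] C4[of v5 v1 s v4]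
    no_C6[of q1 s v2 v1 v5 t] no_C6[of q1 s v5 v1 v2 t] P6[of s q1 v3 v2 v1 v5]
    P6[of s q1 v4 v5 v1 v2] P6[of t q1 v3 v2 v1 v5] P6[of t q1 v4 v5 v1 v2]
    no_pyramid[of v1 s v2 v5 q1 v3 v4] no_pyramid[of v1 t v2 v5 q1 v3 v4]
  unfolding cfg_defs by (smt (verit) R_commute)

lemma edge_path2:
  assumes "hole5 v1 v2 v3 v4 v5"
    "sees q1 [v3, v4] [v1, v2, v5]" "sees q2 [v3, v4] [v1, v2, v5]"
    "\<not> sees s [v3, v4] [v1, v2, v5]" "\<not> sees t [v3, v4] [v1, v2, v5]"
    "s \<in> V" "t \<in> V" "R s q1" "R q1 q2" "R q2 t" "\<not> R s t" "\<not> R s q2" "\<not> R q1 t"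
    "\<not> (sees s [v1, v2, v3] [v4, v5] \<and> R q1 s)"
    "\<not> (sees s [v4, v5, v1] [v2, v3] \<and> R q1 s)"
    "\<not> (sees t [v1, v2, v3] [v4, v5] \<and> R q1 t)"
    "\<not> (sees t [v4, v5, v1] [v2, v3] \<and> R q1 t)"
    "\<not> (sees s [v1, v2, v3] [v4, v5] \<and> R q2 s)"
    "\<not> (sees s [v4, v5, v1] [v2, v3] \<and> R q2 s)"
    "\<not> (sees t [v1, v2, v3] [v4, v5] \<and> R q2 t)"
    "\<not> (sees t [v4, v5, v1] [v2, v3] \<and> R q2 t)"
  shows "False"
  using assms
    C4[of v1 s v3 v2] C4[of v1 s v4 t] C4[of v1 v2 s v5] C4[of v2 s v4 t] C4[of v2 t q2 v3]
    C4[of v2 v1 t v3] C4[of v3 q1 s v2] C4[of v5 s q1 v4] C4[of v5 t q2 v4] C4[of v5 v1 s v4]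
    P6[of q1 q2 t v5 v1 v2] P6[of q1 v4 v5 v1 v2 t] P6[of q2 q1 s v2 v1 v5]
    P6[of q2 q1 s v5 v1 v2] P6[of s q1 v3 v2 v1 v5] P6[of s q1 v4 v5 v1 v2]
    P6[of t q2 v3 v2 v1 v5] P6[of t q2 v4 v5 v1 v2] no_pyramid[of v1 s v2 v5 q1 v3 v4]
    no_pyramid[of v1 t v2 v5 q2 v3 v4]
  unfolding cfg_defs by (smt (verit) R_commute)

definition edge5 where
  "edge5 v1 v2 v3 v4 v5 x \<longleftrightarrow>
  sees x [v3, v4] [v1, v2, v5] \<or> sees x [v4, v5] [v2, v3, v1] \<or>
     sees x [v5, v1] [v3, v4, v2] \<or> sees x [v1, v2] [v4, v5, v3] \<or> sees x [v2, v3] [v5, v1, v4]"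

lemma pendant_below:
  assumes "hole5 v1 v2 v3 v4 v5"
    "sees d [v1] [v2, v3, v4, v5]"
    "z \<in> V" "R z d"
    "\<not> edge5 v1 v2 v3 v4 v5 z"
  shows "R z v1"
  using assms
    C4[of v2 v1 d z] C4[of v5 v1 d z] no_C6[of d v1 v2 v3 v4 z] no_C6[of d v1 v5 v4 v3 z]
    P6[of v4 v3 v2 v1 d z]
  unfolding cfg_defs edge5_def by (smt (verit) R_commute)

text \<open>\<open>a\<close> can replace \<open>v2\<close> on the hole, sees all that
  \<open>v2\<close> sees, and sees \<open>d\<close> besides: impossible on a maximal hole.\<close>

lemma pendant_across:
  assumes "hole5 v1 v2 v3 v4 v5"
    "sees d [v1] [v2, v3, v4, v5]"
    "sees a [v1, v2, v3] [v4, v5]"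
    "R d a" "y \<in> V" "R y v2"
    "\<not> edge5 v1 v2 v3 v4 v5 y"
  shows "R y a"
  using assms
    C4[of a d y v2] C4[of a v1 y v3] C4[of v2 v1 v5 y] C4[of v3 v2 y v4] dom5[of v1 a v3 v4 v5 y]
    P6[of d a v2 y v4 v5] P6[of d a v2 y v5 v4]
  unfolding cfg_defs edge5_def by (smt (verit) R_commute)

lemma pendant_path1:
  assumes "hole5 v1 v2 v3 v4 v5"
    "sees q1 [v1] [v2, v3, v4, v5]"
    "\<not> sees s [v1] [v2, v3, v4, v5]" "\<not> sees t [v1] [v2, v3, v4, v5]"
    "s \<in> V" "t \<in> V" "R s q1" "R q1 t" "\<not> R s t"
    "\<not> edge5 v1 v2 v3 v4 v5 s" "\<not> edge5 v1 v2 v3 v4 v5 t"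
    "\<not> (sees s [v1, v2, v3] [v4, v5] \<and> R q1 s)"
    "\<not> (sees s [v4, v5, v1] [v2, v3] \<and> R q1 s)"
    "\<not> (sees t [v1, v2, v3] [v4, v5] \<and> R q1 t)"
    "\<not> (sees t [v4, v5, v1] [v2, v3] \<and> R q1 t)"
  shows "False"
  using assms
    C4[of s q1 t v2] C4[of v2 v1 s v3] C4[of v2 v1 t v3] C4[of v5 s q1 v1] C4[of v5 t q1 v1]
    C4[of v5 v1 s v4] C4[of v5 v1 t v4] no_C6[of q1 s v3 v4 v5 v1] no_C6[of q1 s v4 v3 v2 v1]
    no_C6[of q1 t v3 v4 v5 v1] no_C6[of q1 t v4 v3 v2 v1] dom5[of v1 v5 v4 v3 v2 s]
    P6[of t q1 v1 v2 v3 v4]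
  unfolding cfg_defs edge5_def by (smt (verit) R_commute)

lemma pendant_path2:
  assumes "hole5 v1 v2 v3 v4 v5"
    "sees q1 [v1] [v2, v3, v4, v5]" "sees q2 [v1] [v2, v3, v4, v5]"
    "\<not> sees s [v1] [v2, v3, v4, v5]" "\<not> sees t [v1] [v2, v3, v4, v5]"
    "s \<in> V" "t \<in> V" "R s q1" "R q1 q2" "R q2 t" "\<not> R s t" "\<not> R s q2" "\<not> R q1 t"
    "\<not> edge5 v1 v2 v3 v4 v5 s" "\<not> edge5 v1 v2 v3 v4 v5 t"
    "\<not> (sees s [v1, v2, v3] [v4, v5] \<and> R q1 s)"
    "\<not> (sees s [v4, v5, v1] [v2, v3] \<and> R q1 s)"
    "\<not> (sees t [v1, v2, v3] [v4, v5] \<and> R q1 t)"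
    "\<not> (sees t [v4, v5, v1] [v2, v3] \<and> R q1 t)"
    "\<not> (sees s [v1, v2, v3] [v4, v5] \<and> R q2 s)"
    "\<not> (sees s [v4, v5, v1] [v2, v3] \<and> R q2 s)"
    "\<not> (sees t [v1, v2, v3] [v4, v5] \<and> R q2 t)"
    "\<not> (sees t [v4, v5, v1] [v2, v3] \<and> R q2 t)"
  shows "False"
  using assms
    C4[of v1 q2 t v5] C4[of v1 s v3 v2] C4[of v1 s v4 t] C4[of v1 s v4 v5] C4[of v2 s q1 v1]
    C4[of v2 s v4 v3] C4[of v2 t q2 v1] C4[of v3 s v5 t] C4[of v4 v3 s v5] C4[of v5 s q1 v1]
    no_C6[of q1 s v3 v4 v5 v1] no_C6[of q1 s v4 v3 v2 v1] no_C6[of q2 t v4 v3 v2 v1]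
    dom5[of v1 v5 v4 v3 v2 s] dom5[of v1 v5 v4 v3 v2 t] P6[of q1 q2 t v2 v3 v4]
    P6[of q1 q2 t v3 v4 v5] P6[of q2 q1 s v5 v4 v3]
  unfolding cfg_defs edge5_def by (smt (verit) R_commute)

definition pendant5 where
  "pendant5 v1 v2 v3 v4 v5 x \<longleftrightarrow>
  sees x [v1] [v2, v3, v4, v5] \<or> sees x [v2] [v3, v4, v5, v1] \<or>
     sees x [v3] [v4, v5, v1, v2] \<or> sees x [v4] [v5, v1, v2, v3] \<or> sees x [v5] [v1, v2, v3, v4]"

lemma hole5_universal:
  assumes "hole5 v1 v2 v3 v4 v5"
    "u \<in> V" "y \<in> V"
    "R u v1" "R u v2" "R u v3" "R u v4" "R u v5"
    "\<not> edge5 v1 v2 v3 v4 v5 y" "\<not> pendant5 v1 v2 v3 v4 v5 y"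
  shows "R u y"
  using assms
    C4[of u v1 y v3] C4[of u v2 y v5] C4[of u v3 y v5] C4[of v1 u v4 y] C4[of v2 u v4 y]
    dom5[of v1 v5 v4 v3 v2 y]
  unfolding cfg_defs edge5_def pendant5_def by (smt (verit) R_commute)

lemma hole5_twin:
  assumes "hole5 v1 v2 v3 v4 v5"
    "y \<in> V"
    "\<not> edge5 v1 v2 v3 v4 v5 y" "\<not> pendant5 v1 v2 v3 v4 v5 y"
    "\<not> (R y v1 \<and> R y v2 \<and> R y v3 \<and> R y v4 \<and> R y v5)"
  shows "sees y [v5, v1, v2] [v3, v4] \<or>
    sees y [v1, v2, v3] [v4, v5] \<or>
    sees y [v2, v3, v4] [v5, v1] \<or>
    sees y [v3, v4, v5] [v1, v2] \<or>
    sees y [v4, v5, v1] [v2, v3]"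
  using assms
    C4[of v2 v1 v5 y] C4[of v2 v1 y v3] C4[of v3 v2 y v4] C4[of v3 v4 v5 y] C4[of v5 v1 y v4]
    dom5[of v1 v5 v4 v3 v2 y]
  unfolding cfg_defs edge5_def pendant5_def by (smt (verit) R_commute)

text \<open>Private neighbours cannot exist on both sides, so the closed neighbourhoods of the twins
  of \<open>v1\<close> form a chain under inclusion, which \<open>ring5_nested\<close> orders by
  \<open>n\<close>.\<close>

lemma ring_nested:
  assumes "hole5 v1 v2 v3 v4 v5"
    "sees a [v5, v1, v2] [v3, v4]" "sees b [v5, v1, v2] [v3, v4]"
    "x \<in> V" "y \<in> V"
    "\<not> edge5 v1 v2 v3 v4 v5 x" "\<not> pendant5 v1 v2 v3 v4 v5 x"
    "\<not> (R x v1 \<and> R x v2 \<and> R x v3 \<and> R x v4 \<and> R x v5)"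
    "\<not> edge5 v1 v2 v3 v4 v5 y" "\<not> pendant5 v1 v2 v3 v4 v5 y"
    "\<not> (R y v1 \<and> R y v2 \<and> R y v3 \<and> R y v4 \<and> R y v5)"
    "R a x" "\<not> R b x" "R b y"
  shows "R a y"
  using assms
    C4[of a v2 y v5] C4[of b a x y] C4[of b v2 x v5] C4[of v1 x v3 y] C4[of v2 a v5 b]
    C4[of v3 v2 a x] C4[of v3 v2 b y] C4[of v4 v5 b y] C4[of v5 a x v4] no_C6[of a b y v3 v4 x]
    no_C6[of a b y v4 v3 x] dom5[of v2 a v5 v4 v3 y] dom5[of v2 b v5 v4 v3 x]
    no_pyramid[of v4 v3 x y v2 a b]
  unfolding cfg_defs edge5_def pendant5_def by (smt (verit) R_commute)

lemma ring_apart: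
  assumes "hole5 v1 v2 v3 v4 v5"
    "sees a [v5, v1, v2] [v3, v4]" "sees b [v2, v3, v4] [v5, v1]"
  shows "\<not> R a b"
  using assms
    C4[of v5 a b v4]
  unfolding cfg_defs edge5_def pendant5_def by (smt (verit) R_commute)

lemma ring_class:
  assumes "hole5 v1 v2 v3 v4 v5"
    "sees a [v5, v1, v2] [v3, v4]" "sees b [v5, v1, v2] [v3, v4]"
  shows "R a b"
  using assms
    C4[of a v2 b v5]
  unfolding cfg_defs edge5_def pendant5_def by (smt (verit) R_commute)

section \<open>Five-holes of maximal degree and the ring of cliques\<close>

definition max5 where
  "max5 a b c d e \<longleftrightarrow> hole5 a b c d e \<and>
     (\<forall>x. hole5 x b c d e \<longrightarrow> n x \<le>
       n a) \<and> (\<forall>x. hole5 a x c d e \<longrightarrow> n x \<le> n b) \<and>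
     (\<forall>x. hole5 a b x d e \<longrightarrow> n x \<le>
       n c) \<and> (\<forall>x. hole5 a b c x e \<longrightarrow> n x \<le> n d) \<and>
     (\<forall>x. hole5 a b c d x \<longrightarrow> n x \<le> n e)"

lemma hole5_rotate: "hole5 a b c d e \<Longrightarrow> hole5 b c d e a"
  unfolding hole5_def sees.simps by blast

lemma hole5_reflect: "hole5 a b c d e \<Longrightarrow> hole5 a e d c b"
  unfolding hole5_def sees.simps by blast

lemma hole5_V:
  assumes "hole5 a b c d e"
  shows "a \<in> V" "b \<in> V" "c \<in> V" "d \<in> V" "e \<in> V"
  using assms by (auto simp: hole5_def)

lemma max5_rotate:
  assumes "max5 a b c d e"
  shows "max5 b c d e a"
proof -
  note r = hole5_rotate[OF hole5_rotate[OF hole5_rotate[OF hole5_rotate]]]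
  have "n x \<le> n b" if "hole5 x c d e a" for x
    using r[OF that] assms by (simp add: max5_def)
  moreover have "n x \<le> n c" if "hole5 b x d e a" for x
    using r[OF that] assms by (simp add: max5_def)
  moreover have "n x \<le> n d" if "hole5 b c x e a" for x
    using r[OF that] assms by (simp add: max5_def)
  moreover have "n x \<le> n e" if "hole5 b c d x a" for x
    using r[OF that] assms by (simp add: max5_def)
  moreover have "n x \<le> n a" if "hole5 b c d e x" for x
    using r[OF that] assms by (simp add: max5_def)
  moreover have "hole5 b c d e a"
    using hole5_rotate[of a b c d e] assms by (simp add: max5_def)
  ultimately show ?thesis
    by (simp add: max5_def)
qed

lemma max5_reflect:
  assumes "max5 a b c d e"
  shows "max5 a e d c b"
proof -
  have "n x \<le> n a" if "hole5 x e d c b" for x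
    using hole5_reflect[OF that] assms by (simp add: max5_def)
  moreover have "n x \<le> n e" if "hole5 a x d c b" for x
    using hole5_reflect[OF that] assms by (simp add: max5_def)
  moreover have "n x \<le> n d" if "hole5 a e x c b" for x
    using hole5_reflect[OF that] assms by (simp add: max5_def)
  moreover have "n x \<le> n c" if "hole5 a e d x b" for x
    using hole5_reflect[OF that] assms by (simp add: max5_def)
  moreover have "n x \<le> n b" if "hole5 a e d c x" for x
    using hole5_reflect[OF that] assms by (simp add: max5_def)
  moreover have "hole5 a e d c b"
    using hole5_reflect[of a b c d e] assms by (simp add: max5_def)
  ultimately show ?thesis
    by (simp add: max5_def)
qed

lemma max5_exists:
  assumes "hole5 a b c d e"
  shows "\<exists>a b c d e. max5 a b c d e"
proof -
  define P where "P xs \<longleftrightarrow>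
    (\<exists>a b c d e. xs = [a, b, c, d, e] \<and> hole5 a b c d e)" for xs
  have "sum_list (map n xs) < 5 * D + 1" if "P xs" for xs
  proof -
    obtain a b c d e where x: "xs = [a, b, c, d, e]" and h: "hole5 a b c d e"
      using \<open>P xs\<close> unfolding P_def by blast
    then show ?thesis
      using hole5_V[OF h, THEN n_le] by simp
  qed
  moreover have "P [a, b, c, d, e]"
    using assms unfolding P_def by blast
  ultimately obtain xs where xs: "P xs"
    "\<And>ys. P ys \<Longrightarrow> sum_list (map n ys) \<le> sum_list (map n xs)"
    using ex_has_greatest_nat[of P _ "\<lambda>xs. sum_list (map n xs)" "5 * D + 1"] by blast
  then obtain a b c d e where h: "xs = [a, b, c, d, e]" "hole5 a b c d e"
    unfolding P_def by blast
  have le: "n a' + (n b' + (n c' + (n d' + n e'))) \<le> n a + (n b + (n c + (n d + n e)))"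
    if "hole5 a' b' c' d' e'" for a' b' c' d' e'
    using xs(2)[of "[a', b', c', d', e']"] that h(1) by (auto simp: P_def)
  have "max5 a b c d e"
    unfolding max5_def using h(2) le[of _ b c d e] le[of a _ c d e] le[of a b _ d e]
      le[of a b c _ e] le[of a b c d] by simp
  then show ?thesis
    by blast
qed

lemma no_across:
  assumes m: "max5 v1 v2 v3 v4 v5" and b: "sees b [v3, v4] [v1, v2, v5]"
    and a: "sees a [v4, v5, v1] [v2, v3]"
  shows "\<not> R b a"
proof
  assume ba: "R b a"
  have h: "hole5 v1 v2 v3 v4 v5"
    using m by (simp add: max5_def)
  have "hole5 v1 v2 v3 v4 a"
    using h a R_commute unfolding cfg_defs by blast
  then have "n a \<le> n v5"
    using m by (simp add: max5_def)
  moreover have "R a b" "\<not> R v5 b"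
    using ba b R_commute unfolding sees.simps by blast+
  ultimately obtain y where y: "R y v5" "\<not> R y a"
    using n_le_witness by blast
  have V: "y \<in> V" "b \<in> V" "v4 \<in> V"
    using y R_V b hole5_V[OF h] by auto
  note ax = h b a \<open>R a b\<close>
  have "R y b"
    by (rule below_adjacent[OF V]) (use across_below1[OF ax V(1) y] across_below2[OF ax V(1) y] in blast)+
  then show False
    using across_apart[OF ax V(1) y] by blast
qed

text \<open>\<open>below_adjacent\<close> makes the set \<open>Z\<close> of vertices that see
  exactly this edge a clique, because all their neighbours see \<open>v3\<close>. This disposes of
  the third outcome of \<open>attached_path\<close>, which needs two non-adjacent members of
  \<open>Z\<close>.\<close>

lemma no_edge:
  assumes m: "max5 v1 v2 v3 v4 v5"
  shows "\<not> sees b [v3, v4] [v1, v2, v5]"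
proof
  assume b: "sees b [v3, v4] [v1, v2, v5]"
  define Z where "Z = {b. sees b [v3, v4] [v1, v2, v5]}"
  have h: "hole5 v1 v2 v3 v4 v5"
    using m by (simp add: max5_def)
  have across: "\<not> (sees z [v1, v2, v3] [v4, v5] \<and> R q z)"
    "\<not> (sees z [v4, v5, v1] [v2, v3] \<and> R q z)"
    if "q \<in> Z" for q z
  proof -
    have q: "sees q [v3, v4] [v1, v2, v5]" "sees q [v4, v3] [v1, v5, v2]"
      using that unfolding Z_def sees.simps by blast+
    show "\<not> (sees z [v4, v5, v1] [v2, v3] \<and> R q z)"
      using no_across[OF m q(1)] by blast
    have "sees z [v1, v2, v3] [v4, v5] \<Longrightarrow> sees z [v3, v2, v1] [v5, v4]"
      unfolding sees.simps by blast
    then show "\<not> (sees z [v1, v2, v3] [v4, v5] \<and> R q z)"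
      using no_across[OF max5_reflect[OF m] q(2)] by blast
  qed
  have ZV: "q \<in> V" if "q \<in> Z" for q
    using that by (simp add: Z_def)
  have below: "R z v3" if "q \<in> Z" "z \<in> V" "R z q" for q z
    using edge_below[OF h _ that(2,3) across[OF that(1)]] that(1) by (simp add: Z_def)
  have RZ: "R p q" if "p \<in> Z" "q \<in> Z" for p q
    by (rule below_adjacent[OF ZV[OF that(1)] ZV[OF that(2)] hole5_V(3)[OF h] below[OF that(1)]
          below[OF that(2)]])
  show False
  proof (rule attached_path[of Z b v1])
    show "Z \<subseteq> V" "b \<in> Z"
      using b by (auto simp: Z_def)
    show "v1 \<in> V"
      using hole5_V[OF h] by simp
    then show "v1 \<notin> Z"
      using R_refl[of v1] by (simp add: Z_def)
    show "\<not> R v1 x" if "x \<in> Z" for x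
      using that R_sym[of v1 x] by (auto simp: Z_def)
  next
    fix s t q1
    assume a: "s \<in> V - Z" "t \<in> V - Z" "\<not> R s t" "q1 \<in> Z" "R s q1" "R q1 t"
    show False
      using edge_path1[OF h _ _ _ _ _ a(5,6,3) across[OF a(4)] across[OF a(4)]] a(1,2,4)
      unfolding Z_def by blast
  next
    fix s t q1 q2
    assume a: "s \<in> V - Z" "t \<in> V - Z" "\<not> R s t" "q1 \<in> Z" "q2 \<in> Z" "R s q1"
      "R q1 q2" "R q2 t"
      "\<not> R s q2" "\<not> R q1 t"
    show False
      using edge_path2[OF h _ _ _ _ _ _ a(6,7,8,3,9,10) across[OF a(4)] across[OF a(4)]
          across[OF a(5)] across[OF a(5)]] a(1,2,4,5)
      unfolding Z_def by blast
  next
    fix s t q1 q2 q3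
    assume "q1 \<in> Z" "q3 \<in> Z" "\<not> R q1 q3"
    then show False
      using RZ by blast
  qed
qed

lemma no_edge5:
  assumes m: "max5 v1 v2 v3 v4 v5"
  shows "\<not> edge5 v1 v2 v3 v4 v5 x"
proof -
  note m2 = max5_rotate[OF m]
  note m3 = max5_rotate[OF m2]
  note m4 = max5_rotate[OF m3]
  note m5 = max5_rotate[OF m4]
  show ?thesis
    unfolding edge5_def using no_edge[OF m] no_edge[OF m2] no_edge[OF m3] no_edge[OF m4] no_edge[OF m5]
    by blast
qed

lemma no_pendant_across:
  assumes m: "max5 v1 v2 v3 v4 v5" and d: "sees d [v1] [v2, v3, v4, v5]"
    and a: "sees a [v1, v2, v3] [v4, v5]"
  shows "\<not> R d a"
proof
  assume da: "R d a"
  have h: "hole5 v1 v2 v3 v4 v5"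
    using m by (simp add: max5_def)
  have "hole5 v1 a v3 v4 v5"
    using h a R_commute unfolding cfg_defs by blast
  then have "n a \<le> n v2"
    using m by (simp add: max5_def)
  moreover have "R a d" "\<not> R v2 d"
    using da d R_commute unfolding sees.simps by blast+
  ultimately obtain y where y: "R y v2" "\<not> R y a"
    using n_le_witness by blast
  then show False
    using pendant_across[OF h d a da _ y(1) no_edge5[OF m]] R_V by blast
qed

lemma no_pendant:
  assumes m: "max5 v1 v2 v3 v4 v5"
  shows "\<not> sees d [v1] [v2, v3, v4, v5]"
proof
  assume d: "sees d [v1] [v2, v3, v4, v5]"
  define Z where "Z = {d. sees d [v1] [v2, v3, v4, v5]}"
  have h: "hole5 v1 v2 v3 v4 v5"
    using m by (simp add: max5_def)
  note ne = no_edge5[OF m]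
  have across: "\<not> (sees z [v1, v2, v3] [v4, v5] \<and> R q z)"
    "\<not> (sees z [v4, v5, v1] [v2, v3] \<and> R q z)"
    if "q \<in> Z" for q z
  proof -
    have q: "sees q [v1] [v2, v3, v4, v5]" "sees q [v1] [v5, v4, v3, v2]"
      using that unfolding Z_def sees.simps by blast+
    show "\<not> (sees z [v1, v2, v3] [v4, v5] \<and> R q z)"
      using no_pendant_across[OF m q(1)] by blast
    have "sees z [v4, v5, v1] [v2, v3] \<Longrightarrow> sees z [v1, v5, v4] [v3, v2]"
      unfolding sees.simps by blast
    then show "\<not> (sees z [v4, v5, v1] [v2, v3] \<and> R q z)"
      using no_pendant_across[OF max5_reflect[OF m] q(2)] by blast
  qed
  have ZV: "q \<in> V" if "q \<in> Z" for q
    using that by (simp add: Z_def)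
  have below: "R z v1" if "q \<in> Z" "z \<in> V" "R z q" for q z
    using pendant_below[OF h _ that(2,3) ne] that(1) by (simp add: Z_def)
  have RZ: "R p q" if "p \<in> Z" "q \<in> Z" for p q
    by (rule below_adjacent[OF ZV[OF that(1)] ZV[OF that(2)] hole5_V(1)[OF h] below[OF that(1)]
          below[OF that(2)]])
  show False
  proof (rule attached_path[of Z d v3])
    show "Z \<subseteq> V" "d \<in> Z"
      using d by (auto simp: Z_def)
    show "v3 \<in> V"
      using hole5_V[OF h] by simp
    then show "v3 \<notin> Z"
      using R_refl[of v3] by (simp add: Z_def)
    show "\<not> R v3 x" if "x \<in> Z" for x
      using that R_sym[of v3 x] by (auto simp: Z_def)
  next
    fix s t q1
    assume a: "s \<in> V - Z" "t \<in> V - Z" "\<not> R s t" "q1 \<in> Z" "R s q1" "R q1 t"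
    show False
      using pendant_path1[OF h _ _ _ _ _ a(5,6,3) ne ne across[OF a(4)] across[OF a(4)]] a(1,2,4)
      unfolding Z_def by blast
  next
    fix s t q1 q2
    assume a: "s \<in> V - Z" "t \<in> V - Z" "\<not> R s t" "q1 \<in> Z" "q2 \<in> Z" "R s q1"
      "R q1 q2" "R q2 t"
      "\<not> R s q2" "\<not> R q1 t"
    show False
      using pendant_path2[OF h _ _ _ _ _ _ a(6,7,8,3,9,10) ne ne across[OF a(4)] across[OF a(4)]
          across[OF a(5)] across[OF a(5)]] a(1,2,4,5)
      unfolding Z_def by blast
  next
    fix s t q1 q2 q3
    assume "q1 \<in> Z" "q3 \<in> Z" "\<not> R q1 q3"
    then show False
      using RZ by blast
  qed
qed

lemma no_pendant5:
  assumes m: "max5 v1 v2 v3 v4 v5"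
  shows "\<not> pendant5 v1 v2 v3 v4 v5 x"
proof -
  note m2 = max5_rotate[OF m]
  note m3 = max5_rotate[OF m2]
  note m4 = max5_rotate[OF m3]
  note m5 = max5_rotate[OF m4]
  show ?thesis
    unfolding pendant5_def
    using no_pendant[OF m] no_pendant[OF m2] no_pendant[OF m3] no_pendant[OF m4] no_pendant[OF m5] by blast
qed

definition ring5 where
  "ring5 v1 v2 v3 v4 v5 \<longleftrightarrow>
  hole5 v1 v2 v3 v4 v5 \<and> (\<forall>y\<in>V. \<not> edge5 v1 v2 v3 v4 v5 y \<and>
     \<not> pendant5 v1 v2 v3 v4 v5 y \<and> \<not> (R y v1 \<and> R y v2 \<and> R y v3 \<and>
       R y v4 \<and> R y v5))"

lemma max5_ring:
  assumes m: "max5 v1 v2 v3 v4 v5"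
  shows "ring5 v1 v2 v3 v4 v5"
proof -
  have h: "hole5 v1 v2 v3 v4 v5"
    using m by (simp add: max5_def)
  have "\<not> (R y v1 \<and> R y v2 \<and> R y v3 \<and> R y v4 \<and> R y v5)" if "y \<in> V" for y
    using no_universal[OF that] hole5_universal[OF h that _ _ _ _ _ _ no_edge5[OF m] no_pendant5[OF m]]
    by blast
  then show ?thesis
    using h no_edge5[OF m] no_pendant5[OF m] by (simp add: ring5_def)
qed

lemma edge5_rotate: "edge5 v2 v3 v4 v5 v1 x \<longleftrightarrow> edge5 v1 v2 v3 v4 v5 x"
  by (simp only: edge5_def sees.simps conj_ac disj_ac)

lemma pendant5_rotate: "pendant5 v2 v3 v4 v5 v1 x \<longleftrightarrow> pendant5 v1 v2 v3 v4 v5 x"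
  by (simp only: pendant5_def sees.simps conj_ac disj_ac)

lemma edge5_reflect: "edge5 v1 v5 v4 v3 v2 x \<longleftrightarrow> edge5 v1 v2 v3 v4 v5 x"
  by (simp only: edge5_def sees.simps conj_ac disj_ac)

lemma pendant5_reflect: "pendant5 v1 v5 v4 v3 v2 x \<longleftrightarrow> pendant5 v1 v2 v3 v4 v5 x"
  by (simp only: pendant5_def sees.simps conj_ac disj_ac)

lemma ring5_rotate: "ring5 v1 v2 v3 v4 v5 \<Longrightarrow> ring5 v2 v3 v4 v5 v1"
  by (auto simp: ring5_def edge5_rotate pendant5_rotate hole5_rotate)

lemma ring5_reflect: "ring5 v1 v2 v3 v4 v5 \<Longrightarrow> ring5 v1 v5 v4 v3 v2"
  by (auto simp: ring5_def edge5_reflect pendant5_reflect hole5_reflect)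

abbreviation twin5 where
  "twin5 v1 v2 v3 v4 v5 x \<equiv> sees x [v5, v1, v2] [v3, v4]"

lemma ring5_twin:
  assumes "ring5 v1 v2 v3 v4 v5" "y \<in> V"
  shows "twin5 v1 v2 v3 v4 v5 y \<or> twin5 v2 v3 v4 v5 v1 y \<or> twin5 v3 v4 v5 v1 v2 y \<or>
    twin5 v4 v5 v1 v2 v3 y \<or> twin5 v5 v1 v2 v3 v4 y"
  using hole5_twin[of v1 v2 v3 v4 v5 y] assms unfolding ring5_def by blast

lemma ring5_hole: "ring5 v1 v2 v3 v4 v5 \<Longrightarrow> hole5 v1 v2 v3 v4 v5"
  by (simp add: ring5_def)

lemma ring5_nested:
  assumes r: "ring5 v1 v2 v3 v4 v5" and a: "twin5 v1 v2 v3 v4 v5 a" and b: "twin5 v1 v2 v3 v4 v5 b"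
    and le: "n a \<le> n b" and x: "R a x"
  shows "R b x"
proof (rule ccontr)
  assume bx: "\<not> R b x"
  then obtain y where y: "R y b" "\<not> R y a"
    using n_le_witness[OF le x] by blast
  have V: "x \<in> V" "y \<in> V"
    using x y R_V by blast+
  have "R a y"
    by (rule ring_nested[OF ring5_hole[OF r] a b V])
      (use r V x bx y R_sym in \<open>auto simp: ring5_def\<close>)
  then show False
    using y R_sym by blast
qed

text \<open>Let \<open>A\<^sub>i\<close> be the class of twins of \<open>v\<^sub>i\<close>. A vertex of \<open>A\<^sub>1\<close> with fewest neighbours forms a clique together with \<open>A\<^sub>1\<close> and its neighbours
  in \<open>A\<^sub>5\<close>; as its degree exceeds \<open>w\<close>, it has two neighbours in \<open>A\<^sub>2\<close>.\<close>

lemma ring5_second: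
  assumes r: "ring5 v1 v2 v3 v4 v5"
  shows "\<exists>q. twin5 v2 v3 v4 v5 v1 q \<and> q \<noteq> v2 \<and>
    (\<forall>a. twin5 v1 v2 v3 v4 v5 a \<longrightarrow> R q a)"
proof -
  note h = ring5_hole[OF r]
  have v1: "twin5 v1 v2 v3 v4 v5 v1"
    using h R_refl[OF hole5_V(1)[OF h]] unfolding cfg_defs by blast
  define m where "m = arg_min n (twin5 v1 v2 v3 v4 v5)"
  have m: "twin5 v1 v2 v3 v4 v5 m" and min: "\<And>a. twin5 v1 v2 v3 v4 v5 a
    \<Longrightarrow> n m \<le> n a"
    unfolding m_def using arg_min_nat_lemma[of "twin5 v1 v2 v3 v4 v5" v1 n, OF v1] by blast+
  \<comment> \<open>\<open>m\<close> is least in the chain of neighbourhoods, so what it sees is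
    seen by its whole class; any neighbour of \<open>m\<close> among the twins of \<open>v2\<close>
    other than \<open>v2\<close> will do as \<open>q\<close>.\<close>
  have up: "R a x" if "twin5 v1 v2 v3 v4 v5 a" "R m x" for a x
    using ring5_nested[OF r m that(1) min[OF that(1)] that(2)] .
  define C where "C = {x \<in> V. twin5 v1 v2 v3 v4 v5 x \<or> twin5 v5 v1 v2 v3 v4 x \<and> R m x}"
  define N where "N = {x \<in> V. twin5 v2 v3 v4 v5 v1 x \<and> R m x}"
  have r5: "ring5 v5 v1 v2 v3 v4"
    by (rule ring5_rotate[OF ring5_rotate[OF ring5_rotate[OF ring5_rotate[OF r]]]])
  have "cliq C"
    unfolding cliq_def C_def
    using ring_class[OF h] ring_class[OF ring5_hole[OF r5]] up R_sym by blast
  then have "card C \<le> w"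
    by (rule cliq_card)
  moreover have "{x \<in> V. R m x} \<subseteq> C \<union> N"
  proof
    fix x assume "x \<in> {x \<in> V. R m x}"
    then have x: "x \<in> V" "R m x"
      by blast+
    have h4: "hole5 v4 v5 v1 v2 v3"
      by (rule ring5_hole[OF ring5_rotate[OF ring5_rotate[OF ring5_rotate[OF r]]]])
    have "\<not> twin5 v3 v4 v5 v1 v2 x"
      using ring_apart[OF h m] x(2) by blast
    moreover have "\<not> twin5 v4 v5 v1 v2 v3 x"
      using ring_apart[OF h4, of x m] m x(2) R_sym by auto
    ultimately show "x \<in> C \<union> N"
      using ring5_twin[OF r x(1)] x unfolding C_def N_def by blast
  qed
  then have "n m \<le> card C + card N"
    using card_mono[of "C \<union> N" "{x \<in> V. R m x}"] card_Un_le[of C N] finite_V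
    by (simp add: C_def N_def)
  moreover have "w + 2 \<le> n m"
  proof -
    have "m \<in> V"
      using m by simp
    then show ?thesis
      using two_n[of m m m] by linarith
  qed
  ultimately have "2 \<le> card N"
    by linarith
  then have "\<not> N \<subseteq> {v2}"
    using card_mono[of "{v2}" N] by auto
  then obtain q where q: "q \<in> N" "q \<noteq> v2"
    by blast
  then have "\<forall>a. twin5 v1 v2 v3 v4 v5 a \<longrightarrow> R q a"
    using up R_sym unfolding N_def by blast
  then show ?thesis
    using q unfolding N_def by blast
qed


text \<open>\<open>v1\<close> itself sees both neighbouring classes, as their members are twins of
  \<open>v2\<close> and \<open>v5\<close>; the condition \<open>q \<noteq> v1\<close> asks for a
  second such vertex.\<close>

definition top5 where
  "top5 v1 v2 v3 v4 v5 q \<longleftrightarrow> twin5 v1 v2 v3 v4 v5 q \<and> q \<noteq> v1 \<and>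
     (\<forall>a. twin5 v2 v3 v4 v5 v1 a \<longrightarrow> R q a) \<and>
       (\<forall>a. twin5 v5 v1 v2 v3 v4 a \<longrightarrow> R q a)"

text \<open>\<open>ring5_second\<close> gives one twin complete to the class of \<open>v5\<close>
  and, by reflection, one complete to the class of \<open>v2\<close>. By nesting, the one with
  larger \<open>n\<close> is complete to both.\<close>

lemma ring5_top:
  assumes r: "ring5 v1 v2 v3 v4 v5"
  shows "\<exists>q. top5 v1 v2 v3 v4 v5 q"
proof -
  have r5: "ring5 v5 v1 v2 v3 v4"
    by (rule ring5_rotate[OF ring5_rotate[OF ring5_rotate[OF ring5_rotate[OF r]]]])
  obtain p where p: "twin5 v1 v2 v3 v4 v5 p" "p \<noteq> v1"
    "\<And>a. twin5 v5 v1 v2 v3 v4 a \<Longrightarrow> R p a"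
    using ring5_second[OF r5] by blast
  obtain q where q: "twin5 v1 v5 v4 v3 v2 q" "q \<noteq> v1"
    "\<And>a. twin5 v2 v1 v5 v4 v3 a \<Longrightarrow> R q a"
    using ring5_second[OF ring5_reflect[OF ring5_rotate[OF r]]] by blast
  have q1: "twin5 v1 v2 v3 v4 v5 q"
    using q(1) by simp
  have q2: "R q a" if "twin5 v2 v3 v4 v5 v1 a" for a
    using that by (intro q(3)) simp
  show ?thesis
  proof (cases "n p \<le> n q")
    case True
    then have "top5 v1 v2 v3 v4 v5 q"
      unfolding top5_def using q1 q(2) q2 p(3) ring5_nested[OF r p(1) q1] by blast
    then show ?thesis
      by blast
  next
    case False
    then have "top5 v1 v2 v3 v4 v5 p"
      unfolding top5_def using p q2 ring5_nested[OF r q1 p(1)] by (meson nat_le_linear)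
    then show ?thesis
      by blast
  qed
qed

definition tops5 where
  "tops5 v1 v2 v3 v4 v5 q1 q2 q3 q4 q5 \<longleftrightarrow>
  ring5 v1 v2 v3 v4 v5 \<and> top5 v1 v2 v3 v4 v5 q1 \<and>
     top5 v2 v3 v4 v5 v1 q2 \<and> top5 v3 v4 v5 v1 v2 q3 \<and> top5 v4 v5 v1 v2 v3 q4 \<and>
       top5 v5 v1 v2 v3 v4 q5"

lemma tops5_rotate: "tops5 v1 v2 v3 v4 v5 q1 q2 q3 q4 q5
  \<Longrightarrow> tops5 v2 v3 v4 v5 v1 q2 q3 q4 q5 q1"
  unfolding tops5_def using ring5_rotate by blast

lemma tops5_row:
  assumes t: "tops5 v1 v2 v3 v4 v5 q1 q2 q3 q4 q5" and y: "twin5 v1 v2 v3 v4 v5 y"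
  shows "sees y [v5, v1, v2, q5, q1, q2] [v3, v4, q3, q4]"
proof -
  have r: "ring5 v1 v2 v3 v4 v5"
    using t by (simp add: tops5_def)
  have h: "hole5 v1 v2 v3 v4 v5" "hole5 v4 v5 v1 v2 v3"
    using ring5_hole r ring5_rotate by blast+
  have q: "twin5 v1 v2 v3 v4 v5 q1" "twin5 v3 v4 v5 v1 v2 q3" "twin5 v4 v5 v1 v2 v3 q4" "R q2 y" "R q5 y"
    using t y unfolding tops5_def top5_def by blast+
  have "R y q1" "\<not> R y q3" "\<not> R q4 y"
    using ring_class[OF h(1) y q(1)] ring_apart[OF h(1) y q(2)] ring_apart[OF h(2) q(3) y] by blast+
  then show ?thesis
    using q y R_commute by auto
qed

lemma tops5_distinct:
  assumes t: "tops5 v1 v2 v3 v4 v5 q1 q2 q3 q4 q5"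
  shows "v1 \<noteq> q1" "{v1, q1} \<inter> {v2, v3, v4, v5, q2, q3, q4, q5} = {}"
proof -
  have "ring5 v1 v2 v3 v4 v5"
    using t by (simp add: tops5_def)
  note h = ring5_hole[OF this]
  have t': "twin5 v1 v2 v3 v4 v5 q1" "q1 \<noteq> v1" "twin5 v2 v3 v4 v5 v1 q2" "twin5 v3 v4 v5 v1 v2 q3"
    "twin5 v4 v5 v1 v2 v3 q4" "twin5 v5 v1 v2 v3 v4 q5"
    using t unfolding tops5_def top5_def by blast+
  show "v1 \<noteq> q1" "{v1, q1} \<inter> {v2, v3, v4, v5, q2, q3, q4, q5} = {}"
    using h t' R_refl unfolding hole5_def sees.simps by (simp_all, metis)
qed

text \<open>The four removed vertices of two consecutive classes are pairwise adjacent and complete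
  to both classes, so they enlarge the clique.\<close>

lemma tops5_clique:
  assumes t: "tops5 v1 v2 v3 v4 v5 q1 q2 q3 q4 q5" and K: "cliq K" "K \<inter> {v1, v2, q1, q2} = {}"
    and sub: "\<And>y. y \<in> K \<Longrightarrow> twin5 v1 v2 v3 v4 v5 y \<or> twin5 v2 v3 v4 v5 v1 y"
  shows "card K + 4 \<le> w"
proof -
  have y: "R y v1 \<and> R y v2 \<and> R y q1 \<and> R y q2"
    if "twin5 v1 v2 v3 v4 v5 y \<or> twin5 v2 v3 v4 v5 v1 y" for y
    using that tops5_row[OF t, of y] tops5_row[OF tops5_rotate[OF t], of y] by auto
  have "hole5 v1 v2 v3 v4 v5" "twin5 v1 v2 v3 v4 v5 q1" "twin5 v2 v3 v4 v5 v1 q2"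
    using t ring5_hole unfolding tops5_def top5_def by blast+
  then have "R x v1 \<and> R x v2 \<and> R x q1 \<and> R x q2" if "x \<in> {v1, v2, q1, q2}" for x
    using that y[of x] R_refl unfolding hole5_def by auto
  then have "cliq (K \<union> {v1, v2, q1, q2})"
    using K(1) sub y R_sym unfolding cliq_def by blast
  then have "card (K \<union> {v1, v2, q1, q2}) \<le> w"
    by (rule cliq_card)
  moreover have "finite K" "finite {v1, v2, q1, q2}"
    using cliq_subset[OF K(1)] finite_V finite_subset by auto
  moreover have "card {v1, v2, q1, q2} = 4"
    using tops5_distinct[OF t] tops5_distinct[OF tops5_rotate[OF t]] by auto
  ultimately show ?thesis
    using card_Un_disjoint[of K "{v1, v2, q1, q2}"] K(2) by linarith
qed

lemma tops5_degree:
  assumes t: "tops5 v1 v2 v3 v4 v5 q1 q2 q3 q4 q5" and y: "twin5 v1 v2 v3 v4 v5 y"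
    and X: "finite X" "{v1, v2, v5, q1, q2, q5} \<subseteq> X"
  shows "6 \<le> card {x \<in> X. R y x}"
proof -
  note t2 = tops5_rotate[OF t]
  note t5 = tops5_rotate[OF tops5_rotate[OF tops5_rotate[OF t2]]]
  have "{v1, v2, v5, q1, q2, q5} \<subseteq> {x \<in> X. R y x}"
    using tops5_row[OF t y] X(2) by auto
  moreover have "card {v1, v2, v5, q1, q2, q5} = 6"
    using tops5_distinct[OF t] tops5_distinct[OF t2] tops5_distinct[OF t5] by auto
  ultimately show ?thesis
    using card_mono[of "{x \<in> X. R y x}" "{v1, v2, v5, q1, q2, q5}"] X(1) by simp
qed

text \<open>Removing the vertices of a hole together with a top vertex of each class lowers every degree by
  6 and every clique by 4, and costs 5 colours: \<open>v\<^sub>i\<close> shares a colour with \<open>q\<^sub>i\<^sub>+\<^sub>2\<close>.\<close>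

lemma no_tops5: "\<not> tops5 v1 v2 v3 v4 v5 q1 q2 q3 q4 q5"
proof
  assume t: "tops5 v1 v2 v3 v4 v5 q1 q2 q3 q4 q5"
  note t2 = tops5_rotate[OF t]
  note t3 = tops5_rotate[OF t2]
  note t4 = tops5_rotate[OF t3]
  note t5 = tops5_rotate[OF t4]
  note d = tops5_distinct[OF t] tops5_distinct[OF t2] tops5_distinct[OF t3] tops5_distinct[OF t4]
    tops5_distinct[OF t5]
  define X where "X = {v1, v2, v3, v4, v5, q1, q2, q3, q4, q5}"
  define f where "f u = (if u \<in> {v1, q3} then 0 else if u \<in> {v2, q4} then 1 else
    if u \<in> {v3, q5} then 2 else if u \<in> {v4, q1} then 3 else (4::nat))" for u
  have r: "ring5 v1 v2 v3 v4 v5"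
    using t by (simp add: tops5_def)
  note h = ring5_hole[OF r]
  have q: "twin5 v1 v2 v3 v4 v5 q1" "twin5 v2 v3 v4 v5 v1 q2" "twin5 v3 v4 v5 v1 v2 q3"
    "twin5 v4 v5 v1 v2 v3 q4" "twin5 v5 v1 v2 v3 v4 q5"
    using t unfolding tops5_def top5_def by blast+
  have X: "X \<subseteq> V" "finite X"
    using q hole5_V[OF h] unfolding X_def by auto
  have "\<not> R v1 q3" "\<not> R v2 q4" "\<not> R v3 q5" "\<not> R v4 q1" "\<not> R v5 q2"
    using q R_sym by (meson sees.simps)+
  then have apart: "\<not> R x y" if "x \<in> X" "y \<in> X" "x \<noteq> y" "f x = f y" for x y
    using that R_sym unfolding X_def f_def by (auto split: if_splits)
  have type: "twin5 v1 v2 v3 v4 v5 y \<or> twin5 v2 v3 v4 v5 v1 y \<or> twin5 v3 v4 v5 v1 v2 y \<or>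
    twin5 v4 v5 v1 v2 v3 y \<or> twin5 v5 v1 v2 v3 v4 y" if "y \<in> V" for y
    using ring5_twin[OF r that] .
  have deg: "card {y \<in> V - X. R x y} + 6 \<le> D" if "x \<in> V" for x
  proof -
    have "6 \<le> card {u \<in> X. R x u}"
      using type[OF that] tops5_degree[OF t, of x X] tops5_degree[OF t2, of x X]
        tops5_degree[OF t3, of x X] tops5_degree[OF t4, of x X] tops5_degree[OF t5, of x X] X(2)
      unfolding X_def by blast
    moreover have "n x = card {y \<in> V - X. R x y} + card {u \<in> X. R x u}"
    proof -
      have "{y \<in> V. R x y} = {y \<in> V - X. R x y} \<union> {u \<in> X. R x u}"
        using X by blast
      then show ?thesis
        using finite_V X by (simp add: card_Un_disjoint disjoint_iff)
    qed
    ultimately show ?thesis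
      using n_le[OF that] by linarith
  qed
  show False
  proof (rule removal[of X 5 f 6 4])
    show "X \<subseteq> V" "X \<noteq> {}" "2 * 5 \<le> 6 + (4::nat)"
      using X by (auto simp: X_def)
    show "proper_colouring X E 5 f"
      unfolding proper_colouring_def
    proof (intro conjI ballI impI image_subsetI)
      show "f u \<in> {0..<5}" for u
        by (simp add: f_def)
      show "f u \<noteq> f v" if "u \<in> X" "v \<in> X" "E u v" for u v
        using apart[OF that(1,2)] that X(1) E_irrefl unfolding R_def by blast
    qed
    show "6 \<le> D"
      using deg[OF hole5_V(1)[OF h]] by linarith
    show "card {y \<in> V - X. R x y} + 6 \<le> D" if "x \<in> V - X" for x
      using deg that by blast
    show "card K + 4 \<le> w" if K: "cliq K" "K \<inter> X = {}" for K
    proof -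
      note h2 = hole5_rotate[OF h]
      note h3 = hole5_rotate[OF h2]
      note h4 = hole5_rotate[OF h3]
      note h5 = hole5_rotate[OF h4]
      have type': "twin5 v1 v2 v3 v4 v5 y \<or> twin5 v2 v3 v4 v5 v1 y \<or> twin5 v3 v4 v5 v1 v2 y \<or>
          twin5 v4 v5 v1 v2 v3 y \<or> twin5 v5 v1 v2 v3 v4 y" if "y \<in> K" for y
        using type that cliq_subset[OF K(1)] by blast
      have KR: "R x y" if "x \<in> K" "y \<in> K" for x y
        using K(1) that by (simp add: cliq_def)
      \<comment> \<open>Non-consecutive classes have no edges between them, by
        \<open>ring_apart\<close>, so a clique lies within two consecutive classes.\<close>
      have "(\<forall>y\<in>K. twin5 v1 v2 v3 v4 v5 y \<or> twin5 v2 v3 v4 v5 v1 y) \<or>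
        (\<forall>y\<in>K. twin5 v2 v3 v4 v5 v1 y \<or> twin5 v3 v4 v5 v1 v2 y) \<or>
        (\<forall>y\<in>K. twin5 v3 v4 v5 v1 v2 y \<or> twin5 v4 v5 v1 v2 v3 y) \<or>
        (\<forall>y\<in>K. twin5 v4 v5 v1 v2 v3 y \<or> twin5 v5 v1 v2 v3 v4 y) \<or>
        (\<forall>y\<in>K. twin5 v5 v1 v2 v3 v4 y \<or> twin5 v1 v2 v3 v4 v5 y)"
        using type' KR ring_apart[OF h] ring_apart[OF h2] ring_apart[OF h3] ring_apart[OF h4]
          ring_apart[OF h5] by metis
      moreover have "K \<inter> {v1, v2, q1, q2} = {}" "K \<inter> {v2, v3, q2, q3} = {}"
        "K \<inter> {v3, v4, q3, q4} = {}"
        "K \<inter> {v4, v5, q4, q5} = {}" "K \<inter> {v5, v1, q5, q1} = {}"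
        using K(2) unfolding X_def by blast+
      ultimately show ?thesis
        using tops5_clique[OF t K(1)] tops5_clique[OF t2 K(1)] tops5_clique[OF t3 K(1)]
          tops5_clique[OF t4 K(1)] tops5_clique[OF t5 K(1)] by blast
    qed
  qed
qed

lemma no_hole5: "\<not> hole5 a b c d e"
proof
  assume "hole5 a b c d e"
  then obtain v1 v2 v3 v4 v5 where r: "ring5 v1 v2 v3 v4 v5"
    using max5_exists max5_ring by blast
  note r2 = ring5_rotate[OF r]
  note r3 = ring5_rotate[OF r2]
  note r4 = ring5_rotate[OF r3]
  note r5 = ring5_rotate[OF r4]
  obtain q1 q2 q3 q4 q5 where "top5 v1 v2 v3 v4 v5 q1" "top5 v2 v3 v4 v5 v1 q2"
    "top5 v3 v4 v5 v1 v2 q3" "top5 v4 v5 v1 v2 v3 q4" "top5 v5 v1 v2 v3 v4 q5"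
    using ring5_top[OF r] ring5_top[OF r2] ring5_top[OF r3] ring5_top[OF r4] ring5_top[OF r5] by blast
  then show False
    using no_tops5[of v1 v2 v3 v4 v5 q1 q2 q3 q4 q5] r by (simp add: tops5_def)
qed

text \<open>By now the graph is chordal, and this is Dirac's argument for a clique cutset:
  \<open>b\<close> closes the three outcomes of \<open>attached_path\<close> into holes of length 4,
  5 and 6.\<close>

lemma no_critical_graph: False
proof -
  obtain b y where b: "b \<in> V" "y \<in> V" "\<not> R b y"
    using V_nonempty no_universal by blast
  define Z where "Z = {x \<in> V. \<not> R b x}"
  show False
  proof (rule attached_path[of Z y b])
    show "Z \<subseteq> V" "y \<in> Z" "b \<in> V"
      "b \<notin> Z" and "\<And>z. z \<in> Z \<Longrightarrow> \<not> R b z"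
      using b R_refl by (auto simp: Z_def)
  next
    fix s t q1
    assume "s \<in> V - Z" "t \<in> V - Z" "\<not> R s t" "q1 \<in> Z" "R s q1" "R q1 t"
    then show False
      using C4[of b s q1 t] R_sym unfolding Z_def by blast
  next
    fix s t q1 q2
    assume "s \<in> V - Z" "t \<in> V - Z" "\<not> R s t" "q1 \<in> Z" "q2 \<in> Z" "R s q1" "R q1 q2"
      "R q2 t"
      "\<not> R s q2" "\<not> R q1 t"
    then have "hole5 b s q1 q2 t"
      using b R_commute unfolding Z_def cfg_defs by blast
    then show False
      using no_hole5 by blast
  next
    fix s t q1 q2 q3
    assume "s \<in> V - Z" "t \<in> V - Z" "\<not> R s t" "q1 \<in> Z" "q2 \<in> Z" "q3 \<in> Z"
      "R s q1" "R q1 q2" "R q2 q3" "R q3 t" "\<not> R s q2" "\<not> R s q3" "\<not> R q1 q3"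
      "\<not> R q1 t" "\<not> R q2 t"
    then have "hole6 b s q1 q2 q3 t"
      using b R_commute unfolding Z_def cfg_defs by blast
    then show False
      using no_hole6 by blast
  qed
qed

end

section \<open>The bound\<close>

lemma has_induced_mono:
  assumes "W \<subseteq> V"
  shows "has_induced_P6 W E \<Longrightarrow> has_induced_P6 V E"
    "has_induced_C4 W E \<Longrightarrow> has_induced_C4 V E"
  using assms unfolding has_induced_P6_def has_induced_C4_def by (meson subset_trans)+

text \<open>Induction over proper subsets with \<open>D\<close>, \<open>w\<close>, \<open>k\<close>
  arbitrary makes a failing \<open>V\<close> a \<open>critical_graph\<close>. The relation
  \<open>E\<close> stays fixed and is not restricted to \<open>V\<close>.\<close>

lemma colouring_bound:
  assumes "finite V" and E: "\<And>u v. E u v \<Longrightarrow> E v u" "\<And>v. \<not> E v v"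
    and free: "\<not> has_induced_P6 V E" "\<not> has_induced_C4 V E"
    and "\<And>x. x \<in> V \<Longrightarrow> card {y \<in> V. x = y \<or> E x y} \<le> D"
    and "\<And>K. is_clique V E K \<Longrightarrow> card K \<le> w"
    and "D + w \<le> 2 * k"
  shows "\<exists>c. proper_colouring V E k c"
  using assms(1,4-8)
proof (induction V arbitrary: D w k rule: finite_psubset_induct)
  case (psubset V)
  show ?case
  proof (rule ccontr)
    assume none: "\<nexists>c. proper_colouring V E k c"
    interpret critical_graph V E D w k
    proof
      show "\<exists>c. proper_colouring W E k' c"
        if "W \<subset> V"
          "\<And>x. x \<in> W \<Longrightarrow> card {y \<in> W. x = y \<or> E x y} \<le> D'"
          "\<And>K. is_clique W E K \<Longrightarrow> card K \<le> w'"
          "D' + w' \<le> 2 * k'" for W D' w' k'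
        using psubset.IH[OF that(1) _ _ that(2-4)] has_induced_mono[of W V E] psubset.prems that(1) by blast
    qed (use psubset E none in auto)
    show False
      by (rule no_critical_graph)
  qed
qed

theorem theorem1p2:
  fixes V :: "'a set" and E :: "'a \<Rightarrow> 'a \<Rightarrow> bool"
  assumes "simple_graph V E"
    and "\<not> has_induced_P6 V E"
    and "\<not> has_induced_C4 V E"
  shows "int (chromatic_number V E)
           \<le> \<lceil>(real (max_degree V E) + real (clique_number V E) + 1) / 2\<rceil>"
proof -
  let ?D = "max_degree V E" and ?w = "clique_number V E"
  \<comment> \<open>The ceiling of half a natural number \<open>j\<close> is
    \<open>(j + 1) div 2\<close>, here with \<open>j = ?D + ?w + 1\<close>.\<close>
  define k where "k = (?D + ?w + 2) div 2"
  have G: "finite V" "\<And>u v. E u v \<Longrightarrow> E v u" "\<And>v. \<not> E v v"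
    using assms(1) by (auto simp: simple_graph_def)
  have "\<exists>c. proper_colouring V E k c"
  proof (rule colouring_bound[OF G assms(2,3)])
    show "card {y \<in> V. x = y \<or> E x y} \<le> ?D + 1" if x: "x \<in> V" for x
    proof -
      have "{y \<in> V. x = y \<or> E x y} = insert x {y \<in> V. E x y}"
        using x by blast
      then have "card {y \<in> V. x = y \<or> E x y} = degree V E x + 1"
        using G by (simp add: degree_def)
      then show ?thesis
        using G(1) x by (simp add: max_degree_def)
    qed
    show "card K \<le> ?w" if "is_clique V E K" for K
    proof -
      have "{K. is_clique V E K} \<subseteq> Pow V"
        by (auto simp: is_clique_def)
      then have "finite {K. is_clique V E K}"
        using G(1) finite_subset by blast
      then have "finite {card K |K. is_clique V E K}"
        by simp
      then show ?thesis
        unfolding clique_number_def using that by (intro Max_ge) auto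
    qed
    show "?D + 1 + ?w \<le> 2 * k"
      by (simp add: k_def)
  qed
  then have "chromatic_number V E \<le> k"
    unfolding chromatic_number_def by (rule Least_le)
  then have "2 * chromatic_number V E \<le> ?D + ?w + 2"
    by (simp add: k_def)
  then have "2 * real (chromatic_number V E) \<le> real ?D + real ?w + 2"
    by linarith
  then show ?thesis
    \<comment> \<open>An integer is at most a ceiling iff its predecessor is below the real number,
      which absorbs the rounding.\<close>
    by (simp add: le_ceiling_iff)
qed

end
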